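(* For every $h>0$, $$\lim_{\alpha\to+\infty}\|u_{h\alpha q_{h\alpha_{op}}}-u_{hq_{h_{op}}}\|_V=0,\qquad \lim_{\alpha\to+\infty}\|p_{h\alpha q_{h\alpha_{op}}}-p_{hq_{h_{op}}}\|_V=0,\qquad \lim_{\alpha\to+\infty}\|q_{h\alpha_{op}}-q_{h_{op}}\|_Q=0 .$$
   Context: Setting. $\Omega\subset\mathbb{R}^n$ is a bounded polygonal domain with regular boundary $\Gamma=\partial\Omega=\Gamma_1\cup\Gamma_2$, a union of two disjoint portions of positive measure. $H=L^2(\Omega)$, $V=H^1(\Omega)$, $Q=L^2(\Gamma_2)$. $b>0$ is a constant, $g,z_d\in H$ and $M>0$ are given. $(u,v)_H=\int_\Omega uv\,dx$, $(q,v)_Q=\int_{\Gamma_2}qv\,d\gamma$ (with the trace of $v$), $a(u,v)=\int_\Omega\nabla u\cdot\nabla v\,dx$ and, for $\alpha>0$, $a_\alpha(u,v)=a(u,v)+\alpha\int_{\Gamma_1}uv\,d\gamma$. Discretization. For $h>0$, $\tau_h$ is a regular triangulation of $\Omega$ by Lagrange triangles of type 1 (affine-equivalent finite elements of class $C^0$), $h$ being the longest side of the triangles. $V_h=\{v_h\in C^0(\overline\Omega): v_h|_T\in P_1(T)\ \forall T\in\tau_h\}$ ($P_1$: polynomials of degree $\le1$), $V_{0h}=\{v_h\in V_h: v_h=0\text{ on }\Gamma_1\}$, $K_h=b+V_{0h}$. Problem $(P_h)$. For $q\in Q$: $u_{hq}\in K_h$ solves $a(u_{hq},v_h)=(g,v_h)_H-(q,v_h)_Q$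 for all $v_h\in V_{0h}$; $p_{hq}\in V_{0h}$ solves $a(p_{hq},v_h)=(u_{hq}-z_d,v_h)_H$ for all $v_h\in V_{0h}$. $J_h(q)=\frac12\|u_{hq}-z_d\|_H^2+\frac M2\|q\|_Q^2$, and $q_{h_{op}}$ is the unique minimizer of $J_h$ over $Q$. Problem $(P_{h\alpha})$. For $q\in Q$, $\alpha>0$: $u_{h\alpha q}\in V_h$ solves $a_\alpha(u_{h\alpha q},v_h)=(g,v_h)_H-(q,v_h)_Q+\alpha\int_{\Gamma_1}bv_h\,d\gamma$ for all $v_h\in V_h$; $p_{h\alpha q}\in V_h$ solves $a_\alpha(p_{h\alpha q},v_h)=(u_{h\alpha q}-z_d,v_h)_H$ for all $v_h\in V_h$. $J_{h\alpha}(q)=\frac12\|u_{h\alpha q}-z_d\|_H^2+\frac M2\|q\|_Q^2$, and $q_{h\alpha_{op}}$ is the unique minimizer of $J_{h\alpha}$ over $Q$. *)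

theory Defs
  imports "HOL-Analysis.Analysis"
begin

section \<open>Surface measure\<close>

text \<open>
  The surface measure on the boundary of a domain in a Euclidean space of dimension \<open>n\<close> is the
  \<open>(n - 1)\<close>-dimensional Hausdorff measure, normalised so that it agrees with Lebesgue measure on
  hyperplanes. Covers consist of bounded sets, because \<^const>\<open>diameter\<close> is unspecified on
  unbounded ones; the empty set costs nothing also in dimension \<open>0\<close>, where \<open>0 ^ 0 = 1\<close>.
\<close>

definition hausdorff_pre :: "nat \<Rightarrow> real \<Rightarrow> 'a::euclidean_space set \<Rightarrow> ennreal" where
  "hausdorff_pre d \<delta> A =
     (INF U \<in> {U :: nat \<Rightarrow> 'a set. A \<subseteq> (\<Union>i. U i) \<and> (\<forall>i. bounded (U i) \<and> diameter (U i) \<le> \<delta>)}.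
        (\<Sum>i. if U i = {} then 0
             else ennreal (unit_ball_vol (real d) * (diameter (U i) / 2) ^ d)))"

definition hausdorff_outer :: "nat \<Rightarrow> 'a::euclidean_space set \<Rightarrow> ennreal" where
  "hausdorff_outer d A = (SUP \<delta>\<in>{0<..}. hausdorff_pre d \<delta> A)"

definition hausdorff_measure :: "nat \<Rightarrow> 'a::euclidean_space measure" where
  "hausdorff_measure d = measure_of UNIV (sets borel) (hausdorff_outer d)"

lemma sets_hausdorff_measure [simp, measurable_cong]:
  "sets (hausdorff_measure d) = sets (borel :: 'a::euclidean_space measure)"
  unfolding hausdorff_measure_def
  using sets.sigma_sets_eq[of "borel :: 'a measure"] by simp

lemma space_hausdorff_measure [simp]: "space (hausdorff_measure d) = UNIV"
  unfolding hausdorff_measure_def by simp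

definition surface_measure :: "'a::euclidean_space set \<Rightarrow> 'a measure" where
  "surface_measure S = restrict_space (hausdorff_measure (DIM('a) - 1)) S"

section \<open>Square-integrable functions\<close>

text \<open>
  Elements of \<open>L\<^sup>2\<close> are represented by functions; all notions below are invariant under changes
  on null sets.
\<close>

definition L2 :: "'a measure \<Rightarrow> ('a \<Rightarrow> real) set" where
  "L2 M = {f \<in> borel_measurable M. integrable M (\<lambda>x. (f x)\<^sup>2)}"

definition L2_inner :: "'a measure \<Rightarrow> ('a \<Rightarrow> real) \<Rightarrow> ('a \<Rightarrow> real) \<Rightarrow> real" where
  "L2_inner M f g = (LINT x|M. f x * g x)"

definition L2_norm :: "'a measure \<Rightarrow> ('a \<Rightarrow> real) \<Rightarrow> real" where
  "L2_norm M f = sqrt (L2_inner M f f)"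

section \<open>Weak gradients and the norm of \<open>H\<^sup>1\<close>\<close>

text \<open>By mollification, \<open>C\<^sup>1\<close> test functions define the same weak gradient as smooth ones.\<close>

definition test_function ::
  "'a::euclidean_space set \<Rightarrow> ('a \<Rightarrow> real) \<Rightarrow> ('a \<Rightarrow> 'a) \<Rightarrow> bool" where
  "test_function \<Omega> \<phi> D\<phi> \<longleftrightarrow>
     (\<forall>x. GDERIV \<phi> x :> D\<phi> x) \<and> continuous_on UNIV D\<phi> \<and>
     compact (closure {x. \<phi> x \<noteq> 0}) \<and> closure {x. \<phi> x \<noteq> 0} \<subseteq> \<Omega>"

definition locally_integrable ::
  "'a::euclidean_space set \<Rightarrow> ('a \<Rightarrow> 'b::{banach, second_countable_topology}) \<Rightarrow> bool" where
  "locally_integrable \<Omega> f \<longleftrightarrow> (\<forall>K. compact K \<and> K \<subseteq> \<Omega> \<longrightarrow> integrable (lebesgue_on K) f)"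

definition is_weak_gradient ::
  "'a::euclidean_space set \<Rightarrow> ('a \<Rightarrow> real) \<Rightarrow> ('a \<Rightarrow> 'a) \<Rightarrow> bool" where
  "is_weak_gradient \<Omega> v G \<longleftrightarrow>
     locally_integrable \<Omega> v \<and> locally_integrable \<Omega> G \<and>
     (\<forall>\<phi> D\<phi>. test_function \<Omega> \<phi> D\<phi> \<longrightarrow>
        (LINT x|lebesgue_on \<Omega>. v x *\<^sub>R D\<phi> x) = - (LINT x|lebesgue_on \<Omega>. \<phi> x *\<^sub>R G x))"

text \<open>The weak gradient is determined almost everywhere on \<open>\<Omega>\<close>.\<close>

definition weak_gradient ::
  "'a::euclidean_space set \<Rightarrow> ('a \<Rightarrow> real) \<Rightarrow> 'a \<Rightarrow> 'a" where
  "weak_gradient \<Omega> v = (SOME G. is_weak_gradient \<Omega> v G)"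

definition dirichlet_form ::
  "'a::euclidean_space set \<Rightarrow> ('a \<Rightarrow> real) \<Rightarrow> ('a \<Rightarrow> real) \<Rightarrow> real" where
  "dirichlet_form \<Omega> u v =
     (LINT x|lebesgue_on \<Omega>. inner (weak_gradient \<Omega> u x) (weak_gradient \<Omega> v x))"

definition H1_norm :: "'a::euclidean_space set \<Rightarrow> ('a \<Rightarrow> real) \<Rightarrow> real" where
  "H1_norm \<Omega> v =
     sqrt ((L2_norm (lebesgue_on \<Omega>) v)\<^sup>2 +
           (LINT x|lebesgue_on \<Omega>. (norm (weak_gradient \<Omega> v x))\<^sup>2))"

definition robin_form ::
  "'a::euclidean_space set \<Rightarrow> 'a set \<Rightarrow> real \<Rightarrow> ('a \<Rightarrow> real) \<Rightarrow> ('a \<Rightarrow> real) \<Rightarrow> real" where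
  "robin_form \<Omega> \<Gamma>1 \<alpha> u v = dirichlet_form \<Omega> u v + \<alpha> * L2_inner (surface_measure \<Gamma>1) u v"

section \<open>Domains and meshes\<close>

definition polygonal_domain :: "'a::euclidean_space set \<Rightarrow> bool" where
  "polygonal_domain \<Omega> \<longleftrightarrow>
     open \<Omega> \<and> connected \<Omega> \<and> bounded \<Omega> \<and> \<Omega> \<noteq> {} \<and>
     (\<exists>\<P>. finite \<P> \<and> (\<forall>P\<in>\<P>. polytope P) \<and> closure \<Omega> = \<Union>\<P>)"

text \<open>
  Near each boundary point, \<open>\<Omega>\<close> is the strict epigraph, in some direction \<open>\<nu>\<close>, of a Lipschitz
  function of the component orthogonal to \<open>\<nu>\<close>.
\<close>

definition lipschitz_boundary :: "'a::euclidean_space set \<Rightarrow> bool" where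
  "lipschitz_boundary \<Omega> \<longleftrightarrow>
     (\<forall>x\<in>frontier \<Omega>. \<exists>r>0. \<exists>\<nu>. norm \<nu> = 1 \<and>
        (\<exists>f :: 'a \<Rightarrow> real. \<exists>L. lipschitz_on L UNIV f \<and>
           \<Omega> \<inter> ball x r = {y \<in> ball x r. f (y - inner y \<nu> *\<^sub>R \<nu>) < inner y \<nu>}))"

definition mesh_size :: "'a::euclidean_space set set \<Rightarrow> real" where
  "mesh_size \<tau> =
     Max (\<Union>T\<in>\<tau>. {dist x y | x y. x extreme_point_of T \<and> y extreme_point_of T})"

text \<open>
  Shape regularity bounds a family of meshes as \<open>h\<close> tends to \<open>0\<close>; it is no restriction on a
  single mesh.
\<close>

definition triangulation_of ::
  "'a::euclidean_space set \<Rightarrow> real \<Rightarrow> 'a set set \<Rightarrow> bool" where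
  "triangulation_of \<Omega> h \<tau> \<longleftrightarrow>
     triangulation \<tau> \<and> (\<forall>T\<in>\<tau>. int DIM('a) simplex T) \<and> \<Union>\<tau> = closure \<Omega> \<and> mesh_size \<tau> = h"

section \<open>Finite element spaces\<close>

text \<open>
  A function on \<open>closure \<Omega>\<close> is represented by its extension by \<open>0\<close>, so that a
  function on \<open>closure \<Omega>\<close> has exactly one representative and \<open>THE\<close> below is meaningful. The trace of such a continuous function is its
  restriction to the boundary.
\<close>

definition P1_on :: "'a::euclidean_space set \<Rightarrow> ('a \<Rightarrow> real) \<Rightarrow> bool" where
  "P1_on T v \<longleftrightarrow> (\<exists>a c. \<forall>x\<in>T. v x = inner a x + c)"

definition Vh :: "'a::euclidean_space set \<Rightarrow> 'a set set \<Rightarrow> ('a \<Rightarrow> real) set" where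
  "Vh \<Omega> \<tau> = {v. continuous_on (closure \<Omega>) v \<and> (\<forall>T\<in>\<tau>. P1_on T v) \<and> (\<forall>x. x \<notin> closure \<Omega> \<longrightarrow> v x = 0)}"

text \<open>
  As for every trace, \<open>v = 0\<close> on \<open>\<Gamma>1\<close> is meant almost everywhere for the surface measure. If each
  relatively open part of \<open>\<Gamma>1\<close> has positive measure, this is the same as pointwise vanishing.
\<close>

definition V0h ::
  "'a::euclidean_space set \<Rightarrow> 'a set \<Rightarrow> 'a set set \<Rightarrow> ('a \<Rightarrow> real) set" where
  "V0h \<Omega> \<Gamma>1 \<tau> = {v \<in> Vh \<Omega> \<tau>. AE x in surface_measure \<Gamma>1. v x = 0}"

definition Kh ::
  "'a::euclidean_space set \<Rightarrow> 'a set \<Rightarrow> 'a set set \<Rightarrow> real \<Rightarrow> ('a \<Rightarrow> real) set" where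
  "Kh \<Omega> \<Gamma>1 \<tau> b = {\<lambda>x. b * indicator (closure \<Omega>) x + v x | v. v \<in> V0h \<Omega> \<Gamma>1 \<tau>}"

section \<open>The control problem with Dirichlet condition on \<open>\<Gamma>1\<close>\<close>

definition state_h ::
  "'a::euclidean_space set \<Rightarrow> 'a set \<Rightarrow> 'a set \<Rightarrow> 'a set set \<Rightarrow> real \<Rightarrow> ('a \<Rightarrow> real) \<Rightarrow>
   ('a \<Rightarrow> real) \<Rightarrow> 'a \<Rightarrow> real" where
  "state_h \<Omega> \<Gamma>1 \<Gamma>2 \<tau> b g q =
     (THE u. u \<in> Kh \<Omega> \<Gamma>1 \<tau> b \<and>
        (\<forall>v\<in>V0h \<Omega> \<Gamma>1 \<tau>. dirichlet_form \<Omega> u v =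
           L2_inner (lebesgue_on \<Omega>) g v - L2_inner (surface_measure \<Gamma>2) q v))"

definition adjoint_h ::
  "'a::euclidean_space set \<Rightarrow> 'a set \<Rightarrow> 'a set \<Rightarrow> 'a set set \<Rightarrow> real \<Rightarrow> ('a \<Rightarrow> real) \<Rightarrow>
   ('a \<Rightarrow> real) \<Rightarrow> ('a \<Rightarrow> real) \<Rightarrow> 'a \<Rightarrow> real" where
  "adjoint_h \<Omega> \<Gamma>1 \<Gamma>2 \<tau> b g zd q =
     (THE p. p \<in> V0h \<Omega> \<Gamma>1 \<tau> \<and>
        (\<forall>v\<in>V0h \<Omega> \<Gamma>1 \<tau>. dirichlet_form \<Omega> p v =
           L2_inner (lebesgue_on \<Omega>) (\<lambda>x. state_h \<Omega> \<Gamma>1 \<Gamma>2 \<tau> b g q x - zd x) v))"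

definition cost_h ::
  "'a::euclidean_space set \<Rightarrow> 'a set \<Rightarrow> 'a set \<Rightarrow> 'a set set \<Rightarrow> real \<Rightarrow> ('a \<Rightarrow> real) \<Rightarrow>
   ('a \<Rightarrow> real) \<Rightarrow> real \<Rightarrow> ('a \<Rightarrow> real) \<Rightarrow> real" where
  "cost_h \<Omega> \<Gamma>1 \<Gamma>2 \<tau> b g zd M q =
     1 / 2 * (L2_norm (lebesgue_on \<Omega>) (\<lambda>x. state_h \<Omega> \<Gamma>1 \<Gamma>2 \<tau> b g q x - zd x))\<^sup>2 +
     M / 2 * (L2_norm (surface_measure \<Gamma>2) q)\<^sup>2"

section \<open>The control problem with Robin condition on \<open>\<Gamma>1\<close>\<close>

definition state_ha ::
  "'a::euclidean_space set \<Rightarrow> 'a set \<Rightarrow> 'a set \<Rightarrow> 'a set set \<Rightarrow> real \<Rightarrow> ('a \<Rightarrow> real) \<Rightarrow>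
   real \<Rightarrow> ('a \<Rightarrow> real) \<Rightarrow> 'a \<Rightarrow> real" where
  "state_ha \<Omega> \<Gamma>1 \<Gamma>2 \<tau> b g \<alpha> q =
     (THE u. u \<in> Vh \<Omega> \<tau> \<and>
        (\<forall>v\<in>Vh \<Omega> \<tau>. robin_form \<Omega> \<Gamma>1 \<alpha> u v =
           L2_inner (lebesgue_on \<Omega>) g v - L2_inner (surface_measure \<Gamma>2) q v +
           \<alpha> * L2_inner (surface_measure \<Gamma>1) (\<lambda>x. b) v))"

definition adjoint_ha ::
  "'a::euclidean_space set \<Rightarrow> 'a set \<Rightarrow> 'a set \<Rightarrow> 'a set set \<Rightarrow> real \<Rightarrow> ('a \<Rightarrow> real) \<Rightarrow>
   ('a \<Rightarrow> real) \<Rightarrow> real \<Rightarrow> ('a \<Rightarrow> real) \<Rightarrow> 'a \<Rightarrow> real" where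
  "adjoint_ha \<Omega> \<Gamma>1 \<Gamma>2 \<tau> b g zd \<alpha> q =
     (THE p. p \<in> Vh \<Omega> \<tau> \<and>
        (\<forall>v\<in>Vh \<Omega> \<tau>. robin_form \<Omega> \<Gamma>1 \<alpha> p v =
           L2_inner (lebesgue_on \<Omega>) (\<lambda>x. state_ha \<Omega> \<Gamma>1 \<Gamma>2 \<tau> b g \<alpha> q x - zd x) v))"

definition cost_ha ::
  "'a::euclidean_space set \<Rightarrow> 'a set \<Rightarrow> 'a set \<Rightarrow> 'a set set \<Rightarrow> real \<Rightarrow> ('a \<Rightarrow> real) \<Rightarrow>
   ('a \<Rightarrow> real) \<Rightarrow> real \<Rightarrow> real \<Rightarrow> ('a \<Rightarrow> real) \<Rightarrow> real" where
  "cost_ha \<Omega> \<Gamma>1 \<Gamma>2 \<tau> b g zd M \<alpha> q =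
     1 / 2 * (L2_norm (lebesgue_on \<Omega>) (\<lambda>x. state_ha \<Omega> \<Gamma>1 \<Gamma>2 \<tau> b g \<alpha> q x - zd x))\<^sup>2 +
     M / 2 * (L2_norm (surface_measure \<Gamma>2) q)\<^sup>2"

end

theory Submission
  imports Defs
begin

text \<open>
  On a fixed mesh everything takes place in the finite-dimensional space \<open>V\<close> of continuous piecewise
  affine functions; only the control ranges over an infinite-dimensional space, and it acts on the
  states through the functional \<open>v \<mapsto> (q, v)\<close> alone. Write \<open>A\<close> for the Dirichlet form, \<open>G\<close> for
  the inner product on \<open>\<Gamma>1\<close> and \<open>V0\<close> for the null space of \<open>G\<close>. The form \<open>A + G\<close> is an inner product
  on \<open>V\<close>: a function with \<open>A v v = 0\<close> is constant, and a constant that vanishes on a set of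
  positive measure is \<open>0\<close>.

  \<^emph>\<open>Penalisation.\<close> Let \<open>u\<close> solve the Dirichlet problem and \<open>u\<^sub>\<alpha>\<close> the Robin problem for the same
  load, and let \<open>e\<close> be their difference. The boundary data cancel and
  \<open>A e v + \<alpha> * G e v = r v\<close>, where \<open>r\<close> is the residual of \<open>u\<close>; it vanishes on \<open>V0\<close>. A functional that
  vanishes on the null space of a seminorm on a finite-dimensional space is bounded by that seminorm, so
  \<open>\<bar>r v\<bar>\<close> is at most a constant times \<open>sqrt (G v v)\<close> (\<open>trace_lifting\<close>, \<open>residual_bound\<close>). Testing with
  \<open>v = e\<close> gives an error of order \<open>1 / \<alpha>\<close> for \<open>A e e + G e e\<close> (\<open>penalty_estimate\<close>), and the constant
  is uniform for controls in a bounded set (\<open>state_error\<close>). The adjoint states obey the same estimate,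
  with the state error as an additional load (\<open>adjoint_error\<close>).

  \<^emph>\<open>Controls.\<close> The penalised costs are bounded along the optimal controls \<open>q\<^sub>\<alpha>\<close>, hence so are the
  \<open>q\<^sub>\<alpha>\<close>, and by uniformity the penalised and the unpenalised cost of \<open>q\<^sub>\<alpha>\<close> have difference tending to
  \<open>0\<close>. So the unpenalised cost of \<open>q\<^sub>\<alpha>\<close> tends to its minimum. The cost is strongly
  convex in the control, which forces \<open>q\<^sub>\<alpha>\<close> to converge to the minimiser
  (\<open>cost_strongly_convex\<close>, \<open>convergence\<close>). States and adjoint states follow by the error estimates.

  Two analytic facts place the concrete problem in this setting. First, the surface
  measure of the boundary is finite, because the boundary is covered by finitely many Lipschitz graphs
  (\<open>finite_surface_measure\<close>); so finite element functions are square integrable on \<open>\<Gamma>1\<close> and \<open>\<Gamma>2\<close>.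
  Secondly, weak gradients are unique almost everywhere (\<open>weak_gradient_unique\<close>), and the weak
  gradient of a finite element function is its piecewise classical gradient
  (\<open>grad_is_weak_gradient\<close>); so the Dirichlet form is bilinear on \<open>V\<close> and detects constants.
\<close>

section \<open>Semi-inner products on spaces of functions\<close>

text \<open>
  The dimension of the finite element space depends on the mesh, so it is not tied to a type: a linear
  space is a set of functions closed under linear combinations, and finite dimension is expressed by a finite set of points whose values
  determine a function; this property passes to subspaces at once.
\<close>

locale function_space =
  fixes W :: "('x \<Rightarrow> real) set"
  assumes zero_mem: "(\<lambda>_. 0) \<in> W"
    and lincomb_mem: "\<And>u v c. u \<in> W \<Longrightarrow> v \<in> W \<Longrightarrow> (\<lambda>x. u x + c * v x) \<in> W"
begin

lemma add_mem: "u \<in> W \<Longrightarrow> v \<in> W \<Longrightarrow> (\<lambda>x. u x + v x) \<in> W"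
  using lincomb_mem[of u v 1] by simp

lemma diff_mem: "u \<in> W \<Longrightarrow> v \<in> W \<Longrightarrow> (\<lambda>x. u x - v x) \<in> W"
  using lincomb_mem[of u v "-1"] by simp

lemma scale_mem: "u \<in> W \<Longrightarrow> (\<lambda>x. c * u x) \<in> W"
  using lincomb_mem[OF zero_mem, of u c] by simp

lemma sum_mem: "finite E \<Longrightarrow> E \<subseteq> W \<Longrightarrow> (\<lambda>x. \<Sum>e\<in>E. c e * e x) \<in> W"
proof (induction rule: finite_induct)
  case empty
  then show ?case by (simp add: zero_mem)
next
  case (insert e E)
  then show ?case
    using lincomb_mem[of "\<lambda>x. \<Sum>e\<in>E. c e * e x" e "c e"] by (simp add: add.commute)
qed

end

definition linear_on :: "('x \<Rightarrow> real) set \<Rightarrow> (('x \<Rightarrow> real) \<Rightarrow> real) \<Rightarrow> bool" where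
  "linear_on W l \<longleftrightarrow> (\<forall>u\<in>W. \<forall>v\<in>W. \<forall>c. l (\<lambda>x. u x + c * v x) = l u + c * l v)"

lemma linear_onD: "linear_on W l \<Longrightarrow> u \<in> W \<Longrightarrow> v \<in> W \<Longrightarrow> l (\<lambda>x. u x + c * v x) = l u + c * l v"
  by (simp add: linear_on_def)

lemma (in function_space) linear_on_diff:
  "linear_on W l \<Longrightarrow> u \<in> W \<Longrightarrow> v \<in> W \<Longrightarrow> l (\<lambda>x. u x - v x) = l u - l v"
  using linear_onD[of W l u v "-1"] by simp

lemma (in function_space) linear_on_zero: "linear_on W l \<Longrightarrow> l (\<lambda>_. 0) = 0"
  using linear_on_diff[of l, OF _ zero_mem zero_mem] by simp

lemma (in function_space) linear_on_sum:
  assumes l: "linear_on W l" and "finite E" "E \<subseteq> W"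
  shows "l (\<lambda>x. \<Sum>e\<in>E. c e * e x) = (\<Sum>e\<in>E. c e * l e)"
  using assms(2,3)
proof (induction rule: finite_induct)
  case empty
  then show ?case by (simp add: linear_on_zero[OF l])
next
  case (insert e E)
  then show ?case
    using linear_onD[OF l, of "\<lambda>x. \<Sum>e\<in>E. c e * e x" e "c e"] sum_mem[of E c]
    by (simp add: add.commute)
qed

locale semi_inner = function_space W for W :: "('x \<Rightarrow> real) set" +
  fixes B :: "('x \<Rightarrow> real) \<Rightarrow> ('x \<Rightarrow> real) \<Rightarrow> real"
  assumes sym: "\<And>u v. u \<in> W \<Longrightarrow> v \<in> W \<Longrightarrow> B u v = B v u"
    and lincomb_left: "\<And>u v w c. u \<in> W \<Longrightarrow> v \<in> W \<Longrightarrow> w \<in> W \<Longrightarrow>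
          B (\<lambda>x. u x + c * v x) w = B u w + c * B v w"
    and nonneg: "\<And>u. u \<in> W \<Longrightarrow> 0 \<le> B u u"
begin

definition nrm :: "('x \<Rightarrow> real) \<Rightarrow> real" where "nrm u = sqrt (B u u)"

lemma linear_on_left: "w \<in> W \<Longrightarrow> linear_on W (\<lambda>u. B u w)"
  by (simp add: linear_on_def lincomb_left)

lemma linear_on_right: "w \<in> W \<Longrightarrow> linear_on W (B w)"
  by (simp add: linear_on_def lincomb_left lincomb_mem sym[of w])

lemmas diff_left = linear_on_diff[OF linear_on_left]
lemmas diff_right = linear_on_diff[OF linear_on_right]
lemmas lincomb_right = linear_onD[OF linear_on_right]

lemma zero_left: "w \<in> W \<Longrightarrow> B (\<lambda>_. 0) w = 0"
  by (rule linear_on_zero[OF linear_on_left])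

lemma nrm_nonneg: "u \<in> W \<Longrightarrow> 0 \<le> nrm u"
  by (simp add: nrm_def nonneg)

lemma nrm_sq: "u \<in> W \<Longrightarrow> (nrm u)\<^sup>2 = B u u"
  by (simp add: nrm_def nonneg)

lemma square_lincomb:
  assumes "u \<in> W" "v \<in> W"
  shows "B (\<lambda>x. u x + c * v x) (\<lambda>x. u x + c * v x) = B u u + 2 * c * B u v + c\<^sup>2 * B v v"
  using assms
  by (simp add: lincomb_left lincomb_right lincomb_mem sym[of v u] power2_eq_square algebra_simps)

lemma square_diff:
  assumes "u \<in> W" "v \<in> W"
  shows "B (\<lambda>x. u x - v x) (\<lambda>x. u x - v x) = B u u - 2 * B u v + B v v"
  using square_lincomb[OF assms, of "-1"] by simp

lemma square_midpoint:
  assumes "u \<in> W" "v \<in> W"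
  shows "B (\<lambda>x. (u x + v x) / 2) (\<lambda>x. (u x + v x) / 2)
       = (B u u + B v v) / 2 - B (\<lambda>x. v x - u x) (\<lambda>x. v x - u x) / 4"
proof -
  have mid: "(\<lambda>x. (u x + v x) / 2) = (\<lambda>x. u x + (1 / 2) * (\<lambda>x. v x - u x) x)"
    by (auto simp: fun_eq_iff field_simps)
  show ?thesis
    unfolding mid square_lincomb[OF assms(1) diff_mem[OF assms(2,1)]] square_diff[OF assms(2,1)]
      diff_right[OF assms(1,2,1)]
    by (simp add: sym[OF assms(2,1)] power2_eq_square field_simps)
qed

lemma cauchy_schwarz:
  assumes u: "u \<in> W" and v: "v \<in> W"
  shows "\<bar>B u v\<bar> \<le> nrm u * nrm v"
proof -
  have *: "0 \<le> B u u + 2 * c * B u v + c\<^sup>2 * B v v" for c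
    using nonneg[OF lincomb_mem[OF u v, of c]] square_lincomb[OF u v] by simp
  have "(B u v)\<^sup>2 \<le> B u u * B v v"
  proof (cases "B v v = 0")
    case True
    have "B u v = 0"
    proof (rule ccontr)
      assume "B u v \<noteq> 0"
      then show False
        using *[of "- (B u u + 1) / (2 * B u v)"] True by (simp add: field_simps)
    qed
    then show ?thesis using True by simp
  next
    case False
    then have "0 < B v v" using nonneg[OF v] by simp
    then show ?thesis
      using *[of "- B u v / B v v"] by (simp add: field_simps power2_eq_square)
  qed
  then have "sqrt ((B u v)\<^sup>2) \<le> sqrt (B u u * B v v)" by (rule real_sqrt_le_mono)
  then show ?thesis by (simp add: nrm_def real_sqrt_mult)
qed

lemma null_right: "u \<in> W \<Longrightarrow> v \<in> W \<Longrightarrow> B u u = 0 \<Longrightarrow> B v u = 0"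
  using cauchy_schwarz[of v u] by (simp add: nrm_def)

lemma nrm_lincomb:
  assumes u: "u \<in> W" and v: "v \<in> W"
  shows "nrm (\<lambda>x. u x + c * v x) \<le> nrm u + \<bar>c\<bar> * nrm v"
proof (rule power2_le_imp_le)
  have "c * B u v \<le> \<bar>c\<bar> * (nrm u * nrm v)"
    using mult_left_mono[OF cauchy_schwarz[OF u v], of "\<bar>c\<bar>"] by (simp flip: abs_mult)
  then show "(nrm (\<lambda>x. u x + c * v x))\<^sup>2 \<le> (nrm u + \<bar>c\<bar> * nrm v)\<^sup>2"
    using u v
    by (simp add: nrm_sq lincomb_mem square_lincomb power2_sum power_mult_distrib mult.left_commute)
  show "0 \<le> nrm u + \<bar>c\<bar> * nrm v"
    using u v by (simp add: nrm_nonneg)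
qed

lemma nrm_zero: "nrm (\<lambda>_. 0) = 0"
  by (simp add: nrm_def zero_left zero_mem)

lemma nrm_diff: "u \<in> W \<Longrightarrow> v \<in> W \<Longrightarrow> nrm (\<lambda>x. u x - v x) \<le> nrm u + nrm v"
  using nrm_lincomb[of u v "-1"] by simp

lemma nrm_sum:
  assumes "finite E" "E \<subseteq> W"
  shows "nrm (\<lambda>x. \<Sum>e\<in>E. c e * e x) \<le> (\<Sum>e\<in>E. \<bar>c e\<bar> * nrm e)"
  using assms
proof (induction rule: finite_induct)
  case empty
  then show ?case by (simp add: nrm_zero)
next
  case (insert e E)
  then have eW: "e \<in> W" and EW: "E \<subseteq> W" by auto
  have eq: "(\<lambda>x. \<Sum>f\<in>insert e E. c f * f x) = (\<lambda>x. (\<Sum>f\<in>E. c f * f x) + c e * e x)"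
    by (simp only: sum.insert[OF insert.hyps] add.commute)
  have "nrm (\<lambda>x. (\<Sum>f\<in>E. c f * f x) + c e * e x)
        \<le> nrm (\<lambda>x. \<Sum>f\<in>E. c f * f x) + \<bar>c e\<bar> * nrm e"
    by (rule nrm_lincomb[OF sum_mem[OF insert.hyps(1) EW] eW])
  also have "\<dots> \<le> (\<Sum>f\<in>E. \<bar>c f\<bar> * nrm f) + \<bar>c e\<bar> * nrm e"
    using insert.IH[OF EW] by simp
  finally show ?case
    unfolding eq by (simp only: sum.insert[OF insert.hyps] add.commute)
qed

lemma semi_inner_subset:
  assumes "function_space U" and "U \<subseteq> W"
  shows "semi_inner U B"
proof -
  interpret U: function_space U by fact
  show ?thesis
    by unfold_locales (use assms(2) in \<open>auto simp: sym lincomb_left nonneg subset_iff\<close>)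
qed

end

locale finite_inner = semi_inner W B for W :: "('x \<Rightarrow> real) set" and B +
  fixes X :: "'x set"
  assumes finite_nodes: "finite X"
    and determined: "\<And>u. u \<in> W \<Longrightarrow> (\<And>x. x \<in> X \<Longrightarrow> u x = 0) \<Longrightarrow> u = (\<lambda>_. 0)"
    and definite: "\<And>u. u \<in> W \<Longrightarrow> B u u = 0 \<Longrightarrow> u = (\<lambda>_. 0)"

text \<open>
  Gram-Schmidt by induction on the points: the functions that vanish at one of the points form a
  subspace of codimension at most \<open>1\<close>, determined by the remaining points.
\<close>
lemma (in semi_inner) orthonormal_basis_exists:
  assumes "finite X" and "function_space U" and "U \<subseteq> W"
    and "\<And>u. u \<in> U \<Longrightarrow> (\<And>x. x \<in> X \<Longrightarrow> u x = 0) \<Longrightarrow> u = (\<lambda>_. 0)"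
    and "\<And>u. u \<in> U \<Longrightarrow> B u u = 0 \<Longrightarrow> u = (\<lambda>_. 0)"
  shows "\<exists>E. finite E \<and> E \<subseteq> U \<and> (\<forall>e\<in>E. \<forall>f\<in>E. B e f = (if e = f then 1 else 0)) \<and>
             (\<forall>u\<in>U. u = (\<lambda>x. \<Sum>e\<in>E. B u e * e x))"
  using assms
proof (induction X arbitrary: U rule: finite_induct)
  case empty
  then have "\<forall>u\<in>U. u = (\<lambda>_. 0)" by blast
  then show ?case by (intro exI[of _ "{}"]) auto
next
  case (insert y X)
  interpret U: function_space U by fact
  have UW: "u \<in> W" if "u \<in> U" for u using that insert.prems(2) by blast
  let ?U' = "{u \<in> U. u y = 0}"
  have fs: "function_space ?U'"
    by unfold_locales (auto simp: U.zero_mem U.lincomb_mem)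
  have sub: "?U' \<subseteq> W" using insert.prems(2) by auto
  have det: "u = (\<lambda>_. 0)" if "u \<in> ?U'" "\<And>x. x \<in> X \<Longrightarrow> u x = 0" for u
    using that by (intro insert.prems(3)) auto
  have def': "u = (\<lambda>_. 0)" if "u \<in> ?U'" "B u u = 0" for u
    using that insert.prems(4) by blast
  obtain E where basis: "finite E \<and> E \<subseteq> ?U' \<and>
      (\<forall>e\<in>E. \<forall>f\<in>E. B e f = (if e = f then 1 else 0)) \<and>
      (\<forall>u\<in>?U'. u = (\<lambda>x. \<Sum>e\<in>E. B u e * e x))"
    using insert.IH[OF fs sub det def'] by (rule exE)
  note E = basis[THEN conjunct1] basis[THEN conjunct2, THEN conjunct1]
    basis[THEN conjunct2, THEN conjunct2, THEN conjunct1, rule_format]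
  note rep = basis[THEN conjunct2, THEN conjunct2, THEN conjunct2, THEN bspec]
  show ?case
  proof (cases "?U' = U")
    case True
    show ?thesis using basis unfolding True by (rule exI)
  next
    case False
    then obtain u where u: "u \<in> U" "u y \<noteq> 0" by blast
    define z where "z = (\<lambda>x. u x - (\<Sum>e\<in>E. B u e * e x))"
    have EU: "E \<subseteq> U" using E by blast
    have EW: "E \<subseteq> W" using EU UW by blast
    have s: "(\<lambda>x. \<Sum>e\<in>E. B u e * e x) \<in> U" by (rule U.sum_mem[OF E(1) EU])
    have zU: "z \<in> U" unfolding z_def by (rule U.diff_mem[OF u(1) s])
    have "(\<Sum>e\<in>E. B u e * e y) = 0" using E(2) by (intro sum.neutral) auto
    then have zy: "z y \<noteq> 0" using u by (simp add: z_def)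
    have ze: "B z e = 0" if e: "e \<in> E" for e
    proof -
      have eW: "e \<in> W" using e EW by blast
      have "B (\<lambda>x. \<Sum>f\<in>E. B u f * f x) e = (\<Sum>f\<in>E. B u f * B f e)"
        by (rule linear_on_sum[OF linear_on_left[OF eW] E(1) EW])
      also have "\<dots> = (\<Sum>f\<in>E. if f = e then B u e else 0)"
        by (intro sum.cong) (auto simp: E(3) e)
      also have "\<dots> = B u e" using e E(1) by simp
      finally show ?thesis
        unfolding z_def using diff_left[OF eW UW[OF u(1)] UW[OF s]] by simp
    qed
    have zpos: "0 < B z z"
      using nonneg[OF UW[OF zU]] insert.prems(4)[OF zU] zy by (cases "B z z = 0") auto
    define f where "f = (\<lambda>x. (1 / sqrt (B z z)) * z x)"
    have fU: "f \<in> U" unfolding f_def by (rule U.scale_mem[OF zU])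
    have Bf: "B f w = B z w / sqrt (B z z)" if "w \<in> W" for w
      using lincomb_left[OF zero_mem UW[OF zU] that, of "1 / sqrt (B z z)"] zero_left[OF that]
      by (simp add: f_def)
    have ff: "B f f = 1"
    proof -
      have "B f f = B z f / sqrt (B z z)" by (rule Bf[OF UW[OF fU]])
      also have "B z f = B f z" by (rule sym[OF UW[OF zU] UW[OF fU]])
      also have "B f z = B z z / sqrt (B z z)" by (rule Bf[OF UW[OF zU]])
      finally show ?thesis using zpos by simp
    qed
    have fe: "B f e = 0" "B e f = 0" if "e \<in> E" for e
    proof -
      have eW: "e \<in> W" using that EW by blast
      show "B f e = 0" using Bf[OF eW] ze[OF that] by simp
      then show "B e f = 0" using sym[OF eW UW[OF fU]] by simp
    qed
    have fE: "f \<notin> E" using ff fe by fastforce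
    have fy: "f y \<noteq> 0" using zy zpos by (simp add: f_def)
    have "v = (\<lambda>x. \<Sum>e\<in>insert f E. B v e * e x)" if v: "v \<in> U" for v
    proof -
      define c where "c = v y / f y"
      define w where "w = (\<lambda>x. v x + (- c) * f x)"
      have w: "w \<in> ?U'"
        unfolding w_def using U.lincomb_mem[OF v fU, of "- c"] fy by (simp add: c_def)
      then have wW: "w \<in> W" using sub by blast
      have vw: "v = (\<lambda>x. w x + c * f x)" by (simp add: w_def)
      have ve: "B v e = B w e" if "e \<in> E" for e
        using lincomb_left[OF wW UW[OF fU], of e c] that EW fe(1)[OF that] by (auto simp flip: vw)
      have wf: "B w f = 0"
      proof -
        have "B (\<lambda>x. \<Sum>e\<in>E. B w e * e x) f = (\<Sum>e\<in>E. B w e * B e f)"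
          by (rule linear_on_sum[OF linear_on_left[OF UW[OF fU]] E(1) EW])
        then show ?thesis using rep[OF w] fe(2) by simp
      qed
      have vf: "B v f = c"
        using lincomb_left[OF wW UW[OF fU] UW[OF fU], of c] wf ff by (simp flip: vw)
      show ?thesis
      proof
        fix x
        have "v x = w x + c * f x" using vw by metis
        also have "w x = (\<Sum>e\<in>E. B w e * e x)" using rep[OF w] by metis
        finally show "v x = (\<Sum>e\<in>insert f E. B v e * e x)"
          using fE E(1) by (simp add: vf ve)
      qed
    qed
    then show ?thesis
      using E fU EU ff fe fE by (intro exI[of _ "insert f E"]) auto
  qed
qed

context finite_inner
begin

lemma orthonormal_basis:
  obtains E where "finite E" "E \<subseteq> W" "\<And>e f. e \<in> E \<Longrightarrow> f \<in> E \<Longrightarrow> B e f = (if e = f then 1 else 0)"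
    "\<And>u. u \<in> W \<Longrightarrow> u = (\<lambda>x. \<Sum>e\<in>E. B u e * e x)"
proof -
  obtain E where basis: "finite E \<and> E \<subseteq> W \<and>
      (\<forall>e\<in>E. \<forall>f\<in>E. B e f = (if e = f then 1 else 0)) \<and>
      (\<forall>u\<in>W. u = (\<lambda>x. \<Sum>e\<in>E. B u e * e x))"
    using orthonormal_basis_exists[OF finite_nodes function_space_axioms order_refl determined definite]
    by (rule exE)
  show ?thesis
    by (rule that[OF basis[THEN conjunct1] basis[THEN conjunct2, THEN conjunct1]
        basis[THEN conjunct2, THEN conjunct2, THEN conjunct1, rule_format]
        basis[THEN conjunct2, THEN conjunct2, THEN conjunct2, THEN bspec]])
qed

text \<open>Expanding in an orthonormal basis solves \<open>B u v = l v\<close> explicitly; definiteness gives uniqueness.\<close>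
lemma riesz:
  assumes l: "linear_on W l"
  shows "\<exists>!u. u \<in> W \<and> (\<forall>v\<in>W. B u v = l v)"
proof -
  obtain E where E: "finite E" "E \<subseteq> W"
    and rep: "\<And>u. u \<in> W \<Longrightarrow> u = (\<lambda>x. \<Sum>e\<in>E. B u e * e x)"
    by (rule orthonormal_basis) blast
  define u where "u = (\<lambda>x. \<Sum>e\<in>E. l e * e x)"
  have u: "u \<in> W" unfolding u_def by (rule sum_mem[OF E])
  have "B u v = l v" if v: "v \<in> W" for v
  proof -
    have "B u v = (\<Sum>e\<in>E. l e * B e v)"
      unfolding u_def by (rule linear_on_sum[OF linear_on_left[OF v] E])
    also have "\<dots> = (\<Sum>e\<in>E. B v e * l e)"
      using E(2) v by (intro sum.cong) (auto simp: sym)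
    also have "\<dots> = l (\<lambda>x. \<Sum>e\<in>E. B v e * e x)"
      by (rule linear_on_sum[OF l E, symmetric])
    finally show ?thesis unfolding rep[OF v, symmetric] .
  qed
  moreover have "w = u" if w: "w \<in> W" "\<forall>v\<in>W. B w v = l v" for w
  proof -
    have "B (\<lambda>x. w x - u x) (\<lambda>x. w x - u x) = 0"
      using diff_left[OF diff_mem[OF w(1) u] w(1) u] w(2) \<open>\<And>v. v \<in> W \<Longrightarrow> B u v = l v\<close>
        diff_mem[OF w(1) u] by simp
    then have "(\<lambda>x. w x - u x) = (\<lambda>_. 0)" by (rule definite[OF diff_mem[OF w(1) u]])
    then show ?thesis by (auto simp: fun_eq_iff)
  qed
  ultimately show ?thesis using u by blast
qed

text \<open>
  By Cauchy-Schwarz the coefficients in an orthonormal basis are bounded by the norm, so the sum of the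
  seminorms of the basis vectors is a valid constant.
\<close>
lemma seminorm_bounded:
  assumes "semi_inner W' N" and "W \<subseteq> W'"
  obtains C where "0 \<le> C" "\<And>u. u \<in> W \<Longrightarrow> semi_inner.nrm N u \<le> C * nrm u"
proof -
  interpret N: semi_inner W' N by fact
  obtain E where E: "finite E" "E \<subseteq> W"
    and on: "\<And>e f. e \<in> E \<Longrightarrow> f \<in> E \<Longrightarrow> B e f = (if e = f then 1 else 0)"
    and rep: "\<And>u. u \<in> W \<Longrightarrow> u = (\<lambda>x. \<Sum>e\<in>E. B u e * e x)"
    by (rule orthonormal_basis) blast
  have EW': "E \<subseteq> W'" using E(2) assms(2) by blast
  have nn: "0 \<le> N.nrm e" if "e \<in> E" for e using N.nrm_nonneg that EW' by blast
  show thesis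
  proof (rule that)
    show "0 \<le> (\<Sum>e\<in>E. N.nrm e)" by (intro sum_nonneg nn)
    fix u assume u: "u \<in> W"
    have "N.nrm u \<le> (\<Sum>e\<in>E. \<bar>B u e\<bar> * N.nrm e)"
      using N.nrm_sum[OF E(1) EW', of "B u"] unfolding rep[OF u, symmetric] .
    also have "\<dots> \<le> (\<Sum>e\<in>E. nrm u * N.nrm e)"
    proof (intro sum_mono mult_right_mono nn)
      fix e assume e: "e \<in> E"
      then show "\<bar>B u e\<bar> \<le> nrm u"
        using cauchy_schwarz[OF u, of e] E(2) on[OF e e] by (auto simp: nrm_def)
    qed
    finally show "N.nrm u \<le> (\<Sum>e\<in>E. N.nrm e) * nrm u"
      by (simp add: sum_distrib_left mult.commute)
  qed
qed

lemma finite_inner_subspace: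
  assumes "function_space U" and "U \<subseteq> W"
  shows "finite_inner U B X"
proof -
  interpret U: semi_inner U B by (rule semi_inner_subset[OF assms])
  show ?thesis
    by unfold_locales (use assms(2) finite_nodes determined definite in blast)+
qed

end

section \<open>Penalisation of an essential boundary condition\<close>

text \<open>
  Think of \<open>A\<close> as the Dirichlet form and of \<open>G\<close> as the inner product of the traces on \<open>\<Gamma>1\<close>. Then \<open>V0\<close> is
  the space of functions with zero trace and \<open>E \<alpha>\<close> is the Robin form; the norm of \<open>E 1\<close> serves as energy
  norm.
\<close>

locale penalised_problem =
  A: semi_inner V A + G: semi_inner V G
  for V :: "('x \<Rightarrow> real) set" and A G +
  fixes X :: "'x set"
  assumes finite_X: "finite X"
    and determined_X: "\<And>u. u \<in> V \<Longrightarrow> (\<And>x. x \<in> X \<Longrightarrow> u x = 0) \<Longrightarrow> u = (\<lambda>_. 0)"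
    and coercive: "\<And>u. u \<in> V \<Longrightarrow> A u u = 0 \<Longrightarrow> G u u = 0 \<Longrightarrow> u = (\<lambda>_. 0)"
begin

definition V0 :: "('x \<Rightarrow> real) set" where "V0 = {v \<in> V. G v v = 0}"

definition E :: "real \<Rightarrow> ('x \<Rightarrow> real) \<Rightarrow> ('x \<Rightarrow> real) \<Rightarrow> real" where
  "E \<alpha> u v = A u v + \<alpha> * G u v"

lemma V0_subset: "V0 \<subseteq> V" by (auto simp: V0_def)

lemma G_V0: "v \<in> V0 \<Longrightarrow> u \<in> V \<Longrightarrow> G u v = 0" "v \<in> V0 \<Longrightarrow> u \<in> V \<Longrightarrow> G v u = 0"
  using G.null_right[of v u] G.sym[of v u] by (auto simp: V0_def)

lemma function_space_V0: "function_space V0"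
proof
  show "(\<lambda>_. 0) \<in> V0" by (simp add: V0_def A.zero_mem G.zero_left)
  fix u v c assume uv: "u \<in> V0" "v \<in> V0"
  then have "u \<in> V" "v \<in> V" using V0_subset by auto
  then show "(\<lambda>x. u x + c * v x) \<in> V0"
    using uv G_V0(1)[OF uv(2), of u] by (simp add: V0_def A.lincomb_mem G.square_lincomb)
qed

lemma finite_inner_E: assumes "0 < \<alpha>" shows "finite_inner V (E \<alpha>) X"
proof
  fix u v w c assume "u \<in> V" "v \<in> V" "w \<in> V"
  then show "E \<alpha> (\<lambda>x. u x + c * v x) w = E \<alpha> u w + c * E \<alpha> v w"
    by (simp add: E_def A.lincomb_left G.lincomb_left algebra_simps)
next
  fix u v assume "u \<in> V" "v \<in> V"
  then show "E \<alpha> u v = E \<alpha> v u" by (simp add: E_def A.sym[of u v] G.sym[of u v])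
next
  fix u assume u: "u \<in> V"
  show "0 \<le> E \<alpha> u u" using u assms by (simp add: E_def A.nonneg G.nonneg)
  assume "E \<alpha> u u = 0"
  moreover have "0 \<le> \<alpha> * G u u" using u assms by (simp add: G.nonneg)
  ultimately have "A u u = 0" "\<alpha> * G u u = 0"
    using A.nonneg[OF u] unfolding E_def by linarith+
  then show "u = (\<lambda>_. 0)" using coercive[OF u] assms by simp
qed (use finite_X determined_X in auto)

sublocale E: finite_inner V "E 1" X by (rule finite_inner_E) simp

lemma finite_inner_V0: "finite_inner V0 A X"
proof -
  interpret V0: semi_inner V0 A by (rule A.semi_inner_subset[OF function_space_V0 V0_subset])
  show ?thesis
    by unfold_locales (use finite_X determined_X coercive in \<open>auto simp: V0_def\<close>)
qed

text \<open>
  The inverse of the trace is bounded: subtracting from \<open>v\<close> its orthogonal projection to \<open>V0\<close> leaves the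
  trace unchanged and lands in the orthogonal complement of \<open>V0\<close>, where \<open>G\<close> is definite, so that
  the energy norm is bounded by the norm of \<open>G\<close>.
\<close>
lemma trace_lifting:
  obtains \<kappa> where "0 \<le> \<kappa>"
    "\<And>v. v \<in> V \<Longrightarrow> \<exists>w\<in>V. (\<lambda>x. v x - w x) \<in> V0 \<and> E.nrm w \<le> \<kappa> * G.nrm v"
proof -
  define U where "U = {w \<in> V. \<forall>v\<in>V0. E 1 w v = 0}"
  have UV: "U \<subseteq> V" by (auto simp: U_def)
  have U: "function_space U"
    by unfold_locales
      (use V0_subset in \<open>auto simp: U_def A.zero_mem A.lincomb_mem E.lincomb_left E.zero_left subset_iff\<close>)
  interpret U: semi_inner U G by (rule G.semi_inner_subset[OF U UV])
  interpret U: finite_inner U G X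
  proof
    fix u assume u: "u \<in> U" "G u u = 0"
    then have "u \<in> V0" using UV by (auto simp: V0_def)
    then have "E 1 u u = 0" using u by (auto simp: U_def)
    then show "u = (\<lambda>_. 0)" using E.definite u UV by blast
  qed (use finite_X determined_X UV in blast)+
  obtain \<kappa> where \<kappa>: "0 \<le> \<kappa>" "\<And>u. u \<in> U \<Longrightarrow> E.nrm u \<le> \<kappa> * U.nrm u"
    using U.seminorm_bounded[OF E.semi_inner_axioms UV] by blast
  interpret V0: finite_inner V0 "E 1" X
    by (rule E.finite_inner_subspace[OF function_space_V0 V0_subset])
  have "\<exists>w\<in>V. (\<lambda>x. v x - w x) \<in> V0 \<and> E.nrm w \<le> \<kappa> * G.nrm v" if v: "v \<in> V" for v
  proof -
    have "linear_on V0 (E 1 v)"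
      using E.linear_on_right[OF v] V0_subset by (auto simp: linear_on_def subset_iff)
    then obtain z where z: "z \<in> V0" "\<And>y. y \<in> V0 \<Longrightarrow> E 1 z y = E 1 v y"
      using V0.riesz by blast
    have zV: "z \<in> V" using z V0_subset by blast
    define w where "w = (\<lambda>x. v x - z x)"
    have wV: "w \<in> V" unfolding w_def by (rule A.diff_mem[OF v zV])
    have wU: "w \<in> U"
      using wV z V0_subset v zV by (auto simp: U_def w_def E.diff_left subset_iff)
    have "G w w = G v v"
      unfolding w_def using G.square_diff[OF v zV] G_V0(1)[OF z(1) v] z(1) by (simp add: V0_def)
    then have "E.nrm w \<le> \<kappa> * G.nrm v"
      using \<kappa>(2)[OF wU] by (simp add: U.nrm_def G.nrm_def)
    moreover have "(\<lambda>x. v x - w x) = z" by (simp add: w_def)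
    ultimately show ?thesis using wV z(1) by auto
  qed
  then show ?thesis using that \<kappa>(1) by blast
qed

definition \<kappa> :: real where
  "\<kappa> = (SOME k. 0 \<le> k \<and> (\<forall>v\<in>V. \<exists>w\<in>V. (\<lambda>x. v x - w x) \<in> V0 \<and> E.nrm w \<le> k * G.nrm v))"

lemma \<kappa>: "0 \<le> \<kappa>" "\<And>v. v \<in> V \<Longrightarrow> \<exists>w\<in>V. (\<lambda>x. v x - w x) \<in> V0 \<and> E.nrm w \<le> \<kappa> * G.nrm v"
proof -
  have "\<exists>k. 0 \<le> k \<and> (\<forall>v\<in>V. \<exists>w\<in>V. (\<lambda>x. v x - w x) \<in> V0 \<and> E.nrm w \<le> k * G.nrm v)"
    by (rule trace_lifting) blast
  from someI_ex[OF this] show "0 \<le> \<kappa>"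
    "\<And>v. v \<in> V \<Longrightarrow> \<exists>w\<in>V. (\<lambda>x. v x - w x) \<in> V0 \<and> E.nrm w \<le> \<kappa> * G.nrm v"
    unfolding \<kappa>_def by auto
qed

lemma residual_bound:
  assumes r: "linear_on V r" and r0: "\<And>v. v \<in> V0 \<Longrightarrow> r v = 0"
    and N: "\<And>v. v \<in> V \<Longrightarrow> \<bar>r v\<bar> \<le> N * E.nrm v" and "0 \<le> N" and v: "v \<in> V"
  shows "\<bar>r v\<bar> \<le> \<kappa> * N * G.nrm v"
proof -
  obtain w where w: "w \<in> V" "(\<lambda>x. v x - w x) \<in> V0" "E.nrm w \<le> \<kappa> * G.nrm v"
    using \<kappa>(2)[OF v] by blast
  have "r v = r w" using A.linear_on_diff[OF r v w(1)] r0[OF w(2)] by simp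
  then show ?thesis
    using N[OF w(1)] mult_left_mono[OF w(3) \<open>0 \<le> N\<close>] by (simp add: mult_ac)
qed

text \<open>
  The core estimate. Testing the error equation with \<open>e\<close> itself gives, for \<open>x\<close> the energy norm and \<open>y\<close>
  the trace norm of \<open>e\<close>, that \<open>x\<^sup>2 + (\<alpha> - 1) * y\<^sup>2 \<le> D * x + \<kappa> * N * y\<close>. Young's inequality absorbs
  \<open>D * x\<close> into half of \<open>x\<^sup>2\<close> and \<open>\<kappa> * N * y\<close> into \<open>(\<alpha> - 1) * y\<^sup>2\<close>, at the price of
  a term of order \<open>1 / \<alpha>\<close>. Allowing for a perturbation \<open>d\<close> of the load lets one lemma serve for states and
  adjoint states.
\<close>
lemma penalty_estimate:
  assumes e: "e \<in> V" and \<alpha>: "1 < \<alpha>"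
    and eq: "E \<alpha> e e = d + r e"
    and d: "\<bar>d\<bar> \<le> D * E.nrm e"
    and r: "linear_on V r" "\<And>v. v \<in> V0 \<Longrightarrow> r v = 0"
    and N: "\<And>v. v \<in> V \<Longrightarrow> \<bar>r v\<bar> \<le> N * E.nrm v" "0 \<le> N"
  shows "E 1 e e \<le> D\<^sup>2 + (\<kappa> * N)\<^sup>2 / (2 * (\<alpha> - 1))"
proof -
  define x where "x = E.nrm e"
  define y where "y = G.nrm e"
  have x2: "E 1 e e = x\<^sup>2" by (simp add: x_def E.nrm_sq[OF e])
  have y2: "G e e = y\<^sup>2" by (simp add: y_def G.nrm_sq[OF e])
  have "x\<^sup>2 + (\<alpha> - 1) * y\<^sup>2 = E \<alpha> e e"
    unfolding x2[symmetric] y2[symmetric] by (simp add: E_def algebra_simps)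
  also have "\<dots> \<le> D * x + \<kappa> * N * y"
    using eq d residual_bound[OF r N e] by (simp add: x_def y_def)
  finally have main: "x\<^sup>2 + (\<alpha> - 1) * y\<^sup>2 \<le> D * x + \<kappa> * N * y" .
  have "0 \<le> (x - D)\<^sup>2" by simp
  then have 1: "D * x \<le> x\<^sup>2 / 2 + D\<^sup>2 / 2" by (simp add: power2_diff field_simps)
  have "0 \<le> (2 * (\<alpha> - 1) * y - \<kappa> * N)\<^sup>2" by simp
  then have "4 * (\<alpha> - 1) * (\<kappa> * N * y) \<le> 4 * (\<alpha> - 1) * ((\<alpha> - 1) * y\<^sup>2) + (\<kappa> * N)\<^sup>2"
    by (simp add: power2_eq_square algebra_simps)
  then have 2: "\<kappa> * N * y \<le> (\<alpha> - 1) * y\<^sup>2 + (\<kappa> * N)\<^sup>2 / (4 * (\<alpha> - 1))"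
    using \<alpha> by (simp add: field_simps)
  have "x\<^sup>2 / 2 \<le> D\<^sup>2 / 2 + (\<kappa> * N)\<^sup>2 / (4 * (\<alpha> - 1))" using main 1 2 by linarith
  from mult_left_mono[OF this, of 2]
  have "x\<^sup>2 \<le> 2 * (D\<^sup>2 / 2 + (\<kappa> * N)\<^sup>2 / (4 * (\<alpha> - 1)))" by simp
  also have "\<dots> = D\<^sup>2 + (\<kappa> * N)\<^sup>2 / (2 * (\<alpha> - 1))" using \<alpha> by (simp add: field_simps)
  finally show ?thesis by (simp add: x2)
qed

end

section \<open>The abstract optimal control problem\<close>

text \<open>
  \<open>WH\<close> and \<open>WQ\<close> stand for the \<open>L\<^sup>2\<close> spaces of the domain and of \<open>\<Gamma>2\<close>. They are infinite-dimensional and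
  their forms are only semidefinite, since functions are not identified almost everywhere. The
  function \<open>\<beta>\<close> carries the boundary value.
\<close>

locale penalised_control =
  penalised_problem V A G X + H: semi_inner WH H + Q: semi_inner WQ Q
  for V :: "('x \<Rightarrow> real) set" and A G and X :: "'x set" and WH :: "('x \<Rightarrow> real) set" and H
    and WQ :: "('x \<Rightarrow> real) set" and Q +
  fixes \<beta> g zd :: "'x \<Rightarrow> real" and M :: real
  assumes V_H: "V \<subseteq> WH" and V_Q: "V \<subseteq> WQ"
    and \<beta>: "\<beta> \<in> V" and g: "g \<in> WH" and zd: "zd \<in> WH" and M: "0 < M"
begin

definition is_state :: "('x \<Rightarrow> real) \<Rightarrow> ('x \<Rightarrow> real) \<Rightarrow> bool" where
  "is_state q u \<longleftrightarrow> (\<exists>v\<in>V0. u = (\<lambda>x. \<beta> x + v x)) \<and> (\<forall>v\<in>V0. A u v = H g v - Q q v)"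

definition is_adjoint :: "('x \<Rightarrow> real) \<Rightarrow> ('x \<Rightarrow> real) \<Rightarrow> bool" where
  "is_adjoint u p \<longleftrightarrow> p \<in> V0 \<and> (\<forall>v\<in>V0. A p v = H (\<lambda>x. u x - zd x) v)"

definition is_penalised_state :: "real \<Rightarrow> ('x \<Rightarrow> real) \<Rightarrow> ('x \<Rightarrow> real) \<Rightarrow> bool" where
  "is_penalised_state \<alpha> q u \<longleftrightarrow> u \<in> V \<and> (\<forall>v\<in>V. E \<alpha> u v = H g v - Q q v + \<alpha> * G \<beta> v)"

definition is_penalised_adjoint :: "real \<Rightarrow> ('x \<Rightarrow> real) \<Rightarrow> ('x \<Rightarrow> real) \<Rightarrow> bool" where
  "is_penalised_adjoint \<alpha> u p \<longleftrightarrow> p \<in> V \<and> (\<forall>v\<in>V. E \<alpha> p v = H (\<lambda>x. u x - zd x) v)"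

definition cost :: "('x \<Rightarrow> real) \<Rightarrow> ('x \<Rightarrow> real) \<Rightarrow> real" where
  "cost u q = 1 / 2 * H (\<lambda>x. u x - zd x) (\<lambda>x. u x - zd x) + M / 2 * Q q q"

lemma memH: "v \<in> V \<Longrightarrow> v \<in> WH" and memQ: "v \<in> V \<Longrightarrow> v \<in> WQ" using V_H V_Q by auto
lemma memV: "v \<in> V0 \<Longrightarrow> v \<in> V" using V0_subset by auto

lemma is_state_V: "is_state q u \<Longrightarrow> u \<in> V"
  using A.add_mem[OF \<beta>] memV by (auto simp: is_state_def)

lemma load_linear:
  assumes q: "q \<in> WQ" shows "linear_on V (\<lambda>v. H g v - Q q v)"
  using V_H V_Q
  by (auto simp: linear_on_def H.lincomb_right[OF g] Q.lincomb_right[OF q] subset_iff algebra_simps)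

lemma ex1_state: assumes q: "q \<in> WQ" shows "\<exists>!u. is_state q u"
proof -
  interpret V0: finite_inner V0 A X by (rule finite_inner_V0)
  have "linear_on V0 (\<lambda>v. H g v - Q q v - A \<beta> v)"
    using load_linear[OF q] A.linear_on_right[OF \<beta>] V0_subset
    by (auto simp: linear_on_def subset_iff algebra_simps)
  from V0.riesz[OF this] obtain w where w: "w \<in> V0" "\<And>v. v \<in> V0 \<Longrightarrow> A w v = H g v - Q q v - A \<beta> v"
    and uniq: "\<And>w'. w' \<in> V0 \<Longrightarrow> (\<And>v. v \<in> V0 \<Longrightarrow> A w' v = H g v - Q q v - A \<beta> v) \<Longrightarrow> w' = w"
    by blast
  have split: "A (\<lambda>x. \<beta> x + w' x) v = A \<beta> v + A w' v" if "w' \<in> V0" "v \<in> V0" for w' v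
    using A.lincomb_left[OF \<beta> memV[OF that(1)] memV[OF that(2)], of 1] by simp
  show ?thesis
  proof (rule ex1I[of _ "\<lambda>x. \<beta> x + w x"])
    show "is_state q (\<lambda>x. \<beta> x + w x)" using w split by (auto simp: is_state_def)
    fix u assume "is_state q u"
    then obtain w' where w': "w' \<in> V0" "u = (\<lambda>x. \<beta> x + w' x)"
      and eq: "\<And>v. v \<in> V0 \<Longrightarrow> A u v = H g v - Q q v"
      by (auto simp: is_state_def)
    have "w' = w" using eq split[OF w'(1)] w' by (intro uniq) (auto simp: algebra_simps)
    then show "u = (\<lambda>x. \<beta> x + w x)" using w' by simp
  qed
qed

lemma residual_linear:
  assumes "u \<in> V" shows "linear_on V (\<lambda>v. H (\<lambda>x. u x - zd x) v)"
  using V_H H.lincomb_right[OF H.diff_mem[OF memH[OF assms] zd]]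
  by (auto simp: linear_on_def subset_iff)

lemma ex1_adjoint: assumes u: "u \<in> V" shows "\<exists>!p. is_adjoint u p"
proof -
  interpret V0: finite_inner V0 A X by (rule finite_inner_V0)
  have "linear_on V0 (\<lambda>v. H (\<lambda>x. u x - zd x) v)"
    using residual_linear[OF u] V0_subset by (auto simp: linear_on_def subset_iff)
  from V0.riesz[OF this] show ?thesis by (simp add: is_adjoint_def)
qed

lemma ex1_penalised_state:
  assumes q: "q \<in> WQ" and \<alpha>: "0 < \<alpha>" shows "\<exists>!u. is_penalised_state \<alpha> q u"
proof -
  interpret E\<alpha>: finite_inner V "E \<alpha>" X by (rule finite_inner_E[OF \<alpha>])
  have "linear_on V (\<lambda>v. H g v - Q q v + \<alpha> * G \<beta> v)"
    using load_linear[OF q] G.linear_on_right[OF \<beta>] by (auto simp: linear_on_def algebra_simps)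
  from E\<alpha>.riesz[OF this] show ?thesis by (simp add: is_penalised_state_def)
qed

lemma ex1_penalised_adjoint:
  assumes u: "u \<in> V" and \<alpha>: "0 < \<alpha>" shows "\<exists>!p. is_penalised_adjoint \<alpha> u p"
proof -
  interpret E\<alpha>: finite_inner V "E \<alpha>" X by (rule finite_inner_E[OF \<alpha>])
  from E\<alpha>.riesz[OF residual_linear[OF u]] show ?thesis by (simp add: is_penalised_adjoint_def)
qed

text \<open>Bounds for the embeddings of \<open>V\<close> into \<open>WH\<close> and \<open>WQ\<close> with respect to the energy norm.\<close>
definition CH :: real where "CH = (SOME C. 0 \<le> C \<and> (\<forall>u\<in>V. H.nrm u \<le> C * E.nrm u))"
definition CQ :: real where "CQ = (SOME C. 0 \<le> C \<and> (\<forall>u\<in>V. Q.nrm u \<le> C * E.nrm u))"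

lemma CH: "0 \<le> CH" "\<And>u. u \<in> V \<Longrightarrow> H.nrm u \<le> CH * E.nrm u"
proof -
  have "\<exists>C. 0 \<le> C \<and> (\<forall>u\<in>V. H.nrm u \<le> C * E.nrm u)"
    by (rule E.seminorm_bounded[OF H.semi_inner_axioms V_H]) blast
  from someI_ex[OF this] show "0 \<le> CH" "\<And>u. u \<in> V \<Longrightarrow> H.nrm u \<le> CH * E.nrm u"
    unfolding CH_def by auto
qed

lemma CQ: "0 \<le> CQ" "\<And>u. u \<in> V \<Longrightarrow> Q.nrm u \<le> CQ * E.nrm u"
proof -
  have "\<exists>C. 0 \<le> C \<and> (\<forall>u\<in>V. Q.nrm u \<le> C * E.nrm u)"
    by (rule E.seminorm_bounded[OF Q.semi_inner_axioms V_Q]) blast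
  from someI_ex[OF this] show "0 \<le> CQ" "\<And>u. u \<in> V \<Longrightarrow> Q.nrm u \<le> CQ * E.nrm u"
    unfolding CQ_def by auto
qed

lemma H_bound: "f \<in> WH \<Longrightarrow> v \<in> V \<Longrightarrow> \<bar>H f v\<bar> \<le> CH * H.nrm f * E.nrm v"
  using H.cauchy_schwarz[of f v] mult_left_mono[OF CH(2)[of v], of "H.nrm f"] memH[of v] H.nrm_nonneg[of f]
  by (simp add: mult_ac)

lemma Q_bound: "f \<in> WQ \<Longrightarrow> v \<in> V \<Longrightarrow> \<bar>Q f v\<bar> \<le> CQ * Q.nrm f * E.nrm v"
  using Q.cauchy_schwarz[of f v] mult_left_mono[OF CQ(2)[of v], of "Q.nrm f"] memQ[of v] Q.nrm_nonneg[of f]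
  by (simp add: mult_ac)

lemma A_bound:
  assumes "u \<in> V" "v \<in> V" shows "\<bar>A u v\<bar> \<le> E.nrm u * E.nrm v"
proof -
  have "A.nrm w \<le> E.nrm w" if "w \<in> V" for w
    using G.nonneg[OF that] by (simp add: A.nrm_def E.nrm_def E_def)
  then show ?thesis
    using A.cauchy_schwarz[OF assms] mult_mono[of "A.nrm u" "E.nrm u" "A.nrm v" "E.nrm v"] assms
      A.nrm_nonneg E.nrm_nonneg by force
qed

text \<open>
  The part of the state in \<open>V0\<close> is its own test function, and on \<open>V0\<close> the energy is \<open>A\<close> alone. The
  bound is affine in the norm of \<open>q\<close>; this makes the error estimates uniform on bounded sets of controls.
\<close>
lemma state_bound:
  assumes q: "q \<in> WQ" and st: "is_state q u"
  shows "E.nrm u \<le> CH * H.nrm g + CQ * Q.nrm q + 2 * E.nrm \<beta>"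
proof -
  obtain w where w: "w \<in> V0" and u: "u = (\<lambda>x. \<beta> x + w x)" using st by (auto simp: is_state_def)
  have wV: "w \<in> V" by (rule memV[OF w])
  have "A \<beta> w + A w w = H g w - Q q w"
    using st w A.lincomb_left[OF \<beta> wV wV, of 1] by (simp add: is_state_def u)
  moreover have "E 1 w w = A w w" using w by (simp add: E_def V0_def)
  ultimately have "E.nrm w * E.nrm w = H g w - Q q w - A \<beta> w"
    using E.nrm_sq[OF wV] by (simp add: power2_eq_square)
  also have "\<dots> \<le> (CH * H.nrm g + CQ * Q.nrm q + E.nrm \<beta>) * E.nrm w"
    using H_bound[OF g wV] Q_bound[OF q wV] A_bound[OF \<beta> wV] by (simp add: algebra_simps)
  finally have "E.nrm w \<le> CH * H.nrm g + CQ * Q.nrm q + E.nrm \<beta>"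
    using E.nrm_nonneg[OF wV] CH(1) CQ(1) H.nrm_nonneg[OF g] Q.nrm_nonneg[OF q] E.nrm_nonneg[OF \<beta>]
    by (cases "E.nrm w = 0") auto
  then show ?thesis using E.nrm_lincomb[OF \<beta> wV, of 1] by (simp add: u)
qed

text \<open>
  A bound for the norm of the residual \<open>v \<mapsto> H g v - Q q v - A u v\<close> of the state \<open>u\<close> of any
  control \<open>q\<close> of norm at most \<open>R\<close>: its first two terms contribute \<open>CH * H.nrm g + CQ * R\<close>, and the
  third one the bound for \<open>u\<close>.
\<close>
definition load :: "real \<Rightarrow> real" where
  "load R = 2 * (CH * H.nrm g + CQ * R + E.nrm \<beta>)"

lemma load_nonneg: "0 \<le> R \<Longrightarrow> 0 \<le> load R"
  using CH(1) CQ(1) H.nrm_nonneg[OF g] E.nrm_nonneg[OF \<beta>] by (simp add: load_def)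

text \<open>
  The controls \<open>q\<close> and \<open>q'\<close> may differ: with \<open>q' = q\<close> this is the uniform consistency of the
  penalisation on bounded sets of controls, and with \<open>q'\<close> the penalised optimal control it transports
  convergence from the controls to the states.
\<close>
lemma state_error:
  assumes q: "q \<in> WQ" and q': "q' \<in> WQ" and \<alpha>: "1 < \<alpha>"
    and st: "is_state q u" and pst: "is_penalised_state \<alpha> q' w" and R: "Q.nrm q \<le> R"
  shows "E 1 (\<lambda>x. w x - u x) (\<lambda>x. w x - u x) \<le>
           (CQ * Q.nrm (\<lambda>x. q' x - q x))\<^sup>2 + (\<kappa> * load R)\<^sup>2 / (2 * (\<alpha> - 1))"
proof -
  have u: "u \<in> V" by (rule is_state_V[OF st])
  have w: "w \<in> V" using pst by (simp add: is_penalised_state_def)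
  define e where "e = (\<lambda>x. w x - u x)"
  have e: "e \<in> V" unfolding e_def by (rule A.diff_mem[OF w u])
  define r where "r = (\<lambda>v. H g v - Q q v - A u v)"
  have Gu: "G u v = G \<beta> v" if v: "v \<in> V" for v
  proof -
    obtain w0 where w0: "w0 \<in> V0" "u = (\<lambda>x. \<beta> x + w0 x)" using st by (auto simp: is_state_def)
    then show ?thesis
      using G.lincomb_left[OF \<beta> memV[OF w0(1)] v, of 1] G_V0(2)[OF w0(1) v] by simp
  qed
  interpret E\<alpha>: finite_inner V "E \<alpha>" X by (rule finite_inner_E) (use \<alpha> in simp)
  have "E \<alpha> e e = E \<alpha> w e - E \<alpha> u e"
    unfolding e_def by (rule E\<alpha>.diff_left[OF e[unfolded e_def] w u])
  also have "\<dots> = - Q (\<lambda>x. q' x - q x) e + r e"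
    using pst e Gu[OF e] Q.diff_left[OF memQ[OF e] q' q]
    by (simp add: is_penalised_state_def E_def r_def)
  finally have eq: "E \<alpha> e e = - Q (\<lambda>x. q' x - q x) e + r e" .
  have "E 1 e e \<le> (CQ * Q.nrm (\<lambda>x. q' x - q x))\<^sup>2 + (\<kappa> * load R)\<^sup>2 / (2 * (\<alpha> - 1))"
  proof (rule penalty_estimate[where r = r, OF e \<alpha> eq])
    show "\<bar>- Q (\<lambda>x. q' x - q x) e\<bar> \<le> CQ * Q.nrm (\<lambda>x. q' x - q x) * E.nrm e"
      using Q_bound[OF Q.diff_mem[OF q' q] e] by simp
    show "linear_on V r"
      using load_linear[OF q] A.linear_on_right[OF u]
      by (auto simp: linear_on_def r_def algebra_simps)
    show "r v = 0" if "v \<in> V0" for v using st that by (simp add: is_state_def r_def)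
    show "0 \<le> load R" by (rule load_nonneg[OF order_trans[OF Q.nrm_nonneg[OF q] R]])
    fix v assume v: "v \<in> V"
    have "\<bar>r v\<bar> \<le> (CH * H.nrm g + CQ * Q.nrm q + E.nrm u) * E.nrm v"
      using H_bound[OF g v] Q_bound[OF q v] A_bound[OF u v] by (simp add: r_def algebra_simps)
    also have "\<dots> \<le> load R * E.nrm v"
      using state_bound[OF q st] mult_left_mono[OF R CQ(1)] E.nrm_nonneg[OF v]
      by (intro mult_right_mono) (auto simp: load_def algebra_simps)
    finally show "\<bar>r v\<bar> \<le> load R * E.nrm v" .
  qed
  then show ?thesis by (simp add: e_def)
qed

lemma adjoint_error:
  assumes u: "u \<in> V" and w: "w \<in> V" and \<alpha>: "1 < \<alpha>"
    and adj: "is_adjoint u p" and padj: "is_penalised_adjoint \<alpha> w s"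
  shows "E 1 (\<lambda>x. s x - p x) (\<lambda>x. s x - p x) \<le>
           (CH * H.nrm (\<lambda>x. w x - u x))\<^sup>2
           + (\<kappa> * (CH * H.nrm (\<lambda>x. u x - zd x) + E.nrm p))\<^sup>2 / (2 * (\<alpha> - 1))"
proof -
  have p0: "p \<in> V0" using adj by (simp add: is_adjoint_def)
  have p: "p \<in> V" by (rule memV[OF p0])
  have s: "s \<in> V" using padj by (simp add: is_penalised_adjoint_def)
  define e where "e = (\<lambda>x. s x - p x)"
  have e: "e \<in> V" unfolding e_def by (rule A.diff_mem[OF s p])
  have uz: "(\<lambda>x. u x - zd x) \<in> WH" by (rule H.diff_mem[OF memH[OF u] zd])
  have wz: "(\<lambda>x. w x - zd x) \<in> WH" by (rule H.diff_mem[OF memH[OF w] zd])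
  define r where "r = (\<lambda>v. H (\<lambda>x. u x - zd x) v - A p v)"
  interpret E\<alpha>: finite_inner V "E \<alpha>" X by (rule finite_inner_E) (use \<alpha> in simp)
  have "E \<alpha> e e = E \<alpha> s e - E \<alpha> p e"
    unfolding e_def by (rule E\<alpha>.diff_left[OF e[unfolded e_def] s p])
  also have "\<dots> = H (\<lambda>x. w x - u x) e + r e"
    using padj e G_V0(2)[OF p0 e] H.diff_left[OF memH[OF e] wz uz]
    by (simp add: is_penalised_adjoint_def E_def r_def)
  finally have eq: "E \<alpha> e e = H (\<lambda>x. w x - u x) e + r e" .
  have "E 1 e e \<le> (CH * H.nrm (\<lambda>x. w x - u x))\<^sup>2
      + (\<kappa> * (CH * H.nrm (\<lambda>x. u x - zd x) + E.nrm p))\<^sup>2 / (2 * (\<alpha> - 1))"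
  proof (rule penalty_estimate[where r = r, OF e \<alpha> eq])
    show "\<bar>H (\<lambda>x. w x - u x) e\<bar> \<le> CH * H.nrm (\<lambda>x. w x - u x) * E.nrm e"
      by (rule H_bound[OF H.diff_mem[OF memH[OF w] memH[OF u]] e])
    show "linear_on V r"
      using residual_linear[OF u] A.linear_on_right[OF p]
      by (auto simp: linear_on_def r_def algebra_simps)
    show "r v = 0" if "v \<in> V0" for v using adj that by (simp add: is_adjoint_def r_def)
    show "0 \<le> CH * H.nrm (\<lambda>x. u x - zd x) + E.nrm p"
      using CH(1) H.nrm_nonneg[OF uz] E.nrm_nonneg[OF p] by simp
    show "\<bar>r v\<bar> \<le> (CH * H.nrm (\<lambda>x. u x - zd x) + E.nrm p) * E.nrm v" if v: "v \<in> V" for v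
      using H_bound[OF uz v] A_bound[OF p v] by (simp add: r_def algebra_simps)
  qed
  then show ?thesis by (simp add: e_def)
qed

lemma midpoint_state:
  assumes q: "q \<in> WQ" "q' \<in> WQ" and st: "is_state q u" "is_state q' u'"
  shows "is_state (\<lambda>x. (q x + q' x) / 2) (\<lambda>x. (u x + u' x) / 2)"
proof -
  interpret V0: function_space V0 by (rule function_space_V0)
  obtain w w' where w: "w \<in> V0" "u = (\<lambda>x. \<beta> x + w x)" "w' \<in> V0" "u' = (\<lambda>x. \<beta> x + w' x)"
    using st by (auto simp: is_state_def)
  have u: "u \<in> V" "u' \<in> V" using st is_state_V by auto
  have mid: "(\<lambda>x. (a x + b x) / 2) = (\<lambda>x. a x + (1 / 2) * (\<lambda>x. b x - a x) x)"
    for a b :: "'x \<Rightarrow> real" by (auto simp: fun_eq_iff field_simps)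
  have "(\<lambda>x. (u x + u' x) / 2) = (\<lambda>x. \<beta> x + (w x + w' x) / 2)"
    by (auto simp: w(2,4) fun_eq_iff field_simps)
  moreover have "(\<lambda>x. (w x + w' x) / 2) \<in> V0"
    unfolding mid by (rule V0.lincomb_mem[OF w(1) V0.diff_mem[OF w(3,1)]])
  moreover have "A (\<lambda>x. (u x + u' x) / 2) v = H g v - Q (\<lambda>x. (q x + q' x) / 2) v" if v: "v \<in> V0" for v
  proof -
    have vV: "v \<in> V" by (rule memV[OF v])
    have "A (\<lambda>x. (u x + u' x) / 2) v = (A u v + A u' v) / 2"
      unfolding mid using A.lincomb_left[OF u(1) A.diff_mem[OF u(2,1)] vV, of "1/2"]
        A.diff_left[OF vV u(2,1)] by (simp add: field_simps)
    moreover have "Q (\<lambda>x. (q x + q' x) / 2) v = (Q q v + Q q' v) / 2"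
      unfolding mid using Q.lincomb_left[OF q(1) Q.diff_mem[OF q(2,1)] memQ[OF vV], of "1/2"]
        Q.diff_left[OF memQ[OF vV] q(2,1)] by (simp add: field_simps)
    moreover have "A u v = H g v - Q q v" "A u' v = H g v - Q q' v"
      using st v by (auto simp: is_state_def)
    ultimately show ?thesis by (simp add: field_simps)
  qed
  ultimately show ?thesis
    unfolding is_state_def by (intro conjI ballI bexI[of _ "\<lambda>x. (w x + w' x) / 2"])
qed

text \<open>
  The control-to-state map is affine, so by the parallelogram identity the cost at the midpoint of two
  controls lies below the mean of the costs by at least \<open>M / 8\<close> times the squared distance. Minimality of
  \<open>q\<close> against the midpoint gives the claim.
\<close>
lemma cost_strongly_convex:
  assumes q: "q \<in> WQ" "q' \<in> WQ" and st: "is_state q u" "is_state q' u'"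
    and opt: "\<And>r w. r \<in> WQ \<Longrightarrow> is_state r w \<Longrightarrow> cost u q \<le> cost w r"
  shows "M / 4 * Q (\<lambda>x. q' x - q x) (\<lambda>x. q' x - q x) \<le> cost u' q' - cost u q"
proof -
  have u: "u \<in> V" "u' \<in> V" using st is_state_V by auto
  have uz: "(\<lambda>x. u x - zd x) \<in> WH" "(\<lambda>x. u' x - zd x) \<in> WH"
    using H.diff_mem[OF memH zd] u by auto
  have qm: "(\<lambda>x. (q x + q' x) / 2) \<in> WQ"
    using Q.scale_mem[OF Q.add_mem[OF q], of "1/2"] by simp
  have eqs: "(\<lambda>x. (u x + u' x) / 2 - zd x) = (\<lambda>x. ((u x - zd x) + (u' x - zd x)) / 2)"
    by (auto simp: fun_eq_iff field_simps)
  have "0 \<le> H (\<lambda>x. (u' x - zd x) - (u x - zd x)) (\<lambda>x. (u' x - zd x) - (u x - zd x))"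
    by (rule H.nonneg[OF H.diff_mem[OF uz(2,1)]])
  then have "H (\<lambda>x. (u x + u' x) / 2 - zd x) (\<lambda>x. (u x + u' x) / 2 - zd x)
    \<le> (H (\<lambda>x. u x - zd x) (\<lambda>x. u x - zd x) + H (\<lambda>x. u' x - zd x) (\<lambda>x. u' x - zd x)) / 2"
    unfolding eqs H.square_midpoint[OF uz] by linarith
  then have "cost (\<lambda>x. (u x + u' x) / 2) (\<lambda>x. (q x + q' x) / 2)
     \<le> (cost u q + cost u' q') / 2 - M / 8 * Q (\<lambda>x. q' x - q x) (\<lambda>x. q' x - q x)"
    unfolding cost_def Q.square_midpoint[OF q] by (simp add: field_simps)
  moreover have "cost u q \<le> cost (\<lambda>x. (u x + u' x) / 2) (\<lambda>x. (q x + q' x) / 2)"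
    by (rule opt[OF qm midpoint_state[OF q st]])
  ultimately show ?thesis by (simp add: field_simps)
qed

lemma cost_difference:
  assumes u: "u \<in> V" and w: "w \<in> V"
  shows "cost w q - cost u q =
     H (\<lambda>x. u x - zd x) (\<lambda>x. w x - u x) + 1 / 2 * H (\<lambda>x. w x - u x) (\<lambda>x. w x - u x)"
proof -
  have uz: "(\<lambda>x. u x - zd x) \<in> WH" by (rule H.diff_mem[OF memH[OF u] zd])
  have wu: "(\<lambda>x. w x - u x) \<in> WH" by (rule H.diff_mem[OF memH[OF w] memH[OF u]])
  have eq: "(\<lambda>x. w x - zd x) = (\<lambda>x. (u x - zd x) + 1 * (\<lambda>x. w x - u x) x)"
    by (simp add: fun_eq_iff)
  show ?thesis
    unfolding cost_def eq H.square_lincomb[OF uz wu] by (simp add: field_simps)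
qed

lemma tendsto_penalty: "((\<lambda>\<alpha>::real. c / (2 * (\<alpha> - 1))) \<longlongrightarrow> 0) at_top"
proof (rule tendsto_divide_0[OF tendsto_const])
  have "filterlim (\<lambda>\<alpha>::real. 2 * (- 1 + \<alpha>)) at_top at_top"
    by (intro filterlim_tendsto_pos_mult_at_top[OF tendsto_const]
        filterlim_tendsto_add_at_top[OF tendsto_const] filterlim_ident) auto
  then show "filterlim (\<lambda>\<alpha>::real. 2 * (\<alpha> - 1)) at_infinity at_top"
    by (intro filterlim_at_top_imp_at_infinity) simp
qed

text \<open>
  Below, \<open>T\<close> and \<open>S \<alpha>\<close> are the control-to-state maps. With \<open>\<epsilon>\<close> for quantities that tend to \<open>0\<close>, the
  argument is the chain
  \<open>cost (T q\<^sub>\<alpha>) q\<^sub>\<alpha> \<le> cost (S \<alpha> q\<^sub>\<alpha>) q\<^sub>\<alpha> + \<epsilon> \<le> cost (S \<alpha> qo) qo + \<epsilon> \<le> cost (T qo) qo + 2 * \<epsilon>\<close>.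
  Its first step needs the uniform error estimate, because \<open>q\<^sub>\<alpha>\<close> is known only to stay bounded.
\<close>
theorem convergence:
  fixes S :: "real \<Rightarrow> ('x \<Rightarrow> real) \<Rightarrow> ('x \<Rightarrow> real)"
  assumes qo: "qo \<in> WQ" and qa: "\<And>\<alpha>. 0 < \<alpha> \<Longrightarrow> qa \<alpha> \<in> WQ"
    and S: "\<And>q. q \<in> WQ \<Longrightarrow> is_state q (T q)"
    and Sa: "\<And>\<alpha> q. 0 < \<alpha> \<Longrightarrow> q \<in> WQ \<Longrightarrow> is_penalised_state \<alpha> q (S \<alpha> q)"
    and P: "is_adjoint (T qo) p" and Pa: "\<And>\<alpha>. 0 < \<alpha> \<Longrightarrow> is_penalised_adjoint \<alpha> (S \<alpha> (qa \<alpha>)) (pa \<alpha>)"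
    and opt: "\<And>q. q \<in> WQ \<Longrightarrow> cost (T qo) qo \<le> cost (T q) q"
    and opta: "\<And>\<alpha> q. 0 < \<alpha> \<Longrightarrow> q \<in> WQ \<Longrightarrow> cost (S \<alpha> (qa \<alpha>)) (qa \<alpha>) \<le> cost (S \<alpha> q) q"
  shows "((\<lambda>\<alpha>. E.nrm (\<lambda>x. S \<alpha> (qa \<alpha>) x - T qo x)) \<longlongrightarrow> 0) at_top"
    and "((\<lambda>\<alpha>. E.nrm (\<lambda>x. pa \<alpha> x - p x)) \<longlongrightarrow> 0) at_top"
    and "((\<lambda>\<alpha>. Q.nrm (\<lambda>x. qa \<alpha> x - qo x)) \<longlongrightarrow> 0) at_top"
proof -
  have TV: "T q \<in> V" if "q \<in> WQ" for q using S[OF that] by (rule is_state_V)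
  have SV: "S \<alpha> q \<in> V" if "0 < \<alpha>" "q \<in> WQ" for \<alpha> q
    using Sa[OF that] by (simp add: is_penalised_state_def)
  have ev: "eventually (\<lambda>\<alpha>::real. 1 < \<alpha>) at_top" by (rule eventually_gt_at_top)
  have Hle: "H.nrm v \<le> CH * sqrt c" if "v \<in> V" "E 1 v v \<le> c" for v c
    using CH(2)[OF that(1)] mult_left_mono[OF real_sqrt_le_mono[OF that(2)] CH(1)]
    unfolding E.nrm_def by linarith
  \<comment> \<open>a bound for the state error in \<open>WH\<close> that is uniform for controls of norm at most \<open>R\<close>\<close>
  define err where "err = (\<lambda>R \<alpha>. CH * sqrt ((\<kappa> * load R)\<^sup>2 / (2 * (\<alpha> - 1))))"
  have err0: "(err R \<longlongrightarrow> 0) at_top" for R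
    unfolding err_def
    using tendsto_mult_right_zero[OF tendsto_real_sqrt[OF tendsto_penalty, simplified], of CH "(\<kappa> * load R)\<^sup>2"]
    by simp
  have close: "H.nrm (\<lambda>x. S \<alpha> q x - T q x) \<le> err R \<alpha>"
    if \<alpha>: "1 < \<alpha>" and q: "q \<in> WQ" and R: "Q.nrm q \<le> R" for \<alpha> q R
  proof -
    have 0: "0 < \<alpha>" using \<alpha> by simp
    have "E 1 (\<lambda>x. S \<alpha> q x - T q x) (\<lambda>x. S \<alpha> q x - T q x) \<le> (\<kappa> * load R)\<^sup>2 / (2 * (\<alpha> - 1))"
      using state_error[OF q q \<alpha> S[OF q] Sa[OF 0 q] R] by (simp add: Q.nrm_zero)
    then show ?thesis
      unfolding err_def by (rule Hle[OF A.diff_mem[OF SV[OF 0 q] TV[OF q]]])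
  qed
  have dz: "(\<lambda>x. T q x - zd x) \<in> WH" if "q \<in> WQ" for q
    by (rule H.diff_mem[OF memH[OF TV[OF that]] zd])
  have upper: "cost (S \<alpha> q) q \<le> cost (T q) q + H.nrm (\<lambda>x. T q x - zd x) * err R \<alpha> + (err R \<alpha>)\<^sup>2 / 2"
    and lower: "cost (T q) q - H.nrm (\<lambda>x. T q x - zd x) * err R \<alpha> \<le> cost (S \<alpha> q) q"
    if \<alpha>: "1 < \<alpha>" and q: "q \<in> WQ" and R: "Q.nrm q \<le> R" for \<alpha> q R
  proof -
    have 0: "0 < \<alpha>" using \<alpha> by simp
    let ?e = "\<lambda>x. S \<alpha> q x - T q x"
    have e: "?e \<in> WH" by (rule memH[OF A.diff_mem[OF SV[OF 0 q] TV[OF q]]])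
    have "\<bar>H (\<lambda>x. T q x - zd x) ?e\<bar> \<le> H.nrm (\<lambda>x. T q x - zd x) * err R \<alpha>"
      by (rule order_trans[OF H.cauchy_schwarz[OF dz[OF q] e]
            mult_left_mono[OF close[OF \<alpha> q R] H.nrm_nonneg[OF dz[OF q]]]])
    moreover have "H ?e ?e \<le> (err R \<alpha>)\<^sup>2"
      using power_mono[OF close[OF \<alpha> q R] H.nrm_nonneg[OF e], of 2] H.nrm_sq[OF e] by simp
    moreover have "0 \<le> H ?e ?e" by (rule H.nonneg[OF e])
    ultimately show "cost (S \<alpha> q) q \<le> cost (T q) q + H.nrm (\<lambda>x. T q x - zd x) * err R \<alpha> + (err R \<alpha>)\<^sup>2 / 2"
      "cost (T q) q - H.nrm (\<lambda>x. T q x - zd x) * err R \<alpha> \<le> cost (S \<alpha> q) q"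
      using cost_difference[OF TV[OF q] SV[OF 0 q], of q] by linarith+
  qed
  define R0 where "R0 = Q.nrm qo"
  define up where "up = (\<lambda>\<alpha>. H.nrm (\<lambda>x. T qo x - zd x) * err R0 \<alpha> + (err R0 \<alpha>)\<^sup>2 / 2)"
  have up0: "(up \<longlongrightarrow> 0) at_top"
    unfolding up_def
    using tendsto_add[OF tendsto_mult_right_zero[OF err0[of R0]]
       tendsto_divide[OF tendsto_power[OF err0[of R0], of 2] tendsto_const[of 2]]] by simp
  \<comment> \<open>comparing with the fixed competitor \<open>qo\<close> bounds the optimal controls by this radius for large \<open>\<alpha>\<close>\<close>
  define R where "R = sqrt (2 / M * (cost (T qo) qo + 1))"
  have "eventually (\<lambda>\<alpha>. up \<alpha> < 1) at_top" using up0 by (rule order_tendstoD) simp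
  then have bdd: "eventually (\<lambda>\<alpha>. 1 < \<alpha> \<and> Q.nrm (qa \<alpha>) \<le> R) at_top"
    using ev
  proof eventually_elim
    case (elim \<alpha>)
    then have 0: "0 < \<alpha>" by simp
    have z: "(\<lambda>x. S \<alpha> (qa \<alpha>) x - zd x) \<in> WH"
      by (rule H.diff_mem[OF memH[OF SV[OF 0 qa[OF 0]]] zd])
    have "M / 2 * Q (qa \<alpha>) (qa \<alpha>) \<le> cost (S \<alpha> (qa \<alpha>)) (qa \<alpha>)"
      using H.nonneg[OF z] by (simp add: cost_def)
    also have "\<dots> \<le> cost (S \<alpha> qo) qo" by (rule opta[OF 0 qo])
    also have "\<dots> \<le> cost (T qo) qo + up \<alpha>"
      using upper[OF elim(2) qo, of R0] by (simp add: R0_def up_def)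
    also have "\<dots> \<le> cost (T qo) qo + 1" using elim by simp
    finally have "Q (qa \<alpha>) (qa \<alpha>) \<le> 2 / M * (cost (T qo) qo + 1)"
      using M by (simp add: field_simps)
    then show ?case using elim by (simp add: Q.nrm_def R_def)
  qed
  define K where "K = CH * (load R / 2 + E.nrm \<beta>) + H.nrm zd"
  have Kb: "H.nrm (\<lambda>x. T q x - zd x) \<le> K" if q: "q \<in> WQ" and R: "Q.nrm q \<le> R" for q
  proof -
    have "E.nrm (T q) \<le> load R / 2 + E.nrm \<beta>"
      using state_bound[OF q S[OF q]] mult_left_mono[OF R CQ(1)] by (simp add: load_def field_simps)
    then have "H.nrm (T q) \<le> CH * (load R / 2 + E.nrm \<beta>)"
      using CH(2)[OF TV[OF q]] mult_left_mono[OF _ CH(1)] order_trans by blast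
    then show ?thesis
      using H.nrm_diff[OF memH[OF TV[OF q]] zd] by (simp add: K_def)
  qed
  have "((\<lambda>\<alpha>. Q (\<lambda>x. qa \<alpha> x - qo x) (\<lambda>x. qa \<alpha> x - qo x)) \<longlongrightarrow> 0) at_top"
  proof (rule tendsto_sandwich[OF _ _ tendsto_const])
    show "((\<lambda>\<alpha>. 4 / M * (K * err R \<alpha> + up \<alpha>)) \<longlongrightarrow> 0) at_top"
      using tendsto_add[OF tendsto_mult_right_zero[OF err0[of R], of K] up0]
      by (intro tendsto_mult_right_zero) simp
    show "\<forall>\<^sub>F \<alpha> in at_top. Q (\<lambda>x. qa \<alpha> x - qo x) (\<lambda>x. qa \<alpha> x - qo x) \<le> 4 / M * (K * err R \<alpha> + up \<alpha>)"
      using bdd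
    proof eventually_elim
      case (elim \<alpha>)
      then have 1: "1 < \<alpha>" and 0: "0 < \<alpha>" and nR: "Q.nrm (qa \<alpha>) \<le> R" by auto
      note q = qa[OF 0]
      have "M / 4 * Q (\<lambda>x. qa \<alpha> x - qo x) (\<lambda>x. qa \<alpha> x - qo x) \<le> cost (T (qa \<alpha>)) (qa \<alpha>) - cost (T qo) qo"
      proof (rule cost_strongly_convex[OF qo q S[OF qo] S[OF q]])
        fix r w assume r: "r \<in> WQ" "is_state r w"
        then have "w = T r" using ex1_state[OF r(1)] S[OF r(1)] by blast
        then show "cost (T qo) qo \<le> cost w r" using opt[OF r(1)] by simp
      qed
      also have "\<dots> \<le> K * err R \<alpha> + up \<alpha>"
      proof -
        have "0 \<le> err R \<alpha>" unfolding err_def using CH(1) 1 by simp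
        then have "H.nrm (\<lambda>x. T (qa \<alpha>) x - zd x) * err R \<alpha> \<le> K * err R \<alpha>"
          by (rule mult_right_mono[OF Kb[OF q nR]])
        then show ?thesis
          using lower[OF 1 q nR] opta[OF 0 qo] upper[OF 1 qo, of R0] by (simp add: R0_def up_def)
      qed
      finally show ?case using M by (simp add: field_simps)
    qed
    show "\<forall>\<^sub>F \<alpha> in at_top. 0 \<le> Q (\<lambda>x. qa \<alpha> x - qo x) (\<lambda>x. qa \<alpha> x - qo x)"
      using ev by eventually_elim (simp add: Q.nonneg Q.diff_mem qo qa)
  qed
  from tendsto_real_sqrt[OF this]
  show q_lim: "((\<lambda>\<alpha>. Q.nrm (\<lambda>x. qa \<alpha> x - qo x)) \<longlongrightarrow> 0) at_top" by (simp add: Q.nrm_def)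
  have nonnegE: "\<forall>\<^sub>F \<alpha> in at_top. 0 \<le> E.nrm (\<lambda>x. S \<alpha> (qa \<alpha>) x - T qo x)"
    using ev by eventually_elim (simp add: E.nrm_nonneg A.diff_mem SV TV qo qa)
  show u_lim: "((\<lambda>\<alpha>. E.nrm (\<lambda>x. S \<alpha> (qa \<alpha>) x - T qo x)) \<longlongrightarrow> 0) at_top"
  proof (rule tendsto_sandwich[OF nonnegE _ tendsto_const])
    show "((\<lambda>\<alpha>. sqrt ((CQ * Q.nrm (\<lambda>x. qa \<alpha> x - qo x))\<^sup>2 + (\<kappa> * load R0)\<^sup>2 / (2 * (\<alpha> - 1)))) \<longlongrightarrow> 0) at_top"
      using tendsto_real_sqrt[OF tendsto_add[OF tendsto_power[OF tendsto_mult_right_zero[OF q_lim, of CQ], of 2]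
           tendsto_penalty[of "(\<kappa> * load R0)\<^sup>2"]]] by simp
    show "\<forall>\<^sub>F \<alpha> in at_top. E.nrm (\<lambda>x. S \<alpha> (qa \<alpha>) x - T qo x)
       \<le> sqrt ((CQ * Q.nrm (\<lambda>x. qa \<alpha> x - qo x))\<^sup>2 + (\<kappa> * load R0)\<^sup>2 / (2 * (\<alpha> - 1)))"
      using ev
    proof eventually_elim
      case (elim \<alpha>)
      then have 0: "0 < \<alpha>" by simp
      show ?case
        unfolding E.nrm_def
        by (rule real_sqrt_le_mono[OF state_error[OF qo qa[OF 0] elim S[OF qo] Sa[OF 0 qa[OF 0]]]])
          (simp add: R0_def)
    qed
  qed
  have pV: "p \<in> V" using P memV by (simp add: is_adjoint_def)
  have paV: "pa \<alpha> \<in> V" if "0 < \<alpha>" for \<alpha> using Pa[OF that] by (simp add: is_penalised_adjoint_def)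
  have nonnegP: "\<forall>\<^sub>F \<alpha> in at_top. 0 \<le> E.nrm (\<lambda>x. pa \<alpha> x - p x)"
    using ev by eventually_elim (simp add: E.nrm_nonneg A.diff_mem pV paV)
  let ?N = "CH * H.nrm (\<lambda>x. T qo x - zd x) + E.nrm p"
  have hu_lim: "((\<lambda>\<alpha>. H.nrm (\<lambda>x. S \<alpha> (qa \<alpha>) x - T qo x)) \<longlongrightarrow> 0) at_top"
  proof (rule tendsto_sandwich[OF _ _ tendsto_const tendsto_mult_right_zero[OF u_lim, of CH]])
    show "\<forall>\<^sub>F \<alpha> in at_top. 0 \<le> H.nrm (\<lambda>x. S \<alpha> (qa \<alpha>) x - T qo x)"
      using ev by eventually_elim (simp add: H.nrm_nonneg H.diff_mem memH SV TV qo qa)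
    show "\<forall>\<^sub>F \<alpha> in at_top. H.nrm (\<lambda>x. S \<alpha> (qa \<alpha>) x - T qo x) \<le> CH * E.nrm (\<lambda>x. S \<alpha> (qa \<alpha>) x - T qo x)"
      using ev by eventually_elim (simp add: CH(2) A.diff_mem SV TV qo qa)
  qed
  show "((\<lambda>\<alpha>. E.nrm (\<lambda>x. pa \<alpha> x - p x)) \<longlongrightarrow> 0) at_top"
  proof (rule tendsto_sandwich[OF nonnegP _ tendsto_const])
    show "((\<lambda>\<alpha>. sqrt ((CH * H.nrm (\<lambda>x. S \<alpha> (qa \<alpha>) x - T qo x))\<^sup>2 + (\<kappa> * ?N)\<^sup>2 / (2 * (\<alpha> - 1)))) \<longlongrightarrow> 0) at_top"
      using tendsto_real_sqrt[OF tendsto_add[OF tendsto_power[OF tendsto_mult_right_zero[OF hu_lim, of CH], of 2]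
           tendsto_penalty[of "(\<kappa> * ?N)\<^sup>2"]]] by simp
    show "\<forall>\<^sub>F \<alpha> in at_top. E.nrm (\<lambda>x. pa \<alpha> x - p x)
       \<le> sqrt ((CH * H.nrm (\<lambda>x. S \<alpha> (qa \<alpha>) x - T qo x))\<^sup>2 + (\<kappa> * ?N)\<^sup>2 / (2 * (\<alpha> - 1)))"
      using ev
    proof eventually_elim
      case (elim \<alpha>)
      then have 0: "0 < \<alpha>" by simp
      show ?case
        unfolding E.nrm_def
        by (rule real_sqrt_le_mono[OF adjoint_error[OF TV[OF qo] SV[OF 0 qa[OF 0]] elim P Pa[OF 0],
              unfolded E.nrm_def]])
    qed
  qed
qed

end

section \<open>Finiteness of the surface measure of a Lipschitz boundary\<close>

text \<open>
  The Hausdorff measure is either given by the outer measure or, should the latter fail to be countably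
  additive on the Borel sets, identically \<open>0\<close>; the bound holds in both cases.
\<close>

lemma emeasure_hausdorff_le: "emeasure (hausdorff_measure d) A \<le> hausdorff_outer d A"
  unfolding hausdorff_measure_def emeasure_measure_of_conv by simp

text \<open>
  If \<open>card D\<close> bounded coordinates \<open>c b\<close> control distances on \<open>S\<close>, then cutting the range of each
  coordinate into intervals of length \<open>\<rho> / N\<close> covers \<open>S\<close> by at most \<open>(3 * N) ^ card D\<close> cells of
  diameter at most \<open>C * card D * \<rho> / N\<close>. The \<open>N\<close> cancels in the sum that defines the Hausdorff measure.
\<close>
lemma hausdorff_outer_bounded:
  fixes S :: "'a::euclidean_space set" and c :: "'b \<Rightarrow> 'a \<Rightarrow> real"
  assumes D: "finite D" and "0 \<le> C" and "0 < \<rho>"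
    and bnd: "\<And>b y. b \<in> D \<Longrightarrow> y \<in> S \<Longrightarrow> \<bar>c b y\<bar> \<le> \<rho>"
    and dist: "\<And>y z. y \<in> S \<Longrightarrow> z \<in> S \<Longrightarrow> dist y z \<le> C * (\<Sum>b\<in>D. \<bar>c b y - c b z\<bar>)"
  shows "hausdorff_outer (card D) S
         \<le> ennreal (unit_ball_vol (real (card D)) * (3 / 2 * C * real (card D) * \<rho>) ^ card D)"
  unfolding hausdorff_outer_def
proof (rule SUP_least)
  fix \<delta> :: real assume "\<delta> \<in> {0<..}"
  then have \<delta>: "0 < \<delta>" by simp
  define d where "d = card D"
  define K where "K = C * real d * \<rho>"
  have K: "0 \<le> K" using assms by (simp add: K_def)
  obtain n :: nat where "K / \<delta> < real n" using reals_Archimedean2 by blast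
  define N where "N = Suc n"
  have N: "0 < real N" "K / real N \<le> \<delta>"
    using \<open>K / \<delta> < real n\<close> \<delta> by (auto simp: N_def field_simps)
  define \<epsilon> where "\<epsilon> = \<rho> / real N"
  have \<epsilon>: "0 < \<epsilon>" using N assms by (simp add: \<epsilon>_def)
  define cell where "cell = (\<lambda>k. {y \<in> S. \<forall>b\<in>D. \<lfloor>c b y / \<epsilon>\<rfloor> = (k b :: int)})"
  define P where "P = PiE D (\<lambda>_. {- int N..int N})"
  have finP: "finite P" unfolding P_def using D by (intro finite_PiE) auto
  have cardP: "card P = (2 * N + 1) ^ d"
    unfolding P_def using D by (simp add: card_PiE d_def nat_add_distrib nat_mult_distrib)
  obtain h where h: "bij_betw h {0..<card P} P" using ex_bij_betw_nat_finite[OF finP] by blast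
  define U where "U = (\<lambda>i. if i < card P then cell (h i) else {})"
  have near: "norm (y - z) \<le> K / real N" if "y \<in> cell k" "z \<in> cell k" for k y z
  proof -
    have "\<bar>c b y - c b z\<bar> \<le> \<epsilon>" if b: "b \<in> D" for b
    proof -
      have "\<lfloor>c b y / \<epsilon>\<rfloor> = \<lfloor>c b z / \<epsilon>\<rfloor>"
        using \<open>y \<in> cell k\<close> \<open>z \<in> cell k\<close> b by (simp add: cell_def)
      then have "\<bar>c b y / \<epsilon> - c b z / \<epsilon>\<bar> \<le> 1" by linarith
      then have "\<bar>(c b y - c b z) / \<epsilon>\<bar> \<le> 1" by (simp add: diff_divide_distrib)
      then show ?thesis using \<epsilon> by (simp add: abs_divide)
    qed
    then have "(\<Sum>b\<in>D. \<bar>c b y - c b z\<bar>) \<le> (\<Sum>b\<in>D. \<epsilon>)" by (rule sum_mono)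
    then have "C * (\<Sum>b\<in>D. \<bar>c b y - c b z\<bar>) \<le> C * (real d * \<epsilon>)"
      using \<open>0 \<le> C\<close> by (intro mult_left_mono) (simp_all add: d_def)
    then show ?thesis
      using dist[of y z] that by (simp add: cell_def dist_norm K_def \<epsilon>_def mult_ac)
  qed
  have diam: "diameter (cell k) \<le> K / real N" for k
    using near[of _ k] K N by (intro diameter_le) auto
  have bdd: "bounded (cell k)" for k
  proof (cases "cell k = {}")
    case False
    then obtain y where "y \<in> cell k" by blast
    then show ?thesis
      unfolding bounded_def dist_norm using near[of y k] by blast
  qed simp
  have cover: "S \<subseteq> (\<Union>i. U i)"
  proof
    fix y assume y: "y \<in> S"
    define k where "k = restrict (\<lambda>b. \<lfloor>c b y / \<epsilon>\<rfloor>) D"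
    have "k \<in> P"
    proof -
      have "\<lfloor>c b y / \<epsilon>\<rfloor> \<in> {- int N..int N}" if b: "b \<in> D" for b
      proof -
        have "\<bar>c b y / \<epsilon>\<bar> \<le> \<rho> / \<epsilon>"
          using bnd[OF b y] \<epsilon> by (simp add: abs_divide divide_right_mono)
        also have "\<rho> / \<epsilon> = real N" using N assms by (simp add: \<epsilon>_def)
        finally have "- real N \<le> c b y / \<epsilon>" "c b y / \<epsilon> \<le> real N" by linarith+
        then show ?thesis by (auto simp: le_floor_iff floor_le_iff)
      qed
      then show ?thesis by (auto simp: P_def k_def)
    qed
    then obtain i where i: "i < card P" "h i = k"
      using h by (auto simp: bij_betw_def image_iff set_eq_iff) (metis atLeastLessThan_iff)
    then have "y \<in> U i" using y by (simp add: U_def cell_def k_def)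
    then show "y \<in> (\<Union>i. U i)" by blast
  qed
  let ?w = "\<lambda>i. if U i = {} then 0 else ennreal (unit_ball_vol (real d) * (diameter (U i) / 2) ^ d)"
  have "hausdorff_pre d \<delta> S \<le> (\<Sum>i. ?w i)"
    unfolding hausdorff_pre_def
  proof (rule INF_lower)
    have "diameter (cell k) \<le> \<delta>" for k using diam[of k] N by linarith
    then show "U \<in> {U. S \<subseteq> (\<Union>i. U i) \<and> (\<forall>i. bounded (U i) \<and> diameter (U i) \<le> \<delta>)}"
      using cover bdd \<delta> by (auto simp: U_def)
  qed
  also have "\<dots> = (\<Sum>i<card P. ?w i)"
    by (rule suminf_finite) (auto simp: U_def)
  also have "\<dots> \<le> (\<Sum>i<card P. ennreal (unit_ball_vol (real d) * (K / (2 * real N)) ^ d))"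
  proof (intro sum_mono)
    fix i assume "i \<in> {..<card P}"
    then have "U i = cell (h i)" by (simp add: U_def)
    then have "diameter (U i) / 2 \<le> K / (2 * real N)" using diam[of "h i"] by simp
    moreover have "0 \<le> diameter (U i)" using bdd by (intro diameter_ge_0) (simp add: U_def)
    ultimately show "?w i \<le> ennreal (unit_ball_vol (real d) * (K / (2 * real N)) ^ d)"
      by (auto intro!: ennreal_leI mult_left_mono power_mono)
  qed
  also have "\<dots> = ennreal (real (card P) * (unit_ball_vol (real d) * (K / (2 * real N)) ^ d))"
    using K by (simp add: ennreal_mult' ennreal_of_nat_eq_real_of_nat)
  also have "\<dots> \<le> ennreal (unit_ball_vol (real d) * (3 / 2 * C * real d * \<rho>) ^ d)"
  proof (rule ennreal_leI)
    have "real (card P) * (K / (2 * real N)) ^ d = ((2 * real N + 1) * (K / (2 * real N))) ^ d"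
      unfolding power_mult_distrib by (simp add: cardP add.commute)
    also have "\<dots> \<le> (3 * real N * (K / (2 * real N))) ^ d"
      using K N by (intro power_mono mult_right_mono) (auto simp: N_def)
    also have "3 * real N * (K / (2 * real N)) = 3 / 2 * C * real d * \<rho>"
      using N by (simp add: K_def)
    finally show "real (card P) * (unit_ball_vol (real d) * (K / (2 * real N)) ^ d)
        \<le> unit_ball_vol (real d) * (3 / 2 * C * real d * \<rho>) ^ d"
      using mult_left_mono[of _ _ "unit_ball_vol (real d)"] by (simp add: mult.left_commute)
  qed
  finally show "hausdorff_pre (card D) \<delta> S
      \<le> ennreal (unit_ball_vol (real (card D)) * (3 / 2 * C * real (card D) * \<rho>) ^ card D)"
    by (simp add: d_def)
qed

text \<open>
  On a Lipschitz graph the coordinates in an orthonormal basis of the hyperplane orthogonal to \<open>\<nu>\<close>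
  control distances, with constant \<open>1 + L\<close>.
\<close>
lemma hausdorff_outer_lipschitz_graph:
  fixes S :: "'a::euclidean_space set" and f :: "'a \<Rightarrow> real"
  assumes \<nu>: "norm \<nu> = 1" and f: "lipschitz_on L UNIV f" and "bounded S"
    and graph: "\<And>y. y \<in> S \<Longrightarrow> f (y - inner y \<nu> *\<^sub>R \<nu>) = inner y \<nu>"
  shows "hausdorff_outer (DIM('a) - 1) S < \<infinity>"
proof -
  have "subspace {y. inner \<nu> y = 0}" by (rule subspace_hyperplane)
  from orthonormal_basis_subspace[OF this] obtain D where
    D: "D \<subseteq> {y. inner \<nu> y = 0}" "pairwise orthogonal D" "\<And>b. b \<in> D \<Longrightarrow> norm b = 1"
      "independent D" "card D = dim {y. inner \<nu> y = 0}" "span D = {y. inner \<nu> y = 0}"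
    by blast
  have "\<nu> \<noteq> 0" using \<nu> by auto
  then have card: "card D = DIM('a) - 1" using D(5) dim_hyperplane by metis
  have fin: "finite D" using D(4) by (rule independent_imp_finite)
  have L: "0 \<le> L" using f by (simp add: lipschitz_on_def)
  obtain \<rho> where \<rho>: "0 < \<rho>" "\<And>y. y \<in> S \<Longrightarrow> norm y \<le> \<rho>"
    using \<open>bounded S\<close> unfolding bounded_pos by blast
  have nn: "inner \<nu> \<nu> = 1" using \<nu> by (simp add: dot_square_norm)
  have "hausdorff_outer (card D) S
       \<le> ennreal (unit_ball_vol (real (card D)) * (3 / 2 * (1 + L) * real (card D) * \<rho>) ^ card D)"
  proof (rule hausdorff_outer_bounded[OF fin _ \<rho>(1), where c = "\<lambda>b y. inner y b"])
    show "0 \<le> 1 + L" using L by simp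
    show "\<bar>inner y b\<bar> \<le> \<rho>" if "b \<in> D" "y \<in> S" for b y
      using Cauchy_Schwarz_ineq2[of y b] D(3)[OF that(1)] \<rho>(2)[OF that(2)] by simp
    show "dist y z \<le> (1 + L) * (\<Sum>b\<in>D. \<bar>inner y b - inner z b\<bar>)" if yz: "y \<in> S" "z \<in> S" for y z
    proof -
      let ?P = "\<lambda>y. y - inner y \<nu> *\<^sub>R \<nu>"
      define w where "w = ?P y - ?P z"
      have "inner w \<nu> = 0" by (simp add: w_def inner_diff_left nn)
      then have "w \<in> span D" unfolding D(6) by (simp add: inner_commute)
      then have "w = (\<Sum>b\<in>D. inner w b *\<^sub>R b)"
        using orthonormal_basis_expand[OF D(2,3) _ fin] by simp
      then have "norm w \<le> (\<Sum>b\<in>D. norm (inner w b *\<^sub>R b))" by (metis norm_sum)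
      also have "\<dots> = (\<Sum>b\<in>D. \<bar>inner y b - inner z b\<bar>)"
      proof (intro sum.cong refl)
        fix b assume b: "b \<in> D"
        then have "inner \<nu> b = 0" using D(1) by auto
        then show "norm (inner w b *\<^sub>R b) = \<bar>inner y b - inner z b\<bar>"
          using D(3)[OF b] by (simp add: w_def inner_diff_left)
      qed
      finally have w: "norm w \<le> (\<Sum>b\<in>D. \<bar>inner y b - inner z b\<bar>)" .
      have "\<bar>inner y \<nu> - inner z \<nu>\<bar> \<le> L * norm w"
        using lipschitz_onD[OF f, of "?P y" "?P z"] graph[OF yz(1)] graph[OF yz(2)]
        by (simp add: w_def dist_norm)
      moreover have "y - z = w + (inner y \<nu> - inner z \<nu>) *\<^sub>R \<nu>"
        by (simp add: w_def algebra_simps)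
      then have "norm (y - z) \<le> norm w + \<bar>inner y \<nu> - inner z \<nu>\<bar>"
        using norm_triangle_ineq[of w "(inner y \<nu> - inner z \<nu>) *\<^sub>R \<nu>"] \<nu> by simp
      ultimately have "norm (y - z) \<le> (1 + L) * norm w" by (simp add: algebra_simps)
      also have "\<dots> \<le> (1 + L) * (\<Sum>b\<in>D. \<bar>inner y b - inner z b\<bar>)"
        using w L by (intro mult_left_mono) auto
      finally show ?thesis by (simp add: dist_norm)
    qed
  qed
  then show ?thesis unfolding card by (rule order_le_less_trans) simp
qed

lemma epigraph_frontier:
  fixes \<Omega> :: "'a::euclidean_space set" and f :: "'a \<Rightarrow> real"
  assumes "open \<Omega>" and f: "continuous_on UNIV f"
    and chart: "\<Omega> \<inter> ball x r = {y \<in> ball x r. f (y - inner y \<nu> *\<^sub>R \<nu>) < inner y \<nu>}"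
    and y: "y \<in> frontier \<Omega> \<inter> ball x r"
  shows "f (y - inner y \<nu> *\<^sub>R \<nu>) = inner y \<nu>"
proof (rule antisym)
  have mem: "z \<in> \<Omega> \<longleftrightarrow> f (z - inner z \<nu> *\<^sub>R \<nu>) < inner z \<nu>" if "z \<in> ball x r" for z
    using that chart[THEN eqset_imp_iff, of z] by blast
  have yb: "y \<in> ball x r" using y by blast
  have "y \<notin> \<Omega>" using y \<open>open \<Omega>\<close> by (simp add: frontier_def interior_open)
  then show "inner y \<nu> \<le> f (y - inner y \<nu> *\<^sub>R \<nu>)" using mem[OF yb] by (simp add: not_less)
  show "f (y - inner y \<nu> *\<^sub>R \<nu>) \<le> inner y \<nu>"
  proof (rule ccontr)
    assume neg: "\<not> ?thesis"
    define Y where "Y = {z. inner z \<nu> < f (z - inner z \<nu> *\<^sub>R \<nu>)} \<inter> ball x r"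
    have "continuous_on UNIV (\<lambda>z. f (z - inner z \<nu> *\<^sub>R \<nu>))"
      by (rule continuous_on_compose2[OF f]) (auto intro!: continuous_intros)
    then have "open Y"
      unfolding Y_def by (intro open_Int open_Collect_less continuous_intros) auto
    moreover have "y \<in> Y" using y neg by (auto simp: Y_def)
    moreover have "y \<in> closure \<Omega>" using y by (simp add: frontier_def)
    ultimately have "Y \<inter> \<Omega> \<noteq> {}" using open_Int_closure_eq_empty[of Y \<Omega>] by blast
    then obtain z where "z \<in> Y" "z \<in> \<Omega>" by blast
    then show False using mem[of z] unfolding Y_def by force
  qed
qed

lemma finite_hausdorff_frontier:
  fixes \<Omega> :: "'a::euclidean_space set"
  assumes "open \<Omega>" and "bounded \<Omega>" and lip: "lipschitz_boundary \<Omega>"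
  shows "emeasure (hausdorff_measure (DIM('a) - 1)) (frontier \<Omega>) < \<infinity>"
proof -
  let ?\<mu> = "hausdorff_measure (DIM('a) - 1) :: 'a measure"
  have "\<exists>r>0. emeasure ?\<mu> (frontier \<Omega> \<inter> ball x r) < \<infinity>" if x: "x \<in> frontier \<Omega>" for x
  proof -
    obtain r \<nu> f L where r: "r > 0" "norm \<nu> = 1" "lipschitz_on L UNIV (f :: 'a \<Rightarrow> real)"
      "\<Omega> \<inter> ball x r = {y \<in> ball x r. f (y - inner y \<nu> *\<^sub>R \<nu>) < inner y \<nu>}"
      using bspec[OF lip[unfolded lipschitz_boundary_def] x] by (elim exE conjE) (rule that)
    have "hausdorff_outer (DIM('a) - 1) (frontier \<Omega> \<inter> ball x r) < \<infinity>"
      by (rule hausdorff_outer_lipschitz_graph[OF r(2,3)])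
        (use epigraph_frontier[OF \<open>open \<Omega>\<close> lipschitz_on_continuous_on[OF r(3)] r(4)] bounded_ball in auto)
    then show ?thesis using r(1) emeasure_hausdorff_le order_le_less_trans by blast
  qed
  then obtain r where r: "\<And>x. x \<in> frontier \<Omega> \<Longrightarrow> 0 < r x"
      "\<And>x. x \<in> frontier \<Omega> \<Longrightarrow> emeasure ?\<mu> (frontier \<Omega> \<inter> ball x (r x)) < \<infinity>"
    by metis
  have "compact (frontier \<Omega>)" using \<open>bounded \<Omega>\<close> by (rule compact_frontier_bounded)
  then obtain F where F: "F \<subseteq> frontier \<Omega>" "finite F" "frontier \<Omega> \<subseteq> (\<Union>x\<in>F. ball x (r x))"
    by (rule compactE_image[of _ "frontier \<Omega>" "\<lambda>x. ball x (r x)"]) (use r(1) in force)+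
  have fb: "frontier \<Omega> \<inter> ball x (r x) \<in> sets borel" for x
    by (intro sets.Int borel_closed borel_open open_ball frontier_closed)
  have "emeasure ?\<mu> (frontier \<Omega>) \<le> emeasure ?\<mu> (\<Union>x\<in>F. frontier \<Omega> \<inter> ball x (r x))"
    using F fb by (intro emeasure_mono) (auto intro!: sets.finite_UN simp del: UN_simps)
  also have "\<dots> \<le> (\<Sum>x\<in>F. emeasure ?\<mu> (frontier \<Omega> \<inter> ball x (r x)))"
    using F fb by (intro emeasure_subadditive_finite) auto
  also have "\<dots> < \<infinity>" using F r(2) by (auto simp: subset_iff)
  finally show ?thesis .
qed

lemma finite_surface_measure:
  fixes \<Omega> S :: "'a::euclidean_space set"
  assumes "open \<Omega>" and "bounded \<Omega>" and "lipschitz_boundary \<Omega>"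
    and "S \<in> sets borel" and "S \<subseteq> frontier \<Omega>"
  shows "finite_measure (surface_measure S)"
proof
  have "emeasure (surface_measure S) (space (surface_measure S))
      = emeasure (hausdorff_measure (DIM('a) - 1)) S"
    using assms(4) by (simp add: surface_measure_def space_restrict_space emeasure_restrict_space)
  also have "\<dots> \<le> emeasure (hausdorff_measure (DIM('a) - 1)) (frontier \<Omega>)"
    using assms by (intro emeasure_mono) auto
  also have "\<dots> < \<infinity>" by (rule finite_hausdorff_frontier[OF assms(1-3)])
  finally show "emeasure (surface_measure S) (space (surface_measure S)) \<noteq> \<infinity>" by simp
qed

section \<open>Uniqueness of weak gradients\<close>

definition C1_function :: "('a::euclidean_space \<Rightarrow> real) \<Rightarrow> bool" where
  "C1_function p \<longleftrightarrow> (\<exists>D. (\<forall>x. GDERIV p x :> D x) \<and> continuous_on UNIV D)"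

lemma C1_functionI: "(\<And>x. GDERIV p x :> D x) \<Longrightarrow> continuous_on UNIV D \<Longrightarrow> C1_function p"
  unfolding C1_function_def by blast

lemma GDERIV_imp_continuous_on:
  assumes "\<And>x. GDERIV p x :> D x" shows "continuous_on S p"
proof (rule continuous_at_imp_continuous_on, rule ballI)
  show "isCont p x" for x using assms[of x] unfolding gderiv_def by (rule has_derivative_continuous)
qed

lemma C1_function_continuous: "C1_function p \<Longrightarrow> continuous_on S p"
  unfolding C1_function_def using GDERIV_imp_continuous_on by blast

lemma C1_function_const: "C1_function (\<lambda>_. c)"
  unfolding C1_function_def by (intro exI[of _ "\<lambda>_. 0"]) (simp add: GDERIV_const)

lemma C1_function_mult:
  assumes "C1_function p" "C1_function q" shows "C1_function (\<lambda>x. p x * q x)"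
proof -
  obtain P Q where P: "\<And>x. GDERIV p x :> P x" "continuous_on UNIV P"
    and Q: "\<And>x. GDERIV q x :> Q x" "continuous_on UNIV Q"
    using assms unfolding C1_function_def by blast
  have "GDERIV (\<lambda>x. p x * q x) x :> p x *\<^sub>R Q x + q x *\<^sub>R P x" for x
    by (rule GDERIV_mult[OF P(1) Q(1)])
  moreover have "continuous_on UNIV (\<lambda>x. p x *\<^sub>R Q x + q x *\<^sub>R P x)"
    by (intro continuous_intros P(2) Q(2) GDERIV_imp_continuous_on[OF P(1)] GDERIV_imp_continuous_on[OF Q(1)])
  ultimately show ?thesis by (rule C1_functionI)
qed

lemma C1_function_compose:
  fixes f f' :: "real \<Rightarrow> real"
  assumes p: "C1_function p" and f: "\<And>x. DERIV f (p x) :> f' (p x)" and f': "continuous_on (range p) f'"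
  shows "C1_function (\<lambda>x. f (p x))"
proof -
  obtain P where P: "\<And>x. GDERIV p x :> P x" "continuous_on UNIV P"
    using p unfolding C1_function_def by blast
  have "GDERIV (\<lambda>x. f (p x)) x :> f' (p x) *\<^sub>R P x" for x
    by (rule GDERIV_DERIV_compose[OF P(1) f])
  moreover have "continuous_on UNIV (\<lambda>x. f' (p x) *\<^sub>R P x)"
    by (intro continuous_intros P(2) continuous_on_compose2[OF f' GDERIV_imp_continuous_on[OF P(1)]]) auto
  ultimately show ?thesis by (rule C1_functionI)
qed

lemma DERIV_square_positive_part: "DERIV (\<lambda>t::real. (max 0 t)\<^sup>2) t :> 2 * max 0 t"
proof (cases t "0 :: real" rule: linorder_cases)
  case less
  have "DERIV (\<lambda>t::real. 0) t :> 2 * max 0 t" using less by simp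
  then show ?thesis
    by (rule has_field_derivative_transform_within_open[of _ _ _ "{..<0}"]) (use less in auto)
next
  case equal
  have "((\<lambda>h::real. max 0 h) \<longlongrightarrow> 0) (at 0)"
    by (rule tendsto_eq_intros | simp)+
  moreover have "(\<lambda>h::real. ((max 0 (0 + h))\<^sup>2 - (max 0 0)\<^sup>2) / h) = (\<lambda>h. max 0 h)"
    by (auto simp: fun_eq_iff max_def power2_eq_square)
  ultimately show ?thesis unfolding equal DERIV_def by simp
next
  case greater
  have "DERIV (\<lambda>t::real. t\<^sup>2) t :> 2 * max 0 t"
    using greater by (auto intro!: derivative_eq_intros)
  then show ?thesis
    by (rule has_field_derivative_transform_within_open[of _ _ _ "{0<..}"]) (use greater in auto)
qed

lemma C1_function_square_positive_part:
  assumes "C1_function p" shows "C1_function (\<lambda>x. (max 0 (p x))\<^sup>2)"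
  by (rule C1_function_compose[OF assms DERIV_square_positive_part]) (intro continuous_intros)

text \<open>
  As \<open>k\<close> grows, these functions increase to the indicator function of the set where \<open>p\<close> is positive.
\<close>
lemma C1_function_saturate:
  assumes p: "C1_function p" "\<And>x. 0 \<le> p x" and k: "0 \<le> k"
  shows "C1_function (\<lambda>x. k * p x / (1 + k * p x))"
proof (rule C1_function_compose[OF p(1), where f = "\<lambda>t. k * t / (1 + k * t)" and f' = "\<lambda>t. k / (1 + k * t)\<^sup>2"])
  have pos: "0 < 1 + k * p x" for x using p(2)[of x] k by (simp add: add_pos_nonneg)
  show "DERIV (\<lambda>t. k * t / (1 + k * t)) (p x) :> k / (1 + k * p x)\<^sup>2" for x
    using pos[of x] by (auto intro!: derivative_eq_intros simp: field_simps power2_eq_square)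
  show "continuous_on (range p) (\<lambda>t. k / (1 + k * t)\<^sup>2)"
    using pos by (intro continuous_intros) (auto, metis less_irrefl)
qed

lemma C1_function_linear: "C1_function (\<lambda>x. inner x a + c)"
  unfolding C1_function_def gderiv_def
  by (intro exI[of _ "\<lambda>_. a"]) (auto intro!: derivative_eq_intros)

lemma C1_function_bump: "C1_function (\<lambda>x. r\<^sup>2 - inner (x - c) (x - c))"
  unfolding C1_function_def gderiv_def
proof (intro exI[of _ "\<lambda>x. - 2 *\<^sub>R (x - c)"] conjI allI)
  show "((\<lambda>x. r\<^sup>2 - inner (x - c) (x - c)) has_derivative (\<lambda>h. inner h (- 2 *\<^sub>R (x - c)))) (at x)" for x
    by (auto intro!: derivative_eq_intros simp: fun_eq_iff inner_commute algebra_simps)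
qed (intro continuous_intros)

text \<open>
  The sets on which nonnegative \<open>C\<^sup>1\<close> functions are positive are stable under intersection, by taking
  products, and contain the open half-spaces. So they are a generator of the Borel sets to
  which Dynkin's lemma applies, and their indicator functions are limits of \<open>C\<^sup>1\<close> functions.
\<close>
definition C1_open_sets :: "'a::euclidean_space set set" where
  "C1_open_sets = {{x. 0 < p x} | p. C1_function p \<and> (\<forall>x. 0 \<le> p x)}"

lemma Int_stable_C1_open_sets: "Int_stable C1_open_sets"
proof (rule Int_stableI)
  fix A B :: "'a set" assume "A \<in> C1_open_sets" "B \<in> C1_open_sets"
  then obtain p q where p: "A = {x. 0 < p x}" "C1_function p" "\<forall>x. 0 \<le> p x"
    and q: "B = {x. 0 < q x}" "C1_function q" "\<forall>x. 0 \<le> q x"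
    unfolding C1_open_sets_def by blast
  have "A \<inter> B = {x. 0 < p x * q x}"
    unfolding p(1) q(1) using p(3) q(3) by (auto simp: zero_less_mult_iff not_less[symmetric])
  then show "A \<inter> B \<in> C1_open_sets"
    unfolding C1_open_sets_def using C1_function_mult[OF p(2) q(2)] p(3) q(3)
    by (intro CollectI exI[of _ "\<lambda>x. p x * q x"]) auto
qed

lemma sets_borel_C1_open_sets: "A \<in> sets borel \<Longrightarrow> A \<in> sigma_sets UNIV C1_open_sets"
proof -
  assume "A \<in> sets borel"
  then have "A \<in> sigma_sets UNIV ((\<lambda>(a, i). {x::'a. a < x \<bullet> i}) ` (UNIV \<times> Basis))"
    by (subst (asm) borel_eq_halfspace_greater) (simp add: sets_measure_of)
  moreover have "(\<lambda>(a, i). {x::'a. a < x \<bullet> i}) ` (UNIV \<times> Basis) \<subseteq> C1_open_sets"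
  proof clarify
    fix a :: real and i :: 'a
    have "{x. a < x \<bullet> i} = {x. 0 < (max 0 (x \<bullet> i + (- a)))\<^sup>2}"
      by (auto simp: max_def)
    then show "{x. a < x \<bullet> i} \<in> C1_open_sets"
      unfolding C1_open_sets_def using C1_function_square_positive_part[OF C1_function_linear[of i "- a"]]
      by (intro CollectI exI[of _ "\<lambda>x. (max 0 (x \<bullet> i + (- a)))\<^sup>2"]) auto
  qed
  ultimately show ?thesis by (meson sigma_sets_mono' subsetD)
qed

lemma C1_open_sets_Pow: "C1_open_sets \<subseteq> Pow UNIV"
  by simp

lemma C1_open_sets_borel: "A \<in> sigma_sets UNIV C1_open_sets \<Longrightarrow> A \<in> sets borel"
proof (induction rule: sigma_sets.induct)
  case (Basic A)
  then obtain p where p: "A = {x. 0 < p x}" "C1_function p" unfolding C1_open_sets_def by blast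
  have "open A"
    unfolding p(1) by (intro open_Collect_less continuous_intros C1_function_continuous[OF p(2)])
  then show ?case by simp
qed auto

lemma test_functionE:
  assumes "test_function \<Omega> \<phi> D\<phi>"
  obtains K B where "compact K" "K \<subseteq> \<Omega>" "\<And>x. x \<notin> K \<Longrightarrow> \<phi> x = 0" "\<And>x. x \<notin> K \<Longrightarrow> D\<phi> x = 0"
    "\<And>x. \<bar>\<phi> x\<bar> \<le> B" "\<And>x. norm (D\<phi> x) \<le> B" "continuous_on UNIV \<phi>" "continuous_on UNIV D\<phi>"
proof -
  define K where "K = closure {x. \<phi> x \<noteq> 0}"
  have K: "compact K" "K \<subseteq> \<Omega>" and der: "\<And>x. GDERIV \<phi> x :> D\<phi> x" and cD: "continuous_on UNIV D\<phi>"
    using assms by (auto simp: test_function_def K_def)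
  have cont: "continuous_on S \<phi>" for S by (rule GDERIV_imp_continuous_on[OF der])
  have 0: "\<phi> x = 0" if "x \<notin> K" for x
    using that closure_subset[of "{x. \<phi> x \<noteq> 0}"] by (auto simp: K_def)
  have D0: "D\<phi> x = 0" if x: "x \<notin> K" for x
  proof -
    have "((\<lambda>_. 0) has_derivative (\<lambda>h. inner h (D\<phi> x))) (at x)"
      by (rule has_derivative_transform_within_open[OF der[of x, unfolded gderiv_def], of "- K"])
        (use x K(1) 0 in \<open>auto intro: compact_imp_closed\<close>)
    then have "(\<lambda>h. inner h (D\<phi> x)) = (\<lambda>_. 0)"
      by (rule has_derivative_unique) simp
    then show ?thesis by (metis inner_eq_zero_iff)
  qed
  have "bounded (\<phi> ` K)" "bounded (D\<phi> ` K)"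
    using compact_continuous_image[OF cont K(1)]
      compact_continuous_image[OF continuous_on_subset[OF cD] K(1)] compact_imp_bounded by auto
  then obtain B1 B2 where B: "\<And>x. x \<in> K \<Longrightarrow> norm (\<phi> x) \<le> B1" "\<And>x. x \<in> K \<Longrightarrow> norm (D\<phi> x) \<le> B2"
    unfolding bounded_iff by auto
  define B where "B = max 0 (max B1 B2)"
  have b1: "\<bar>\<phi> x\<bar> \<le> B" for x
    using B(1)[of x] 0[of x] by (cases "x \<in> K") (auto simp: B_def)
  have b2: "norm (D\<phi> x) \<le> B" for x
    using B(2)[of x] D0[of x] by (cases "x \<in> K") (auto simp: B_def)
  show ?thesis by (rule that[OF K 0 D0 b1 b2 cont cD])
qed

lemma test_function_integrable:
  fixes G :: "'a::euclidean_space \<Rightarrow> 'b::euclidean_space"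
  assumes \<phi>: "test_function \<Omega> \<phi> D\<phi>" and G: "locally_integrable \<Omega> G" and \<Omega>: "open \<Omega>"
  shows "integrable (lebesgue_on \<Omega>) (\<lambda>x. \<phi> x *\<^sub>R G x)"
proof -
  obtain K B where K: "compact K" "K \<subseteq> \<Omega>" "\<And>x. x \<notin> K \<Longrightarrow> \<phi> x = 0"
      "\<And>x. \<bar>\<phi> x\<bar> \<le> B" "continuous_on UNIV \<phi>"
    using \<phi> by (rule test_functionE) blast
  have Km: "K \<in> sets lebesgue" using K(1) by (simp add: borel_compact)
  have GK: "integrable lebesgue (\<lambda>x. indicator K x *\<^sub>R G x)"
  proof -
    have "integrable (lebesgue_on K) G" using G K(1,2) by (simp add: locally_integrable_def)
    then show ?thesis using Km by (subst (asm) integrable_restrict_space) auto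
  qed
  have [measurable]: "\<phi> \<in> borel_measurable lebesgue"
    by (intro measurable_completion) (simp add: borel_measurable_continuous_onI K(5))
  have [measurable]: "(\<lambda>x. indicator K x *\<^sub>R G x) \<in> borel_measurable lebesgue"
    using GK by simp
  have eq: "(\<lambda>x. indicator \<Omega> x *\<^sub>R (\<phi> x *\<^sub>R G x)) = (\<lambda>x. \<phi> x *\<^sub>R (indicator K x *\<^sub>R G x))"
    using K(2,3) by (auto simp: fun_eq_iff indicator_def)
  have "integrable lebesgue (\<lambda>x. \<phi> x *\<^sub>R (indicator K x *\<^sub>R G x))"
  proof (rule Bochner_Integration.integrable_bound)
    show "integrable lebesgue (\<lambda>x. B *\<^sub>R norm (indicator K x *\<^sub>R G x))"
      using GK by (intro integrable_scaleR_right integrable_norm)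
    show "AE x in lebesgue. norm (\<phi> x *\<^sub>R (indicator K x *\<^sub>R G x)) \<le> norm (B *\<^sub>R norm (indicator K x *\<^sub>R G x))"
    proof (intro AE_I2)
      fix x
      have "\<bar>\<phi> x\<bar> * norm (indicator K x *\<^sub>R G x) \<le> \<bar>B\<bar> * norm (indicator K x *\<^sub>R G x)"
        using K(4)[of x] by (intro mult_right_mono) auto
      then show "norm (\<phi> x *\<^sub>R (indicator K x *\<^sub>R G x)) \<le> norm (B *\<^sub>R norm (indicator K x *\<^sub>R G x))"
        by (simp add: mult.assoc abs_mult)
    qed
  qed measurable
  then have "integrable lebesgue (\<lambda>x. indicator \<Omega> x *\<^sub>R (\<phi> x *\<^sub>R G x))" unfolding eq .
  moreover have "\<Omega> \<inter> space lebesgue \<in> sets lebesgue" using \<Omega> by simp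
  ultimately show ?thesis by (simp only: integrable_restrict_space)
qed

lemma sigma_finite_lebesgue: "sigma_finite_measure (lebesgue :: 'a::euclidean_space measure)"
proof
  obtain A :: "'a set set" where A: "countable A" "A \<subseteq> sets lborel" "\<Union>A = space lborel"
      "\<forall>a\<in>A. emeasure lborel a \<noteq> \<infinity>"
    using sigma_finite_measure.sigma_finite_countable[OF sigma_finite_lborel] by blast
  then show "\<exists>A. countable A \<and> A \<subseteq> sets (lebesgue :: 'a measure) \<and> \<Union>A = space lebesgue \<and>
      (\<forall>a\<in>A. emeasure lebesgue a \<noteq> \<infinity>)"
    by (intro exI[of _ A]) (auto simp: subset_iff)
qed

text \<open>
  The difference \<open>F\<close> of two weak gradients annihilates all test functions. Fix a ball inside the domain and a
  bump function \<open>\<psi>\<close> that is positive exactly there. For \<open>A\<close> the positivity set of \<open>p\<close>, the test functions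
  \<open>k * \<psi> * p / (1 + k * \<psi> * p)\<close> tend to the indicator function of the intersection of \<open>A\<close> with the
  ball, so the integral of \<open>F\<close> over that set is \<open>0\<close>. By Dynkin's lemma this extends to all Borel sets \<open>A\<close>, so
  \<open>F\<close> vanishes almost everywhere on the ball, and countably many balls exhaust the domain.
\<close>
lemma weak_gradient_unique:
  fixes \<Omega> :: "'a::euclidean_space set"
  assumes \<Omega>: "open \<Omega>" and G: "is_weak_gradient \<Omega> v G" and G': "is_weak_gradient \<Omega> v G'"
  shows "AE x in lebesgue_on \<Omega>. G x = G' x"
proof -
  define F where "F = (\<lambda>x. G x - G' x)"
  have li: "locally_integrable \<Omega> G" "locally_integrable \<Omega> G'"
    using G G' by (auto simp: is_weak_gradient_def)
  then have F: "locally_integrable \<Omega> F" by (auto simp: locally_integrable_def F_def)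
  have zero: "(LINT x|lebesgue_on \<Omega>. \<phi> x *\<^sub>R F x) = 0" if \<phi>: "test_function \<Omega> \<phi> D\<phi>" for \<phi> D\<phi>
  proof -
    have "(LINT x|lebesgue_on \<Omega>. \<phi> x *\<^sub>R G x) = (LINT x|lebesgue_on \<Omega>. \<phi> x *\<^sub>R G' x)"
      using G[unfolded is_weak_gradient_def, THEN conjunct2, THEN conjunct2, rule_format, OF \<phi>]
        G'[unfolded is_weak_gradient_def, THEN conjunct2, THEN conjunct2, rule_format, OF \<phi>]
      by simp
    then show ?thesis
      using test_function_integrable[OF \<phi> li(1) \<Omega>] test_function_integrable[OF \<phi> li(2) \<Omega>]
      by (simp add: F_def scaleR_diff_right)
  qed
  have local: "AE x in lebesgue. x \<in> ball c r \<longrightarrow> F x = 0" if r: "0 < r" and sub: "cball c r \<subseteq> \<Omega>" for c r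
  proof -
    define Fb where "Fb = (\<lambda>x. indicator (ball c r) x *\<^sub>R F x)"
    have "integrable lebesgue (\<lambda>x. indicator (cball c r) x *\<^sub>R F x)"
    proof -
      have "integrable (lebesgue_on (cball c r)) F"
        using F sub by (simp add: locally_integrable_def)
      then show ?thesis by (subst (asm) integrable_restrict_space) auto
    qed
    then have "integrable lebesgue (\<lambda>x. indicator (ball c r) x *\<^sub>R (indicator (cball c r) x *\<^sub>R F x))"
      by (rule integrable_mult_indicator[rotated]) simp
    moreover have "(\<lambda>x. indicator (ball c r) x *\<^sub>R (indicator (cball c r) x *\<^sub>R F x)) = Fb"
      by (auto simp: Fb_def fun_eq_iff indicator_def)
    ultimately have Fb: "integrable lebesgue Fb" by simp
    have [measurable]: "Fb \<in> borel_measurable lebesgue" using Fb by simp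
    define \<psi> where "\<psi> = (\<lambda>x. (max 0 (r\<^sup>2 - inner (x - c) (x - c)))\<^sup>2)"
    have \<psi>: "C1_function \<psi>"
      unfolding \<psi>_def by (rule C1_function_square_positive_part[OF C1_function_bump])
    have \<psi>0: "0 \<le> \<psi> x" for x by (simp add: \<psi>_def)
    have \<psi>_pos: "0 < \<psi> x \<longleftrightarrow> x \<in> ball c r" for x
    proof -
      have "0 < \<psi> x \<longleftrightarrow> (norm (x - c))\<^sup>2 < r\<^sup>2"
        by (auto simp: \<psi>_def max_def power2_norm_eq_inner)
      also have "\<dots> \<longleftrightarrow> norm (x - c) < r"
        using r power2_less_imp_less[of "norm (x - c)" r] power_strict_mono[of "norm (x - c)" r 2] by auto
      finally show ?thesis by (simp add: dist_norm norm_minus_commute)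
    qed
    have open_zero: "(LINT x|lebesgue. indicator A x *\<^sub>R Fb x) = 0" if "A \<in> C1_open_sets" for A
    proof -
      obtain p where A: "A = {x. 0 < p x}" and p: "C1_function p" "\<forall>x. 0 \<le> p x"
        using \<open>A \<in> C1_open_sets\<close> unfolding C1_open_sets_def by blast
      define q where "q = (\<lambda>x. \<psi> x * p x)"
      have q: "C1_function q" "\<And>x. 0 \<le> q x"
        unfolding q_def using C1_function_mult[OF \<psi> p(1)] \<psi>0 p(2) by auto
      have qpos: "0 < q x \<longleftrightarrow> x \<in> ball c r \<and> x \<in> A" for x
        unfolding q_def A using \<psi>_pos[of x] \<psi>0[of x] p(2)[rule_format, of x]
        by (auto simp: zero_less_mult_iff)
      have q0: "q x = 0" if "x \<notin> ball c r" for x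
        using qpos[of x] q(2)[of x] that by auto
      define \<phi> where "\<phi> = (\<lambda>k x. real k * q x / (1 + real k * q x))"
      have \<phi>01: "0 \<le> \<phi> k x" "\<phi> k x \<le> 1" for k x
      proof -
        have "0 \<le> real k * q x" using q(2)[of x] by simp
        then show "0 \<le> \<phi> k x" "\<phi> k x \<le> 1" by (simp_all add: \<phi>_def)
      qed
      have C1: "C1_function (\<phi> k)" for k
        unfolding \<phi>_def by (rule C1_function_saturate[OF q]) simp
      have [measurable]: "\<phi> k \<in> borel_measurable lebesgue" for k
        by (intro measurable_completion)
          (simp add: borel_measurable_continuous_onI C1_function_continuous[OF C1])
      have zero_k: "(LINT x|lebesgue. \<phi> k x *\<^sub>R Fb x) = 0" for k
      proof -
        obtain D where D: "\<And>x. GDERIV (\<phi> k) x :> D x" "continuous_on UNIV D"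
          using C1[of k] unfolding C1_function_def by blast
        have "{x. \<phi> k x \<noteq> 0} \<subseteq> cball c r"
          using q0 by (force simp: \<phi>_def)
        then have cl: "closure {x. \<phi> k x \<noteq> 0} \<subseteq> cball c r" by (rule closure_minimal) simp
        have "test_function \<Omega> (\<phi> k) D"
          unfolding test_function_def using D cl sub
          by (auto simp: compact_eq_bounded_closed intro: bounded_subset[OF bounded_cball])
        then have "(LINT x|lebesgue_on \<Omega>. \<phi> k x *\<^sub>R F x) = 0" by (rule zero)
        moreover have "\<Omega> \<inter> space lebesgue \<in> sets lebesgue" using \<Omega> by simp
        ultimately have "(LINT x|lebesgue. indicator \<Omega> x *\<^sub>R (\<phi> k x *\<^sub>R F x)) = 0"
          by (simp only: integral_restrict_space)
        moreover have "indicator \<Omega> x *\<^sub>R (\<phi> k x *\<^sub>R F x) = \<phi> k x *\<^sub>R Fb x" for x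
        proof (cases "x \<in> ball c r")
          case True
          then have "x \<in> \<Omega>" using sub by auto
          then show ?thesis using True by (simp add: Fb_def)
        next
          case False
          then show ?thesis using q0[OF False] by (simp add: \<phi>_def)
        qed
        ultimately show ?thesis by (simp only:)
      qed
      have "(\<lambda>k. LINT x|lebesgue. \<phi> k x *\<^sub>R Fb x) \<longlonglongrightarrow> (LINT x|lebesgue. indicator A x *\<^sub>R Fb x)"
      proof (rule integral_dominated_convergence[where w = "\<lambda>x. norm (Fb x)"])
        have "open A" unfolding A
          by (intro open_Collect_less continuous_intros C1_function_continuous[OF p(1)])
        then have [measurable]: "A \<in> sets lebesgue" by simp
        show "(\<lambda>x. indicator A x *\<^sub>R Fb x) \<in> borel_measurable lebesgue" by simp
        show "integrable lebesgue (\<lambda>x. norm (Fb x))" using Fb by (rule integrable_norm)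
        show "AE x in lebesgue. norm (\<phi> k x *\<^sub>R Fb x) \<le> norm (Fb x)" for k
          using \<phi>01[of k] by (auto intro!: AE_I2 mult_left_le_one_le)
        show "AE x in lebesgue. (\<lambda>k. \<phi> k x *\<^sub>R Fb x) \<longlonglongrightarrow> indicator A x *\<^sub>R Fb x"
        proof (intro AE_I2)
          fix x :: 'a
          show "(\<lambda>k. \<phi> k x *\<^sub>R Fb x) \<longlonglongrightarrow> indicator A x *\<^sub>R Fb x"
          proof (cases "0 < q x")
            case True
            have "(\<lambda>k. 1 - inverse (1 + real k * q x)) \<longlonglongrightarrow> 1 - 0"
            proof (intro tendsto_intros tendsto_inverse_0_at_top
                filterlim_tendsto_add_at_top[OF tendsto_const])
              show "filterlim (\<lambda>k. real k * q x) at_top sequentially"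
                by (rule filterlim_at_top_mult_tendsto_pos[OF tendsto_const True filterlim_real_sequentially])
            qed
            moreover have "\<phi> k x = 1 - inverse (1 + real k * q x)" for k
            proof -
              have "1 + real k * q x \<noteq> 0" using True by (simp add: add_nonneg_eq_0_iff)
              then show ?thesis by (simp add: \<phi>_def field_simps)
            qed
            ultimately have "(\<lambda>k. \<phi> k x) \<longlonglongrightarrow> 1" by simp
            then have "(\<lambda>k. \<phi> k x *\<^sub>R Fb x) \<longlonglongrightarrow> 1 *\<^sub>R Fb x" by (intro tendsto_intros)
            then show ?thesis using True qpos[of x] by simp
          next
            case False
            then have qx: "q x = 0" using q(2)[of x] by simp
            have z: "indicator A x *\<^sub>R Fb x = 0" using False qpos[of x] by (auto simp: Fb_def)
            show ?thesis unfolding z using qx by (simp add: \<phi>_def)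
          qed
        qed
      qed simp
      then show ?thesis using zero_k by (simp add: LIMSEQ_const_iff)
    qed
    \<comment> \<open>the class of sets with vanishing integral is a Dynkin system\<close>
    have borel: "(LINT x|lebesgue. indicator A x *\<^sub>R Fb x) = 0" if "A \<in> sets borel" for A
      using Int_stable_C1_open_sets C1_open_sets_Pow sets_borel_C1_open_sets[OF that]
    proof (induction rule: sigma_sets_induct_disjoint)
      case (basic A)
      then show ?case by (rule open_zero)
    next
      case empty
      show ?case by simp
    next
      case (compl A)
      have "UNIV \<in> C1_open_sets"
        unfolding C1_open_sets_def using C1_function_const[of 1]
        by (intro CollectI exI[of _ "\<lambda>_. 1"]) auto
      from open_zero[OF this] have "(LINT x|lebesgue. Fb x) = 0" by simp
      moreover have "A \<in> sets lebesgue" using C1_open_sets_borel[OF compl(1)] by simp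
      then have "(LINT x|lebesgue. Fb x - indicator A x *\<^sub>R Fb x)
          = (LINT x|lebesgue. Fb x) - (LINT x|lebesgue. indicator A x *\<^sub>R Fb x)"
        by (intro Bochner_Integration.integral_diff Fb integrable_mult_indicator)
      moreover have "(\<lambda>x. Fb x - indicator A x *\<^sub>R Fb x) = (\<lambda>x. indicator (UNIV - A) x *\<^sub>R Fb x)"
        by (auto simp: indicator_def fun_eq_iff)
      ultimately show ?case using compl(2) by simp
    next
      case (union A)
      have A: "A i \<in> sets lebesgue" for i
      proof -
        have "A i \<in> sigma_sets UNIV C1_open_sets" using union(2) by blast
        from C1_open_sets_borel[OF this] show ?thesis by simp
      qed
      have "(LINT x:(\<Union>i. A i)|lebesgue. Fb x) = (\<Sum>i. (LINT x:(A i)|lebesgue. Fb x))"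
      proof (rule lebesgue_integral_countable_add)
        show "A i \<inter> A j = {}" if "i \<noteq> j" for i j
          using union(1) that by (auto simp: disjoint_family_on_def)
        show "set_integrable lebesgue (\<Union>i. A i) Fb"
          unfolding set_integrable_def using A by (intro integrable_mult_indicator Fb sets.countable_UN) auto
      qed (rule A)
      then show ?case using union(3) by (simp add: set_lebesgue_integral_def)
    qed
    have "AE x in lebesgue. Fb x = 0"
    proof (rule sigma_finite_measure.density_zero[OF sigma_finite_lebesgue Fb])
      fix A :: "'a set" assume A: "A \<in> sets lebesgue"
      \<comment> \<open>a Lebesgue set differs from a Borel set by a null set\<close>
      obtain S N N' where S: "A = S \<union> N" "N \<subseteq> N'" "N' \<in> null_sets lborel" "S \<in> sets lborel"
        using A by (rule sets_completionE)
      have [measurable]: "A \<in> sets lebesgue" "S \<in> sets lebesgue" using A S(4) by auto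
      have "AE x in lborel. x \<notin> N'" using S(3) by (rule AE_not_in)
      then have ae: "AE x in lebesgue. x \<notin> N'" by (rule AE_completion)
      have "(LINT x|lebesgue. indicator A x *\<^sub>R Fb x) = (LINT x|lebesgue. indicator S x *\<^sub>R Fb x)"
      proof (rule integral_cong_AE)
        show "AE x in lebesgue. indicator A x *\<^sub>R Fb x = indicator S x *\<^sub>R Fb x"
          using ae by eventually_elim (use S(1,2) in \<open>auto simp: indicator_def\<close>)
      qed measurable
      then show "set_lebesgue_integral lebesgue A Fb = 0"
        using borel[of S] S(4) by (simp add: set_lebesgue_integral_def)
    qed
    then show ?thesis by eventually_elim (auto simp: Fb_def)
  qed
  define \<F> where "\<F> = {ball c r | c r. 0 < r \<and> cball c r \<subseteq> \<Omega>}"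
  have "\<And>S. S \<in> \<F> \<Longrightarrow> open S" by (auto simp: \<F>_def)
  then obtain \<C> where \<C>: "\<C> \<subseteq> \<F>" "countable \<C>" "\<Union>\<C> = \<Union>\<F>" by (rule Lindelof)
  have cover: "\<Omega> \<subseteq> \<Union>\<C>"
  proof
    fix x assume "x \<in> \<Omega>"
    then obtain r where "r > 0" "cball x r \<subseteq> \<Omega>" using \<Omega> open_contains_cball by blast
    then have "ball x r \<in> \<F>" "x \<in> ball x r" by (auto simp: \<F>_def)
    then show "x \<in> \<Union>\<C>" unfolding \<C>(3) by blast
  qed
  have "AE x in lebesgue. \<forall>S\<in>\<C>. x \<in> S \<longrightarrow> F x = 0"
  proof (subst AE_ball_countable[OF \<C>(2)], rule ballI)
    fix S assume "S \<in> \<C>"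
    then obtain c r where "S = ball c r" "0 < r" "cball c r \<subseteq> \<Omega>" using \<C>(1) by (auto simp: \<F>_def)
    then show "AE x in lebesgue. x \<in> S \<longrightarrow> F x = 0" using local by simp
  qed
  then have "AE x in lebesgue. x \<in> \<Omega> \<longrightarrow> G x = G' x"
    by eventually_elim (use cover in \<open>auto simp: F_def\<close>)
  then show ?thesis using \<Omega> by (simp add: AE_restrict_space_iff)
qed

section \<open>Weak gradients of finite element functions\<close>

lemma integrable_const_indicator:
  fixes S :: "'a::euclidean_space set"
  assumes "S \<in> sets borel" and "bounded S"
  shows "integrable lborel (\<lambda>x. c * indicator S x :: real)"
  using emeasure_bounded_finite[OF assms(2)] assms(1)
  by (intro integrable_mult_right integrable_real_indicator) auto

lemma integrable_bounded_support:
  fixes f :: "'a::euclidean_space \<Rightarrow> 'b::euclidean_space"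
  assumes f: "f \<in> borel_measurable borel" and C: "\<And>x. norm (f x) \<le> C"
    and S: "bounded S" "\<And>x. x \<notin> S \<Longrightarrow> f x = 0"
  shows "integrable lborel f"
proof -
  obtain R where "\<And>x. x \<in> S \<Longrightarrow> norm x \<le> R" using S(1) unfolding bounded_iff by blast
  then have R: "S \<subseteq> cball 0 R" by auto
  show ?thesis
  proof (rule Bochner_Integration.integrable_bound)
    show "integrable lborel (\<lambda>x. C * indicator (cball 0 R :: 'a set) x :: real)"
      by (rule integrable_const_indicator) auto
    show "f \<in> borel_measurable lborel" using f by simp
    show "AE x in lborel. norm (f x) \<le> norm (C * indicator (cball 0 R :: 'a set) x :: real)"
    proof (intro AE_I2)
      fix x
      have "0 \<le> C" using order_trans[OF norm_ge_zero C] .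
      then show "norm (f x) \<le> norm (C * indicator (cball 0 R :: 'a set) x :: real)"
        using C[of x] S(2)[of x] R by (cases "x \<in> S") auto
    qed
  qed
qed

lemma locally_integrable_bounded:
  fixes f :: "'a::euclidean_space \<Rightarrow> 'b::euclidean_space"
  assumes f: "f \<in> borel_measurable borel" and C: "\<And>x. norm (f x) \<le> C"
  shows "locally_integrable \<Omega> f"
  unfolding locally_integrable_def
proof (intro allI impI)
  fix K :: "'a set" assume K: "compact K \<and> K \<subseteq> \<Omega>"
  have [measurable]: "K \<in> sets borel" using K by (simp add: borel_compact)
  have m: "(\<lambda>x. indicator K x *\<^sub>R f x) \<in> borel_measurable borel" using f by simp
  have "integrable lborel (\<lambda>x. indicator K x *\<^sub>R f x)"
  proof (rule integrable_bounded_support[OF m])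
    show "norm (indicator K x *\<^sub>R f x) \<le> C" for x
      using C[of x] order_trans[OF norm_ge_zero C] by (auto simp: indicator_def)
    show "bounded K" using K compact_imp_bounded by blast
  qed auto
  then have "integrable lebesgue (\<lambda>x. indicator K x *\<^sub>R f x)"
    using m by (simp add: integrable_completion)
  moreover have "K \<inter> space lebesgue \<in> sets lebesgue" by simp
  ultimately show "integrable (lebesgue_on K) f" by (simp only: integrable_restrict_space)
qed

lemma integral_lebesgue_on_supported:
  fixes f :: "'a::euclidean_space \<Rightarrow> 'b::euclidean_space"
  assumes f: "f \<in> borel_measurable borel" and \<Omega>: "open \<Omega>" and supp: "\<And>x. x \<notin> \<Omega> \<Longrightarrow> f x = 0"
  shows "(LINT x|lebesgue_on \<Omega>. f x) = (LINT x|lborel. f x)"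
proof -
  have "\<Omega> \<inter> space lebesgue \<in> sets lebesgue" using \<Omega> by simp
  then have "(LINT x|lebesgue_on \<Omega>. f x) = (LINT x|lebesgue. indicator \<Omega> x *\<^sub>R f x)"
    by (rule integral_restrict_space)
  also have "(\<lambda>x. indicator \<Omega> x *\<^sub>R f x) = f"
    using supp by (auto simp: fun_eq_iff indicator_def)
  also have "(LINT x|lebesgue. f x) = (LINT x|lborel. f x)"
    using f by (intro integral_completion) simp
  finally show ?thesis .
qed

lemma GDERIV_difference_quotient:
  fixes f :: "'a::euclidean_space \<Rightarrow> real"
  assumes f: "GDERIV f x :> d" and t: "t \<longlonglongrightarrow> 0" "\<And>n. t n \<noteq> 0"
  shows "(\<lambda>n. (f (x + t n *\<^sub>R e) - f x) / t n) \<longlonglongrightarrow> inner e d"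
proof -
  have "((\<lambda>s. f (x + s *\<^sub>R e)) has_derivative (\<lambda>h. inner (h *\<^sub>R e) d)) (at 0)"
    by (rule has_derivative_compose[where g = f and g' = "\<lambda>h. inner h d"])
      (use f in \<open>auto simp: gderiv_def intro!: derivative_eq_intros\<close>)
  then have "DERIV (\<lambda>s. f (x + s *\<^sub>R e)) 0 :> inner e d"
    unfolding has_field_derivative_def by (rule has_derivative_eq_rhs) (simp add: fun_eq_iff)
  then have "((\<lambda>h. (f (x + h *\<^sub>R e) - f x) / h) \<longlongrightarrow> inner e d) (at 0)"
    by (simp add: DERIV_def)
  moreover have "filterlim t (at 0) sequentially"
    using t by (simp add: filterlim_at)
  ultimately show ?thesis by (rule filterlim_compose)
qed

lemma C1_bounded_gradient_lipschitz:
  fixes p :: "'a::euclidean_space \<Rightarrow> real"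
  assumes D: "\<And>x. GDERIV p x :> D x" and B: "\<And>x. norm (D x) \<le> B"
  shows "\<bar>p y - p x\<bar> \<le> B * norm (y - x)"
proof -
  have "norm (p y - p x) \<le> B * norm (y - x)"
  proof (rule differentiable_bound[OF convex_UNIV])
    show "(p has_derivative (\<lambda>h. inner h (D z))) (at z within UNIV)" for z
      using D[of z] by (simp add: gderiv_def)
    show "onorm (\<lambda>h. inner h (D z)) \<le> B" for z
    proof (rule onorm_le)
      fix h
      have "norm (inner h (D z)) \<le> norm h * norm (D z)" by (rule Cauchy_Schwarz_ineq2[of h "D z", folded real_norm_def])
      also have "\<dots> \<le> B * norm h" using mult_left_mono[OF B[of z] norm_ge_zero[of h]] by (simp add: mult.commute)
      finally show "norm (inner h (D z)) \<le> B * norm h" .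
    qed
  qed auto
  then show ?thesis by simp
qed

locale mesh =
  fixes \<Omega> :: "'a::euclidean_space set" and \<tau> :: "'a set set"
  assumes open_domain: "open \<Omega>" and connected_domain: "connected \<Omega>" and bounded_domain: "bounded \<Omega>"
    and finite_mesh: "finite \<tau>" and simplices: "\<And>T. T \<in> \<tau> \<Longrightarrow> int DIM('a) simplex T"
    and mesh_cover: "\<Union>\<tau> = closure \<Omega>"
begin

text \<open>
  Only the interiors of the simplices matter: what remains of \<open>closure \<Omega>\<close> consists of frontiers of convex
  sets and is negligible. Where two simplices meet, no single classical gradient exists and \<open>grad\<close> has the
  default value \<open>0\<close>.
\<close>
definition cells :: "'a set" where "cells = (\<Union>T\<in>\<tau>. interior T)"

definition grad :: "('a \<Rightarrow> real) \<Rightarrow> 'a \<Rightarrow> 'a" where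
  "grad v x = (if x \<in> cells then THE d. GDERIV v x :> d else 0)"

lemma simplexE:
  assumes "T \<in> \<tau>"
  obtains C where "finite C" "T = convex hull C"
  using simplices[OF assms] unfolding simplex by blast

lemma compact_simplex: "T \<in> \<tau> \<Longrightarrow> compact T"
  by (metis simplexE finite_imp_compact_convex_hull)

lemma convex_simplex: "T \<in> \<tau> \<Longrightarrow> convex T"
  by (metis simplexE convex_convex_hull)

lemma interior_simplex: assumes "T \<in> \<tau>" shows "interior T \<noteq> {}"
proof -
  obtain C where C: "finite C" "\<not> affine_dependent C" "int (card C) = int DIM('a) + 1" "T = convex hull C"
    using simplices[OF assms] unfolding simplex by blast
  then have "card C = Suc DIM('a)" by simp
  from interior_convex_hull_eq_empty[OF this] show ?thesis using C by simp
qed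

lemma simplex_subset: "T \<in> \<tau> \<Longrightarrow> T \<subseteq> closure \<Omega>"
  using mesh_cover by blast

lemma compact_closure: "compact (closure \<Omega>)"
  using bounded_domain by simp

lemma open_cells: "open cells"
  unfolding cells_def by blast

lemma negligible_skeleton: "negligible (closure \<Omega> - cells)"
proof (rule negligible_subset)
  show "negligible (\<Union>T\<in>\<tau>. frontier T)"
    using finite_mesh convex_simplex negligible_convex_frontier by (intro negligible_Union) auto
  have "x \<in> frontier T" if "x \<in> T" "x \<notin> interior T" for x T
    using that closure_subset[of T] by (auto simp: frontier_def)
  then show "closure \<Omega> - cells \<subseteq> (\<Union>T\<in>\<tau>. frontier T)"
    unfolding mesh_cover[symmetric] cells_def by blast
qed

lemma AE_cells: "AE x in lborel. x \<in> \<Omega> \<longrightarrow> x \<in> cells"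
proof -
  have "closure \<Omega> - cells \<in> null_sets lebesgue"
    using negligible_skeleton by (simp add: negligible_iff_null_sets)
  moreover have "closure \<Omega> - cells \<in> sets lborel" using open_cells by simp
  ultimately have "closure \<Omega> - cells \<in> null_sets lborel"
    using null_sets_completion_iff by blast
  then have "AE x in lborel. x \<notin> closure \<Omega> - cells" by (rule AE_not_in)
  then show ?thesis by eventually_elim (use closure_subset in auto)
qed

lemma Vh_affine:
  assumes "v \<in> Vh \<Omega> \<tau>"
  shows "\<exists>a c. \<forall>T\<in>\<tau>. \<forall>x\<in>T. v x = inner (a T) x + c T"
proof -
  have "\<forall>T\<in>\<tau>. \<exists>ac. \<forall>x\<in>T. v x = inner (fst ac) x + snd ac"
    using assms by (fastforce simp: Vh_def P1_on_def)
  then obtain ac where "\<forall>T\<in>\<tau>. \<forall>x\<in>T. v x = inner (fst (ac T)) x + snd (ac T)"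
    by (rule bchoice[THEN exE])
  then show ?thesis by (intro exI[of _ "\<lambda>T. fst (ac T)"] exI[of _ "\<lambda>T. snd (ac T)"]) auto
qed

lemma grad_affine:
  assumes T: "T \<in> \<tau>" and v: "\<And>y. y \<in> T \<Longrightarrow> v y = inner a y + c" and x: "x \<in> interior T"
  shows "GDERIV v x :> a" and "grad v x = a"
proof -
  have "((\<lambda>y. inner a y + c) has_derivative (\<lambda>h. inner h a)) (at x)"
    by (auto intro!: derivative_eq_intros simp: inner_commute)
  then show D: "GDERIV v x :> a"
    unfolding gderiv_def
    by (rule has_derivative_transform_within_open[of _ _ _ _ "interior T"])
      (use x v in \<open>auto dest: interior_subset[THEN subsetD]\<close>)
  have "d = a" if "GDERIV v x :> d" for d
  proof -
    have "(\<lambda>h. inner h d) = (\<lambda>h. inner h a)"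
      using that D unfolding gderiv_def by (rule has_derivative_unique)
    then have "inner (d - a) d = inner (d - a) a" by (rule fun_cong)
    then have "inner (d - a) (d - a) = 0" by (simp add: inner_diff_right)
    then show ?thesis by simp
  qed
  then have "(THE d. GDERIV v x :> d) = a" using D by blast
  moreover have "x \<in> cells" using x T by (auto simp: cells_def)
  ultimately show "grad v x = a" by (simp add: grad_def)
qed

lemma grad_lincomb:
  assumes u: "u \<in> Vh \<Omega> \<tau>" and v: "v \<in> Vh \<Omega> \<tau>"
  shows "grad (\<lambda>x. u x + k * v x) x = grad u x + k *\<^sub>R grad v x"
proof (cases "x \<in> cells")
  case True
  then obtain T where T: "T \<in> \<tau>" "x \<in> interior T" by (auto simp: cells_def)
  obtain a c where a: "\<And>T x. T \<in> \<tau> \<Longrightarrow> x \<in> T \<Longrightarrow> u x = inner (a T) x + c T"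
    using Vh_affine[OF u] by blast
  obtain b d where b: "\<And>T x. T \<in> \<tau> \<Longrightarrow> x \<in> T \<Longrightarrow> v x = inner (b T) x + d T"
    using Vh_affine[OF v] by blast
  have "grad (\<lambda>x. u x + k * v x) x = a T + k *\<^sub>R b T"
    by (rule grad_affine(2)[OF T(1) _ T(2), of _ _ "c T + k * d T"])
      (simp add: a[OF T(1)] b[OF T(1)] inner_add_left algebra_simps)
  then show ?thesis
    using grad_affine(2)[OF T(1) a[OF T(1)] T(2)] grad_affine(2)[OF T(1) b[OF T(1)] T(2)] by simp
qed (simp add: grad_def)

text \<open>
  A segment inside the closed domain is covered by finitely many simplices, on each of which the function is
  Lipschitz continuous with the same constant; closedness of the simplices lets these estimates be chained.
\<close>
lemma grad_bounded:
  assumes "v \<in> Vh \<Omega> \<tau>"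
  obtains L where "0 \<le> L" "\<And>x. norm (grad v x) \<le> L"
    "\<And>x y. closed_segment x y \<subseteq> closure \<Omega> \<Longrightarrow> \<bar>v y - v x\<bar> \<le> L * norm (y - x)"
proof -
  obtain a c where a: "\<And>T x. T \<in> \<tau> \<Longrightarrow> x \<in> T \<Longrightarrow> v x = inner (a T) x + c T"
    using Vh_affine[OF assms] by blast
  define L where "L = (\<Sum>T\<in>\<tau>. norm (a T))"
  have L: "0 \<le> L" unfolding L_def by (intro sum_nonneg) simp
  have aL: "norm (a T) \<le> L" if "T \<in> \<tau>" for T
    unfolding L_def using finite_mesh that by (intro member_le_sum) auto
  have 1: "norm (grad v x) \<le> L" for x
  proof (cases "x \<in> cells")
    case True
    then obtain T where T: "T \<in> \<tau>" "x \<in> interior T" by (auto simp: cells_def)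
    show ?thesis using grad_affine(2)[OF T(1) a[OF T(1)] T(2)] aL[OF T(1)] by simp
  qed (simp add: grad_def L)
  have 2: "\<bar>v y - v x\<bar> \<le> L * norm (y - x)" if seg: "closed_segment x y \<subseteq> closure \<Omega>" for x y
  proof -
    define \<gamma> where "\<gamma> = (\<lambda>s::real. x + s *\<^sub>R (y - x))"
    define U where "U = (\<lambda>T. {s \<in> {0..1}. \<gamma> s \<in> T})"
    have cont: "continuous_on UNIV \<gamma>" unfolding \<gamma>_def by (intro continuous_intros)
    have "lipschitz_on (L * norm (y - x)) {0..1} (\<lambda>s. v (\<gamma> s))"
    proof (rule lipschitz_on_closed_Union[of \<tau> _ U])
      show "0 \<le> L * norm (y - x)" using L by simp
      show "lipschitz_on (L * norm (y - x)) (U T) (\<lambda>s. v (\<gamma> s))" if T: "T \<in> \<tau>" for T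
      proof (rule lipschitz_onI)
        fix s t assume "s \<in> U T" "t \<in> U T"
        then have "v (\<gamma> s) - v (\<gamma> t) = inner (a T) (\<gamma> s - \<gamma> t)"
          using a[OF T] by (simp add: U_def inner_diff_right)
        also have "\<gamma> s - \<gamma> t = (s - t) *\<^sub>R (y - x)" by (simp add: \<gamma>_def algebra_simps)
        finally have "\<bar>v (\<gamma> s) - v (\<gamma> t)\<bar> \<le> norm (a T) * norm ((s - t) *\<^sub>R (y - x))"
          using Cauchy_Schwarz_ineq2 by metis
        also have "\<dots> \<le> L * norm ((s - t) *\<^sub>R (y - x))"
          by (intro mult_right_mono aL[OF T]) simp
        finally show "dist (v (\<gamma> s)) (v (\<gamma> t)) \<le> L * norm (y - x) * dist s t"
          by (simp add: dist_real_def mult_ac)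
      qed (use L in simp)
      show "closed (U T)" if "T \<in> \<tau>" for T
      proof -
        have "closed (\<gamma> -` T)"
          by (rule continuous_closed_vimage[OF compact_imp_closed[OF compact_simplex[OF that]]])
            (use cont in \<open>simp add: continuous_on_eq_continuous_at\<close>)
        moreover have "U T = {0..1} \<inter> \<gamma> -` T" by (auto simp: U_def)
        ultimately show ?thesis by (simp add: closed_Int)
      qed
      show "{0..1} \<subseteq> (\<Union>T\<in>\<tau>. U T)"
      proof
        fix s :: real assume s: "s \<in> {0..1}"
        then have "\<gamma> s \<in> closed_segment x y"
          by (auto simp: \<gamma>_def closed_segment_def algebra_simps intro!: exI[of _ s])
        then have "\<gamma> s \<in> \<Union>\<tau>" using seg mesh_cover by blast
        then show "s \<in> (\<Union>T\<in>\<tau>. U T)" using s by (auto simp: U_def)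
      qed
    qed (rule finite_mesh)
    then have "dist (v (\<gamma> 1)) (v (\<gamma> 0)) \<le> L * norm (y - x) * dist (1::real) 0"
      by (rule lipschitz_onD) auto
    then show ?thesis by (simp add: \<gamma>_def dist_real_def)
  qed
  show ?thesis by (rule that[OF L 1 2])
qed

lemma grad_measurable:
  assumes v: "v \<in> Vh \<Omega> \<tau>" shows "grad v \<in> borel_measurable borel"
proof -
  obtain a c where a: "\<And>T x. T \<in> \<tau> \<Longrightarrow> x \<in> T \<Longrightarrow> v x = inner (a T) x + c T"
    using Vh_affine[OF v] by blast
  have "continuous_on cells (grad v)"
  proof (rule continuous_at_imp_continuous_on, rule ballI)
    fix x assume "x \<in> cells"
    then obtain T where T: "T \<in> \<tau>" "x \<in> interior T" by (auto simp: cells_def)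
    have ev: "eventually (\<lambda>y. a T = grad v y) (nhds x)"
      using eventually_nhds_in_open[OF open_interior T(2)]
      by eventually_elim (simp add: grad_affine(2)[OF T(1) a[OF T(1)]])
    show "isCont (grad v) x" using isCont_cong[OF ev] by simp
  qed
  then have "(\<lambda>x. if x \<in> cells then grad v x else 0) \<in> borel_measurable borel"
    using open_cells by (intro borel_measurable_continuous_on_if) auto
  moreover have "(\<lambda>x. if x \<in> cells then grad v x else 0) = grad v"
    by (auto simp: grad_def)
  ultimately show ?thesis by simp
qed

lemma Vh_measurable:
  assumes v: "v \<in> Vh \<Omega> \<tau>" shows "v \<in> borel_measurable borel"
proof -
  have "(\<lambda>x. if x \<in> closure \<Omega> then v x else 0) \<in> borel_measurable borel"
    using v by (intro borel_measurable_continuous_on_if) (auto simp: Vh_def)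
  moreover have "(\<lambda>x. if x \<in> closure \<Omega> then v x else 0) = v"
    using v by (auto simp: Vh_def)
  ultimately show ?thesis by simp
qed

lemma Vh_bounded:
  assumes v: "v \<in> Vh \<Omega> \<tau>"
  obtains C where "0 \<le> C" "\<And>x. \<bar>v x\<bar> \<le> C"
proof -
  have "bounded (v ` closure \<Omega>)"
    using v compact_closure by (intro compact_imp_bounded compact_continuous_image) (auto simp: Vh_def)
  then obtain C where C: "\<And>x. x \<in> closure \<Omega> \<Longrightarrow> norm (v x) \<le> C" unfolding bounded_iff by auto
  have "\<bar>v x\<bar> \<le> max 0 C" for x
    using C[of x] v by (cases "x \<in> closure \<Omega>") (auto simp: Vh_def)
  then show ?thesis by (intro that[of "max 0 C"]) auto
qed

text \<open>
  Integration by parts for difference quotients is a translation of the variable: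
  \<open>v x * (\<phi> (x + t *\<^sub>R e) - \<phi> x) / t\<close> and \<open>(v (x - t *\<^sub>R e) - v x) / t * \<phi> x\<close> have the same integral. As
  \<open>t\<close> tends to \<open>0\<close>, dominated convergence applies on both sides. On the right the dominating constant is
  the Lipschitz bound along segments that stay inside the domain, which is why \<open>t\<close> is kept below a radius
  \<open>\<delta>\<close> for which all balls around points of the support of \<open>\<phi>\<close> lie in the domain.
\<close>
lemma grad_integration_by_parts:
  assumes v: "v \<in> Vh \<Omega> \<tau>" and \<phi>: "test_function \<Omega> \<phi> D\<phi>" and e: "norm e = 1"
  shows "(LINT x|lborel. v x * inner e (D\<phi> x)) = - (LINT x|lborel. \<phi> x * inner e (grad v x))"
proof -
  obtain K B where K: "compact K" "K \<subseteq> \<Omega>" and \<phi>0: "\<And>x. x \<notin> K \<Longrightarrow> \<phi> x = 0"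
      and B: "\<And>x. \<bar>\<phi> x\<bar> \<le> B" "\<And>x. norm (D\<phi> x) \<le> B"
      and cont: "continuous_on UNIV \<phi>" "continuous_on UNIV D\<phi>"
    using \<phi> by (rule test_functionE) blast
  have der: "\<And>x. GDERIV \<phi> x :> D\<phi> x" using \<phi> by (simp add: test_function_def)
  have B0: "0 \<le> B" using order_trans[OF norm_ge_zero B(2)] .
  obtain \<delta> where \<delta>: "0 < \<delta>" "(\<Union>x\<in>K. ball x \<delta>) \<subseteq> \<Omega>"
    using compact_subset_open_imp_ball_epsilon_subset[OF K(1) open_domain K(2)] by blast
  obtain L where L: "0 \<le> L" "\<And>x. norm (grad v x) \<le> L"
    "\<And>x y. closed_segment x y \<subseteq> closure \<Omega> \<Longrightarrow> \<bar>v y - v x\<bar> \<le> L * norm (y - x)"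
    using v by (rule grad_bounded) blast
  obtain C where C: "0 \<le> C" "\<And>x. \<bar>v x\<bar> \<le> C" using v by (rule Vh_bounded) blast
  have v0: "v x = 0" if "x \<notin> closure \<Omega>" for x using v that by (simp add: Vh_def)
  define t where "t = (\<lambda>n. \<delta> / real (n + 2))"
  have t: "0 < t n" "t n < \<delta>" "t n \<noteq> 0" for n
  proof -
    show "0 < t n" unfolding t_def using \<delta> by simp
    then show "t n \<noteq> 0" by simp
    have "\<delta> * 1 < \<delta> * real (n + 2)" by (rule mult_strict_left_mono) (use \<delta> in auto)
    then show "t n < \<delta>" unfolding t_def by (simp add: divide_less_eq)
  qed
  have "(\<lambda>n. \<delta> * inverse (real (n + 2))) \<longlonglongrightarrow> \<delta> * 0"
    by (intro tendsto_mult tendsto_const LIMSEQ_ignore_initial_segment[OF lim_inverse_n])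
  then have t0: "t \<longlonglongrightarrow> 0" by (simp add: t_def divide_inverse)
  have [measurable]: "v \<in> borel_measurable borel" by (rule Vh_measurable[OF v])
  have [measurable]: "grad v \<in> borel_measurable borel" by (rule grad_measurable[OF v])
  have [measurable]: "\<phi> \<in> borel_measurable borel" "D\<phi> \<in> borel_measurable borel"
    using cont by (auto intro: borel_measurable_continuous_onI)
  have bK: "bounded K" by (rule compact_imp_bounded[OF K(1)])
  have bC: "bounded (closure \<Omega>)" by (rule bounded_closure[OF bounded_domain])
  define g where "g = (\<lambda>n x. v x * ((\<phi> (x + t n *\<^sub>R e) - \<phi> x) / t n))"
  define h where "h = (\<lambda>n x. (v (x - t n *\<^sub>R e) - v x) / t n * \<phi> x)"
  have bound: "\<bar>v x * \<phi> y\<bar> \<le> C * B" for x y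
    unfolding abs_mult by (intro mult_mono C B) (use C in auto)
  have swap: "(LINT x|lborel. g n x) = (LINT x|lborel. h n x)" for n
  proof -
    define s where "s = t n *\<^sub>R e"
    have i1: "integrable lborel (\<lambda>x. v x * \<phi> (x + s))"
      by (rule integrable_bounded_support[where C = "C * B", OF _ _ bC]) (use bound v0 in auto)
    have i2: "integrable lborel (\<lambda>x. v x * \<phi> x)"
      by (rule integrable_bounded_support[where C = "C * B", OF _ _ bC]) (use bound v0 in auto)
    have i3: "integrable lborel (\<lambda>x. v (x - s) * \<phi> x)"
      by (rule integrable_bounded_support[where C = "C * B", OF _ _ bK]) (use bound \<phi>0 in auto)
    have "(LINT x|lborel. v (x - s) * \<phi> x) = (LINT x|distr lborel borel ((+) s). v (x - s) * \<phi> x)"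
      by (simp add: lborel_distr_plus)
    also have "\<dots> = (LINT x|lborel. v (s + x - s) * \<phi> (s + x))"
      by (rule integral_distr) measurable
    finally have shift: "(LINT x|lborel. v (x - s) * \<phi> x) = (LINT x|lborel. v x * \<phi> (x + s))"
      by (simp add: add.commute)
    have "(LINT x|lborel. g n x) = (LINT x|lborel. (v x * \<phi> (x + s) - v x * \<phi> x) / t n)"
      by (simp add: g_def s_def right_diff_distrib)
    also have "\<dots> = ((LINT x|lborel. v x * \<phi> (x + s)) - (LINT x|lborel. v x * \<phi> x)) / t n"
      using i1 i2 by simp
    also have "\<dots> = (LINT x|lborel. (v (x - s) * \<phi> x - v x * \<phi> x) / t n)"
      using i2 i3 shift by simp
    also have "\<dots> = (LINT x|lborel. h n x)"
      by (simp add: h_def s_def left_diff_distrib)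
    finally show ?thesis .
  qed
  have lim_g: "(\<lambda>n. LINT x|lborel. g n x) \<longlonglongrightarrow> (LINT x|lborel. v x * inner e (D\<phi> x))"
  proof (rule integral_dominated_convergence[where w = "\<lambda>x. C * B * indicator (closure \<Omega>) x"])
    show "integrable lborel (\<lambda>x. C * B * indicator (closure \<Omega>) x)"
      by (rule integrable_const_indicator[OF _ bC]) simp
    show "AE x in lborel. (\<lambda>n. g n x) \<longlonglongrightarrow> v x * inner e (D\<phi> x)"
      unfolding g_def
      by (intro AE_I2 tendsto_mult tendsto_const GDERIV_difference_quotient[OF der t0 t(3)])
    show "AE x in lborel. norm (g n x) \<le> C * B * indicator (closure \<Omega>) x" for n
    proof (intro AE_I2)
      fix x
      have "\<bar>\<phi> (x + t n *\<^sub>R e) - \<phi> x\<bar> \<le> B * t n"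
        using C1_bounded_gradient_lipschitz[OF der B(2), of "x + t n *\<^sub>R e" x] e t(1)[of n] by simp
      then have "\<bar>(\<phi> (x + t n *\<^sub>R e) - \<phi> x) / t n\<bar> \<le> B"
        using t(1)[of n] by (simp add: abs_divide pos_divide_le_eq)
      then have "\<bar>v x\<bar> * \<bar>(\<phi> (x + t n *\<^sub>R e) - \<phi> x) / t n\<bar> \<le> C * B"
        by (intro mult_mono C) (use C in auto)
      then show "norm (g n x) \<le> C * B * indicator (closure \<Omega>) x"
        using v0[of x] by (cases "x \<in> closure \<Omega>") (auto simp: g_def abs_mult)
    qed
  qed (simp_all add: g_def)
  have lim_h: "(\<lambda>n. LINT x|lborel. h n x) \<longlonglongrightarrow> (LINT x|lborel. - (\<phi> x * inner e (grad v x)))"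
  proof (rule integral_dominated_convergence[where w = "\<lambda>x. L * B * indicator K x"])
    have [measurable]: "K \<in> sets borel" using K(1) by (rule borel_compact)
    show "integrable lborel (\<lambda>x. L * B * indicator K x)"
      by (rule integrable_const_indicator[OF _ bK]) simp
    show "AE x in lborel. (\<lambda>n. h n x) \<longlonglongrightarrow> - (\<phi> x * inner e (grad v x))"
      using AE_cells
    proof eventually_elim
      case (elim x)
      show ?case
      proof (cases "x \<in> K")
        case False
        then show ?thesis by (simp add: h_def \<phi>0)
      next
        case True
        then have "x \<in> cells" using elim K(2) by blast
        then obtain T where T: "T \<in> \<tau>" "x \<in> interior T" by (auto simp: cells_def)
        obtain a c where a: "\<And>T x. T \<in> \<tau> \<Longrightarrow> x \<in> T \<Longrightarrow> v x = inner (a T) x + c T"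
          using Vh_affine[OF v] by blast
        have "GDERIV v x :> grad v x"
          using grad_affine[OF T(1) a[OF T(1)] T(2)] by simp
        from GDERIV_difference_quotient[OF this t0 t(3), of "- e"]
        have "(\<lambda>n. (v (x - t n *\<^sub>R e) - v x) / t n) \<longlonglongrightarrow> - inner e (grad v x)" by simp
        from tendsto_mult[OF this tendsto_const[of "\<phi> x"]] show ?thesis
          by (simp add: h_def mult.commute)
      qed
    qed
    show "AE x in lborel. norm (h n x) \<le> L * B * indicator K x" for n
    proof (intro AE_I2)
      fix x
      show "norm (h n x) \<le> L * B * indicator K x"
      proof (cases "x \<in> K")
        case True
        have "x - t n *\<^sub>R e \<in> ball x \<delta>" using t(1,2)[of n] e by (simp add: dist_norm)
        moreover have "x \<in> ball x \<delta>" using \<delta> by simp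
        ultimately have "closed_segment x (x - t n *\<^sub>R e) \<subseteq> ball x \<delta>"
          by (intro closed_segment_subset convex_ball)
        then have "closed_segment x (x - t n *\<^sub>R e) \<subseteq> closure \<Omega>"
          using \<delta>(2) True closure_subset by blast
        from L(3)[OF this] have "\<bar>v (x - t n *\<^sub>R e) - v x\<bar> \<le> L * t n" using e t(1)[of n] by simp
        then have "\<bar>(v (x - t n *\<^sub>R e) - v x) / t n\<bar> \<le> L"
          using t(1)[of n] by (simp add: abs_divide pos_divide_le_eq)
        then have "\<bar>(v (x - t n *\<^sub>R e) - v x) / t n\<bar> * \<bar>\<phi> x\<bar> \<le> L * B"
          by (intro mult_mono B) (use L in auto)
        then show ?thesis using True by (simp add: h_def abs_mult)
      qed (simp add: h_def \<phi>0)
    qed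
  qed (simp_all add: h_def)
  have "(LINT x|lborel. v x * inner e (D\<phi> x)) = (LINT x|lborel. - (\<phi> x * inner e (grad v x)))"
    using LIMSEQ_unique[OF lim_g lim_h[folded swap]] .
  then show ?thesis by simp
qed

lemma grad_is_weak_gradient:
  assumes v: "v \<in> Vh \<Omega> \<tau>" shows "is_weak_gradient \<Omega> v (grad v)"
  unfolding is_weak_gradient_def
proof (intro conjI allI impI)
  obtain L where L: "0 \<le> L" "\<And>x. norm (grad v x) \<le> L" using v by (rule grad_bounded) blast
  obtain C where C: "0 \<le> C" "\<And>x. \<bar>v x\<bar> \<le> C" using v by (rule Vh_bounded) blast
  have mv [measurable]: "v \<in> borel_measurable borel" by (rule Vh_measurable[OF v])
  have mg [measurable]: "grad v \<in> borel_measurable borel" by (rule grad_measurable[OF v])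
  show "locally_integrable \<Omega> v" by (rule locally_integrable_bounded[OF mv]) (use C in simp)
  show "locally_integrable \<Omega> (grad v)" by (rule locally_integrable_bounded[OF mg L(2)])
  fix \<phi> D\<phi> assume \<phi>: "test_function \<Omega> \<phi> D\<phi>"
  obtain K B where K: "compact K" "K \<subseteq> \<Omega>" and 0: "\<And>x. x \<notin> K \<Longrightarrow> \<phi> x = 0" "\<And>x. x \<notin> K \<Longrightarrow> D\<phi> x = 0"
      and B: "\<And>x. \<bar>\<phi> x\<bar> \<le> B" "\<And>x. norm (D\<phi> x) \<le> B"
      and cont: "continuous_on UNIV \<phi>" "continuous_on UNIV D\<phi>"
    using \<phi> by (rule test_functionE) blast
  have [measurable]: "\<phi> \<in> borel_measurable borel" "D\<phi> \<in> borel_measurable borel"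
    using cont by (auto intro: borel_measurable_continuous_onI)
  have bK: "bounded K" by (rule compact_imp_bounded[OF K(1)])
  have i1: "integrable lborel (\<lambda>x. v x *\<^sub>R D\<phi> x)"
  proof (rule integrable_bounded_support[OF _ _ bK])
    show "norm (v x *\<^sub>R D\<phi> x) \<le> C * B" for x
      unfolding norm_scaleR by (intro mult_mono C B) (use C in auto)
  qed (use 0 in auto)
  have i2: "integrable lborel (\<lambda>x. \<phi> x *\<^sub>R grad v x)"
  proof (rule integrable_bounded_support[OF _ _ bK])
    show "norm (\<phi> x *\<^sub>R grad v x) \<le> B * L" for x
      unfolding norm_scaleR by (intro mult_mono L B) (use order_trans[OF norm_ge_zero B(2)] in auto)
  qed (use 0 in auto)
  have "(LINT x|lborel. v x *\<^sub>R D\<phi> x) = - (LINT x|lborel. \<phi> x *\<^sub>R grad v x)"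
  proof (rule euclidean_eqI)
    fix e :: 'a assume "e \<in> Basis"
    then have e: "norm e = 1" by simp
    have "inner (LINT x|lborel. v x *\<^sub>R D\<phi> x) e = (LINT x|lborel. v x * inner e (D\<phi> x))"
      using i1 by (subst integral_inner_left[symmetric]) (auto simp: inner_commute)
    also have "\<dots> = - (LINT x|lborel. \<phi> x * inner e (grad v x))"
      by (rule grad_integration_by_parts[OF v \<phi> e])
    also have "(LINT x|lborel. \<phi> x * inner e (grad v x)) = inner (LINT x|lborel. \<phi> x *\<^sub>R grad v x) e"
      using i2 by (subst integral_inner_left[symmetric]) (auto simp: inner_commute)
    finally show "inner (LINT x|lborel. v x *\<^sub>R D\<phi> x) e = inner (- (LINT x|lborel. \<phi> x *\<^sub>R grad v x)) e"
      by simp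
  qed
  moreover have "(LINT x|lebesgue_on \<Omega>. v x *\<^sub>R D\<phi> x) = (LINT x|lborel. v x *\<^sub>R D\<phi> x)"
    by (rule integral_lebesgue_on_supported[OF _ open_domain]) (use 0 K in auto)
  moreover have "(LINT x|lebesgue_on \<Omega>. \<phi> x *\<^sub>R grad v x) = (LINT x|lborel. \<phi> x *\<^sub>R grad v x)"
    by (rule integral_lebesgue_on_supported[OF _ open_domain]) (use 0 K in auto)
  ultimately show "(LINT x|lebesgue_on \<Omega>. v x *\<^sub>R D\<phi> x) = - (LINT x|lebesgue_on \<Omega>. \<phi> x *\<^sub>R grad v x)"
    by simp
qed

lemma AE_weak_gradient:
  assumes v: "v \<in> Vh \<Omega> \<tau>" shows "AE x in lebesgue_on \<Omega>. weak_gradient \<Omega> v x = grad v x"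
proof -
  have "is_weak_gradient \<Omega> v (weak_gradient \<Omega> v)"
    unfolding weak_gradient_def by (rule someI[of "is_weak_gradient \<Omega> v", OF grad_is_weak_gradient[OF v]])
  then show ?thesis by (rule weak_gradient_unique[OF open_domain _ grad_is_weak_gradient[OF v]])
qed

end

section \<open>The finite element problem\<close>

lemma L2_product_integrable:
  assumes "f \<in> L2 M" "g \<in> L2 M" shows "integrable M (\<lambda>x. f x * g x)"
proof (rule Bochner_Integration.integrable_bound)
  have [measurable]: "f \<in> borel_measurable M" "g \<in> borel_measurable M"
    using assms by (auto simp: L2_def)
  show "integrable M (\<lambda>x. (f x)\<^sup>2 + (g x)\<^sup>2)" using assms by (auto simp: L2_def)
  show "(\<lambda>x. f x * g x) \<in> borel_measurable M" by measurable
  show "AE x in M. norm (f x * g x) \<le> norm ((f x)\<^sup>2 + (g x)\<^sup>2)"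
  proof (intro AE_I2)
    fix x
    have "0 \<le> (\<bar>f x\<bar> - \<bar>g x\<bar>)\<^sup>2" by simp
    then have "2 * (\<bar>f x\<bar> * \<bar>g x\<bar>) \<le> (f x)\<^sup>2 + (g x)\<^sup>2" by (simp add: power2_diff)
    moreover have "0 \<le> \<bar>f x\<bar> * \<bar>g x\<bar>" by simp
    ultimately show "norm (f x * g x) \<le> norm ((f x)\<^sup>2 + (g x)\<^sup>2)"
      unfolding real_norm_def abs_mult by linarith
  qed
qed

lemma semi_inner_L2: "semi_inner (L2 M) (L2_inner M)"
proof
  show "(\<lambda>_. 0) \<in> L2 M" by (simp add: L2_def)
  fix u v :: "'a \<Rightarrow> real" and c
  assume u: "u \<in> L2 M" and v: "v \<in> L2 M"
  have "(\<lambda>x. (u x + c * v x)\<^sup>2) = (\<lambda>x. (u x)\<^sup>2 + 2 * c * (u x * v x) + c\<^sup>2 * (v x)\<^sup>2)"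
    by (simp add: fun_eq_iff power2_eq_square algebra_simps)
  moreover have "integrable M (\<lambda>x. (u x)\<^sup>2 + 2 * c * (u x * v x) + c\<^sup>2 * (v x)\<^sup>2)"
    using u v L2_product_integrable[OF u v] by (auto simp: L2_def)
  moreover have "(\<lambda>x. u x + c * v x) \<in> borel_measurable M"
    using u v by (auto simp: L2_def)
  ultimately show "(\<lambda>x. u x + c * v x) \<in> L2 M" by (simp add: L2_def)
next
  fix u v w :: "'a \<Rightarrow> real" and c
  assume u: "u \<in> L2 M" and v: "v \<in> L2 M" and w: "w \<in> L2 M"
  have "L2_inner M (\<lambda>x. u x + c * v x) w = (LINT x|M. u x * w x + c * (v x * w x))"
    by (simp add: L2_inner_def algebra_simps)
  then show "L2_inner M (\<lambda>x. u x + c * v x) w = L2_inner M u w + c * L2_inner M v w"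
    using L2_product_integrable[OF u w] L2_product_integrable[OF v w] by (simp add: L2_inner_def)
qed (auto simp: L2_inner_def mult.commute)

lemma L2_inner_null_iff:
  assumes "v \<in> L2 M" shows "L2_inner M v v = 0 \<longleftrightarrow> (AE x in M. v x = 0)"
  unfolding L2_inner_def
  by (subst integral_nonneg_eq_0_iff_AE[OF L2_product_integrable[OF assms assms]]) auto

context mesh
begin

lemma function_space_Vh: "function_space (Vh \<Omega> \<tau>)"
proof
  show "(\<lambda>_. 0) \<in> Vh \<Omega> \<tau>"
    by (auto simp: Vh_def P1_on_def intro!: exI[of _ 0])
  fix u v c assume u: "u \<in> Vh \<Omega> \<tau>" and v: "v \<in> Vh \<Omega> \<tau>"
  obtain a k where a: "\<And>T x. T \<in> \<tau> \<Longrightarrow> x \<in> T \<Longrightarrow> u x = inner (a T) x + k T"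
    using Vh_affine[OF u] by blast
  obtain b m where b: "\<And>T x. T \<in> \<tau> \<Longrightarrow> x \<in> T \<Longrightarrow> v x = inner (b T) x + m T"
    using Vh_affine[OF v] by blast
  have "P1_on T (\<lambda>x. u x + c * v x)" if T: "T \<in> \<tau>" for T
    unfolding P1_on_def
  proof (intro exI ballI)
    show "u x + c * v x = inner (a T + c *\<^sub>R b T) x + (k T + c * m T)" if "x \<in> T" for x
      using a[OF T that] b[OF T that] by (simp add: inner_add_left algebra_simps)
  qed
  moreover have "continuous_on (closure \<Omega>) (\<lambda>x. u x + c * v x)"
    using u v by (intro continuous_intros) (auto simp: Vh_def)
  ultimately show "(\<lambda>x. u x + c * v x) \<in> Vh \<Omega> \<tau>" using u v by (simp add: Vh_def)
qed

lemma finite_measure_domain: "finite_measure (lebesgue_on \<Omega>)"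
  by (rule finite_measure_lebesgue_on[OF lmeasurable_open[OF bounded_domain open_domain]])

lemma Vh_subset_L2:
  assumes "finite_measure N" and meas: "\<And>f :: 'a \<Rightarrow> real. f \<in> borel_measurable borel \<Longrightarrow> f \<in> borel_measurable N"
  shows "Vh \<Omega> \<tau> \<subseteq> L2 N"
proof
  fix v assume v: "v \<in> Vh \<Omega> \<tau>"
  obtain C where C: "0 \<le> C" "\<And>x. \<bar>v x\<bar> \<le> C" using v by (rule Vh_bounded) blast
  have m: "v \<in> borel_measurable N" by (rule meas[OF Vh_measurable[OF v]])
  have "integrable N (\<lambda>x. (v x)\<^sup>2)"
  proof (rule finite_measure.integrable_const_bound[OF assms(1)])
    show "AE x in N. norm ((v x)\<^sup>2) \<le> C\<^sup>2"
      using power_mono[OF C(2) abs_ge_zero, where n = 2] by simp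
  qed (use m in simp)
  then show "v \<in> L2 N" using m by (simp add: L2_def)
qed

lemma measurable_lebesgue_on_domain:
  fixes f :: "'a \<Rightarrow> 'b::euclidean_space"
  shows "f \<in> borel_measurable borel \<Longrightarrow> f \<in> borel_measurable (lebesgue_on \<Omega>)"
  by (intro measurable_restrict_space1 measurable_completion) simp

lemma Vh_L2_domain: "Vh \<Omega> \<tau> \<subseteq> L2 (lebesgue_on \<Omega>)"
  by (rule Vh_subset_L2[OF finite_measure_domain measurable_lebesgue_on_domain])

text \<open>
  The weak gradient is an arbitrary choice among functions that agree almost everywhere; its measurability comes from
  completeness of Lebesgue measure.
\<close>
lemma dirichlet_form_grad:
  assumes u: "u \<in> Vh \<Omega> \<tau>" and v: "v \<in> Vh \<Omega> \<tau>"
  shows "dirichlet_form \<Omega> u v = (LINT x|lebesgue_on \<Omega>. inner (grad u x) (grad v x))"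
proof -
  have Om: "\<Omega> \<inter> space lebesgue \<in> sets lebesgue" using open_domain by simp
  let ?f = "\<lambda>x. indicator \<Omega> x *\<^sub>R inner (grad u x) (grad v x) :: real"
  let ?g = "\<lambda>x. indicator \<Omega> x *\<^sub>R inner (weak_gradient \<Omega> u x) (weak_gradient \<Omega> v x) :: real"
  have [measurable]: "grad u \<in> borel_measurable borel" "grad v \<in> borel_measurable borel" "\<Omega> \<in> sets borel"
    using grad_measurable[OF u] grad_measurable[OF v] open_domain by auto
  have "?f \<in> borel_measurable lborel" by measurable
  then have f: "?f \<in> borel_measurable lebesgue" by (rule measurable_completion)
  have "AE x in lebesgue. x \<in> \<Omega> \<longrightarrow> weak_gradient \<Omega> u x = grad u x"
    "AE x in lebesgue. x \<in> \<Omega> \<longrightarrow> weak_gradient \<Omega> v x = grad v x"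
    using AE_weak_gradient[OF u] AE_weak_gradient[OF v] by (simp_all add: AE_restrict_space_iff[OF Om])
  then have ae: "AE x in lebesgue. ?f x = ?g x"
    by eventually_elim (auto simp: indicator_def)
  have g: "?g \<in> borel_measurable lebesgue" by (rule borel_measurable_AE[OF f ae])
  have "(LINT x|lebesgue. ?g x) = (LINT x|lebesgue. ?f x)"
    using ae by (intro integral_cong_AE g f) (auto elim: eventually_mono)
  then show ?thesis by (simp only: dirichlet_form_def integral_restrict_space[OF Om])
qed

lemma grad_product_integrable:
  assumes u: "u \<in> Vh \<Omega> \<tau>" and v: "v \<in> Vh \<Omega> \<tau>"
  shows "integrable (lebesgue_on \<Omega>) (\<lambda>x. inner (grad u x) (grad v x))"
proof -
  obtain L where L: "0 \<le> L" "\<And>x. norm (grad u x) \<le> L" using u by (rule grad_bounded) blast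
  obtain K where K: "0 \<le> K" "\<And>x. norm (grad v x) \<le> K" using v by (rule grad_bounded) blast
  have [measurable]: "grad u \<in> borel_measurable borel" "grad v \<in> borel_measurable borel"
    using grad_measurable[OF u] grad_measurable[OF v] by auto
  have m: "(\<lambda>x. inner (grad u x) (grad v x)) \<in> borel_measurable (lebesgue_on \<Omega>)"
    by (rule measurable_lebesgue_on_domain) measurable
  show ?thesis
  proof (rule finite_measure.integrable_const_bound[OF finite_measure_domain _ m])
    show "AE x in lebesgue_on \<Omega>. norm (inner (grad u x) (grad v x)) \<le> L * K"
    proof (intro AE_I2)
      fix x
      have "\<bar>inner (grad u x) (grad v x)\<bar> \<le> norm (grad u x) * norm (grad v x)"
        by (rule Cauchy_Schwarz_ineq2)
      also have "\<dots> \<le> L * K" by (intro mult_mono L K) simp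
      finally show "norm (inner (grad u x) (grad v x)) \<le> L * K" by simp
    qed
  qed
qed

lemma semi_inner_dirichlet: "semi_inner (Vh \<Omega> \<tau>) (dirichlet_form \<Omega>)"
proof -
  interpret V: function_space "Vh \<Omega> \<tau>" by (rule function_space_Vh)
  show ?thesis
  proof
    fix u v w c assume u: "u \<in> Vh \<Omega> \<tau>" and v: "v \<in> Vh \<Omega> \<tau>" and w: "w \<in> Vh \<Omega> \<tau>"
    show "dirichlet_form \<Omega> (\<lambda>x. u x + c * v x) w = dirichlet_form \<Omega> u w + c * dirichlet_form \<Omega> v w"
      using grad_product_integrable[OF u w] grad_product_integrable[OF v w]
      by (simp add: dirichlet_form_grad[OF V.lincomb_mem[OF u v] w] dirichlet_form_grad[OF u w]
          dirichlet_form_grad[OF v w] grad_lincomb[OF u v] inner_add_left)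
  qed (auto simp: dirichlet_form_def inner_commute)
qed

text \<open>
  The affine pieces have zero gradient, so the function takes finitely many values; being continuous on a
  connected set, it is constant.
\<close>
lemma Vh_constant_if_dirichlet_null:
  assumes u: "u \<in> Vh \<Omega> \<tau>" and 0: "dirichlet_form \<Omega> u u = 0"
  obtains c where "\<And>x. x \<in> closure \<Omega> \<Longrightarrow> u x = c"
proof -
  obtain a c where a: "\<And>T x. T \<in> \<tau> \<Longrightarrow> x \<in> T \<Longrightarrow> u x = inner (a T) x + c T"
    using Vh_affine[OF u] by blast
  have "AE x in lebesgue_on \<Omega>. inner (grad u x) (grad u x) = 0"
    using 0 integral_nonneg_eq_0_iff_AE[OF grad_product_integrable[OF u u]]
    by (simp add: dirichlet_form_grad[OF u u])
  then have ae: "AE x in lebesgue. x \<in> \<Omega> \<longrightarrow> grad u x = 0"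
    using open_domain by (simp add: AE_restrict_space_iff)
  have a0: "a T = 0" if T: "T \<in> \<tau>" for T
  proof (rule ccontr)
    assume "a T \<noteq> 0"
    then have "grad u x \<noteq> 0" if "x \<in> interior T" for x
      using grad_affine(2)[OF T a[OF T] that] by simp
    then have "AE x in lebesgue. x \<notin> interior T \<inter> \<Omega>"
      using ae by (auto elim: eventually_mono)
    moreover have op: "open (interior T \<inter> \<Omega>)" using open_domain by blast
    ultimately have "negligible (interior T \<inter> \<Omega>)"
      by (simp add: negligible_iff_null_sets AE_iff_null_sets)
    moreover have "interior T \<inter> \<Omega> \<noteq> {}"
      using interior_simplex[OF T] interior_subset[of T] simplex_subset[OF T]
        open_Int_closure_eq_empty[OF open_interior, of T \<Omega>] by blast
    ultimately show False using open_not_negligible[OF op] by blast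
  qed
  have "u ` closure \<Omega> \<subseteq> c ` \<tau>"
    unfolding mesh_cover[symmetric] using a a0 by auto
  then have "finite (u ` closure \<Omega>)" using finite_mesh finite_surj by blast
  moreover have "continuous_on (closure \<Omega>) u" using u by (simp add: Vh_def)
  moreover have "connected (closure \<Omega>)" by (rule connected_imp_connected_closure[OF connected_domain])
  ultimately have "u constant_on closure \<Omega>" using continuous_finite_range_constant by blast
  then obtain k where "\<And>x. x \<in> closure \<Omega> \<Longrightarrow> u x = k" unfolding constant_on_def by blast
  then show ?thesis by (rule that)
qed

text \<open>The vertices of the mesh determine the function on each simplex, which is their convex hull.\<close>
lemma Vh_determined_by_finite_set:
  obtains X where "finite X" "\<And>u. u \<in> Vh \<Omega> \<tau> \<Longrightarrow> (\<And>x. x \<in> X \<Longrightarrow> u x = 0) \<Longrightarrow> u = (\<lambda>_. 0)"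
proof -
  have "\<forall>T\<in>\<tau>. \<exists>C. finite C \<and> T = convex hull C" using simplexE by metis
  then obtain C where C: "\<forall>T\<in>\<tau>. finite (C T) \<and> T = convex hull (C T)" by (rule bchoice[THEN exE])
  show ?thesis
  proof (rule that)
    show "finite (\<Union>T\<in>\<tau>. C T)" using C finite_mesh by simp
    fix u assume u: "u \<in> Vh \<Omega> \<tau>" and 0: "\<And>x. x \<in> (\<Union>T\<in>\<tau>. C T) \<Longrightarrow> u x = 0"
    obtain a c where a: "\<And>T x. T \<in> \<tau> \<Longrightarrow> x \<in> T \<Longrightarrow> u x = inner (a T) x + c T"
      using Vh_affine[OF u] by blast
    have "u x = 0" if T: "T \<in> \<tau>" and x: "x \<in> T" for x T
    proof -
      have hull: "T = convex hull C T" using C T by blast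
      have sub: "C T \<subseteq> T" using hull_subset[of "C T" convex] hull by simp
      have "C T \<subseteq> {x. inner (a T) x = - c T}"
      proof
        fix y assume y: "y \<in> C T"
        then have "u y = 0" using 0 T by blast
        then show "y \<in> {x. inner (a T) x = - c T}" using a[OF T, of y] sub y by auto
      qed
      then have "convex hull C T \<subseteq> {x. inner (a T) x = - c T}"
        by (rule hull_minimal) (rule convex_hyperplane)
      then have "inner (a T) x = - c T" using x hull by blast
      then show ?thesis using a[OF T x] by simp
    qed
    then have "u x = 0" if "x \<in> closure \<Omega>" for x using that mesh_cover by blast
    moreover have "u x = 0" if "x \<notin> closure \<Omega>" for x using u that by (simp add: Vh_def)
    ultimately show "u = (\<lambda>_. 0)" by blast
  qed
qed

end

theorem theorem16:
  fixes \<Omega> \<Gamma>1 \<Gamma>2 :: "'a::euclidean_space set"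
    and \<tau> :: "'a set set"
    and h b M :: real
    and g zd q_op :: "'a \<Rightarrow> real"
    and qa_op :: "real \<Rightarrow> 'a \<Rightarrow> real"
  assumes "polygonal_domain \<Omega>" and "lipschitz_boundary \<Omega>"
    and "\<Gamma>1 \<in> sets borel" and "\<Gamma>2 \<in> sets borel"
    and "frontier \<Omega> = \<Gamma>1 \<union> \<Gamma>2" and "\<Gamma>1 \<inter> \<Gamma>2 = {}"
    and "0 < emeasure (surface_measure \<Gamma>1) \<Gamma>1" and "0 < emeasure (surface_measure \<Gamma>2) \<Gamma>2"
    and "0 < b" and "0 < M"
    and "g \<in> L2 (lebesgue_on \<Omega>)" and "zd \<in> L2 (lebesgue_on \<Omega>)"
    and "0 < h" and "triangulation_of \<Omega> h \<tau>"
    and "is_arg_min (cost_h \<Omega> \<Gamma>1 \<Gamma>2 \<tau> b g zd M) (\<lambda>q. q \<in> L2 (surface_measure \<Gamma>2)) q_op"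
    and "\<And>\<alpha>. 0 < \<alpha> \<Longrightarrow>
           is_arg_min (cost_ha \<Omega> \<Gamma>1 \<Gamma>2 \<tau> b g zd M \<alpha>) (\<lambda>q. q \<in> L2 (surface_measure \<Gamma>2)) (qa_op \<alpha>)"
  shows "((\<lambda>\<alpha>. H1_norm \<Omega> (\<lambda>x. state_ha \<Omega> \<Gamma>1 \<Gamma>2 \<tau> b g \<alpha> (qa_op \<alpha>) x
                               - state_h \<Omega> \<Gamma>1 \<Gamma>2 \<tau> b g q_op x)) \<longlongrightarrow> 0) at_top \<and>
         ((\<lambda>\<alpha>. H1_norm \<Omega> (\<lambda>x. adjoint_ha \<Omega> \<Gamma>1 \<Gamma>2 \<tau> b g zd \<alpha> (qa_op \<alpha>) x
                               - adjoint_h \<Omega> \<Gamma>1 \<Gamma>2 \<tau> b g zd q_op x)) \<longlongrightarrow> 0) at_top \<and>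
         ((\<lambda>\<alpha>. L2_norm (surface_measure \<Gamma>2) (\<lambda>x. qa_op \<alpha> x - q_op x)) \<longlongrightarrow> 0) at_top"
proof -
  have dom: "open \<Omega>" "connected \<Omega>" "bounded \<Omega>" using assms(1) by (auto simp: polygonal_domain_def)
  have tri: "finite \<tau>" "\<And>T. T \<in> \<tau> \<Longrightarrow> int DIM('a) simplex T" "\<Union>\<tau> = closure \<Omega>"
    using \<open>triangulation_of \<Omega> h \<tau>\<close> by (auto simp: triangulation_of_def triangulation_def)
  interpret mesh \<Omega> \<tau> by unfold_locales (use dom tri in auto)
  let ?V = "Vh \<Omega> \<tau>" and ?W = "V0h \<Omega> \<Gamma>1 \<tau>"
  let ?S = "surface_measure \<Gamma>1" and ?R = "surface_measure \<Gamma>2" and ?H = "lebesgue_on \<Omega>"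
  define \<beta> where "\<beta> = (\<lambda>x. b * indicator (closure \<Omega>) x :: real)"
  have fin1: "finite_measure ?S" and fin2: "finite_measure ?R"
    by (rule finite_surface_measure[OF dom(1,3) assms(2)]; use assms(3,4,5) in auto)+
  have meas: "f \<in> borel_measurable (surface_measure S)" if "f \<in> borel_measurable borel"
    for f :: "'a \<Rightarrow> real" and S
    unfolding surface_measure_def using that by (intro measurable_restrict_space1) simp
  have V_1: "?V \<subseteq> L2 ?S" by (rule Vh_subset_L2[OF fin1 meas])
  have V_2: "?V \<subseteq> L2 ?R" by (rule Vh_subset_L2[OF fin2 meas])
  have sub1: "\<Gamma>1 \<subseteq> closure \<Omega>" using assms(5) unfolding frontier_def by blast
  obtain X where X: "finite X" "\<And>u. u \<in> ?V \<Longrightarrow> (\<And>x. x \<in> X \<Longrightarrow> u x = 0) \<Longrightarrow> u = (\<lambda>_. 0)"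
    by (rule Vh_determined_by_finite_set) blast
  interpret A: semi_inner ?V "dirichlet_form \<Omega>" by (rule semi_inner_dirichlet)
  interpret G: semi_inner ?V "L2_inner ?S"
    by (rule semi_inner.semi_inner_subset[OF semi_inner_L2 function_space_Vh V_1])
  interpret H: semi_inner "L2 ?H" "L2_inner ?H" by (rule semi_inner_L2)
  interpret Q: semi_inner "L2 ?R" "L2_inner ?R" by (rule semi_inner_L2)
  have coercive: "u = (\<lambda>_. 0)"
    if u: "u \<in> ?V" "dirichlet_form \<Omega> u u = 0" "L2_inner ?S u u = 0" for u
  proof -
    obtain c where c: "\<And>x. x \<in> closure \<Omega> \<Longrightarrow> u x = c"
      using u(1,2) by (rule Vh_constant_if_dirichlet_null) blast
    have sp: "space ?S = \<Gamma>1" by (simp add: surface_measure_def space_restrict_space)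
    have "AE x in ?S. u x = 0" using u(1,3) V_1 L2_inner_null_iff by blast
    moreover have "AE x in ?S. x \<in> \<Gamma>1" using AE_space[of ?S] sp by simp
    ultimately have "AE x in ?S. c = 0" by eventually_elim (use c sub1 in auto)
    moreover have "emeasure ?S (space ?S) \<noteq> 0" using assms(7) sp by simp
    ultimately have "c = 0" using emeasure_eq_0_AE[where M = ?S and P = "\<lambda>_. c \<noteq> 0"] by (cases "c = 0") auto
    then show ?thesis using u(1) c by (auto simp: Vh_def fun_eq_iff)
  qed
  have \<beta>V: "\<beta> \<in> ?V"
  proof -
    have "continuous_on (closure \<Omega>) (\<lambda>_. b) \<longleftrightarrow> continuous_on (closure \<Omega>) \<beta>"
      by (rule continuous_on_cong) (auto simp: \<beta>_def)
    moreover have "P1_on T \<beta>" if "T \<in> \<tau>" for T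
      unfolding P1_on_def by (intro exI[of _ 0] exI[of _ b]) (use simplex_subset[OF that] in \<open>auto simp: \<beta>_def\<close>)
    ultimately show ?thesis by (auto simp: Vh_def \<beta>_def)
  qed
  interpret P: penalised_control ?V "dirichlet_form \<Omega>" "L2_inner ?S" X "L2 ?H" "L2_inner ?H" "L2 ?R"
    "L2_inner ?R" \<beta> g zd M
  proof
    show "u = (\<lambda>_. 0)" if "u \<in> ?V" "\<And>x. x \<in> X \<Longrightarrow> u x = 0" for u
      using that by (rule X(2))
    show "u = (\<lambda>_. 0)" if "u \<in> ?V" "dirichlet_form \<Omega> u u = 0" "L2_inner ?S u u = 0" for u
      using that by (rule coercive)
  qed (fact X(1) Vh_L2_domain V_2 \<beta>V assms(10,11,12))+
  have V0: "P.V0 = ?W"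
    unfolding P.V0_def V0h_def using V_1 L2_inner_null_iff by blast
  have K: "Kh \<Omega> \<Gamma>1 \<tau> b = {u. \<exists>v\<in>?W. u = (\<lambda>x. \<beta> x + v x)}"
    unfolding Kh_def \<beta>_def by blast
  have G\<beta>: "L2_inner ?S (\<lambda>x. b) v = L2_inner ?S \<beta> v" for v
    unfolding L2_inner_def
    by (rule Bochner_Integration.integral_cong)
      (use sub1 in \<open>auto simp: \<beta>_def surface_measure_def space_restrict_space\<close>)
  have state: "P.is_state q (state_h \<Omega> \<Gamma>1 \<Gamma>2 \<tau> b g q)" if q: "q \<in> L2 ?R" for q
  proof -
    have "state_h \<Omega> \<Gamma>1 \<Gamma>2 \<tau> b g q = (THE u. P.is_state q u)"
      unfolding state_h_def P.is_state_def V0 K mem_Collect_eq ..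
    then show ?thesis using theI'[OF P.ex1_state[OF q]] by simp
  qed
  have adjoint: "P.is_adjoint (state_h \<Omega> \<Gamma>1 \<Gamma>2 \<tau> b g q) (adjoint_h \<Omega> \<Gamma>1 \<Gamma>2 \<tau> b g zd q)"
    if q: "q \<in> L2 ?R" for q
  proof -
    have "adjoint_h \<Omega> \<Gamma>1 \<Gamma>2 \<tau> b g zd q = (THE p. P.is_adjoint (state_h \<Omega> \<Gamma>1 \<Gamma>2 \<tau> b g q) p)"
      unfolding adjoint_h_def P.is_adjoint_def V0 ..
    then show ?thesis using theI'[OF P.ex1_adjoint[OF P.is_state_V[OF state[OF q]]]] by simp
  qed
  have pstate: "P.is_penalised_state \<alpha> q (state_ha \<Omega> \<Gamma>1 \<Gamma>2 \<tau> b g \<alpha> q)"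
    if \<alpha>: "0 < \<alpha>" and q: "q \<in> L2 ?R" for \<alpha> q
  proof -
    have "state_ha \<Omega> \<Gamma>1 \<Gamma>2 \<tau> b g \<alpha> q = (THE u. P.is_penalised_state \<alpha> q u)"
      unfolding state_ha_def P.is_penalised_state_def P.E_def robin_form_def G\<beta> ..
    then show ?thesis using theI'[OF P.ex1_penalised_state[OF q \<alpha>]] by simp
  qed
  have padjoint: "P.is_penalised_adjoint \<alpha> (state_ha \<Omega> \<Gamma>1 \<Gamma>2 \<tau> b g \<alpha> q) (adjoint_ha \<Omega> \<Gamma>1 \<Gamma>2 \<tau> b g zd \<alpha> q)"
    if \<alpha>: "0 < \<alpha>" and q: "q \<in> L2 ?R" for \<alpha> q
  proof -
    have V: "state_ha \<Omega> \<Gamma>1 \<Gamma>2 \<tau> b g \<alpha> q \<in> ?V"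
      using pstate[OF \<alpha> q] by (simp add: P.is_penalised_state_def)
    have "adjoint_ha \<Omega> \<Gamma>1 \<Gamma>2 \<tau> b g zd \<alpha> q
        = (THE p. P.is_penalised_adjoint \<alpha> (state_ha \<Omega> \<Gamma>1 \<Gamma>2 \<tau> b g \<alpha> q) p)"
      unfolding adjoint_ha_def P.is_penalised_adjoint_def P.E_def robin_form_def ..
    then show ?thesis using theI'[OF P.ex1_penalised_adjoint[OF V \<alpha>]] by simp
  qed
  have costs: "1 / 2 * (L2_norm ?H (\<lambda>x. u x - zd x))\<^sup>2 + M / 2 * (L2_norm ?R q)\<^sup>2 = P.cost u q"
    if "u \<in> ?V" "q \<in> L2 ?R" for u q
    using H.nonneg[OF H.diff_mem[OF P.memH[OF that(1)] assms(12)]] Q.nonneg[OF that(2)]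
    by (simp add: P.cost_def L2_norm_def)
  have qo: "q_op \<in> L2 ?R" using assms(15) by (simp add: is_arg_min_def)
  have qa: "qa_op \<alpha> \<in> L2 ?R" if "0 < \<alpha>" for \<alpha> using assms(16)[OF that] by (simp add: is_arg_min_def)
  have cost_h: "cost_h \<Omega> \<Gamma>1 \<Gamma>2 \<tau> b g zd M q = P.cost (state_h \<Omega> \<Gamma>1 \<Gamma>2 \<tau> b g q) q"
    if "q \<in> L2 ?R" for q
    unfolding cost_h_def by (rule costs[OF P.is_state_V[OF state[OF that]] that])
  have cost_ha: "cost_ha \<Omega> \<Gamma>1 \<Gamma>2 \<tau> b g zd M \<alpha> q = P.cost (state_ha \<Omega> \<Gamma>1 \<Gamma>2 \<tau> b g \<alpha> q) q"
    if "0 < \<alpha>" "q \<in> L2 ?R" for \<alpha> q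
    unfolding cost_ha_def
    by (rule costs[OF _ that(2)]) (use pstate[OF that] in \<open>simp add: P.is_penalised_state_def\<close>)
  have opt: "P.cost (state_h \<Omega> \<Gamma>1 \<Gamma>2 \<tau> b g q_op) q_op \<le> P.cost (state_h \<Omega> \<Gamma>1 \<Gamma>2 \<tau> b g q) q"
    if "q \<in> L2 ?R" for q
    using assms(15) that cost_h[OF that] cost_h[OF qo] by (auto simp: is_arg_min_def not_less)
  have opta: "P.cost (state_ha \<Omega> \<Gamma>1 \<Gamma>2 \<tau> b g \<alpha> (qa_op \<alpha>)) (qa_op \<alpha>) \<le> P.cost (state_ha \<Omega> \<Gamma>1 \<Gamma>2 \<tau> b g \<alpha> q) q"
    if "0 < \<alpha>" "q \<in> L2 ?R" for \<alpha> q
    using assms(16)[OF that(1)] that cost_ha[OF that] cost_ha[OF that(1) qa[OF that(1)]]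
    by (auto simp: is_arg_min_def not_less)
  \<comment> \<open>the abstract result bounds the energy norm; on \<open>V\<close> it dominates the norm of \<open>H\<^sup>1\<close> up to a constant\<close>
  note lim = P.convergence[OF qo qa state pstate adjoint[OF qo] padjoint[OF _ qa] opt opta]
  define N where "N = (\<lambda>u v. L2_inner ?H u v + dirichlet_form \<Omega> u v)"
  have N: "semi_inner ?V N"
  proof
    fix u v w c assume uvw: "u \<in> ?V" "v \<in> ?V" "w \<in> ?V"
    show "N (\<lambda>x. u x + c * v x) w = N u w + c * N v w"
      using uvw by (simp add: N_def H.lincomb_left A.lincomb_left P.memH algebra_simps)
  next
    fix u v assume "u \<in> ?V" "v \<in> ?V"
    then show "N u v = N v u" by (simp add: N_def H.sym[of u v] A.sym[of u v] P.memH)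
  next
    fix u assume "u \<in> ?V"
    then show "0 \<le> N u u" by (simp add: N_def H.nonneg A.nonneg P.memH)
  qed
  then interpret N: semi_inner ?V N .
  have H1: "H1_norm \<Omega> u = N.nrm u" if u: "u \<in> ?V" for u
    unfolding H1_norm_def N.nrm_def
    using H.nonneg[OF P.memH[OF u]] by (simp add: N_def L2_norm_def dirichlet_form_def power2_norm_eq_inner)
  obtain C where C: "0 \<le> C" "\<And>u. u \<in> ?V \<Longrightarrow> N.nrm u \<le> C * P.E.nrm u"
    using P.E.seminorm_bounded[OF N order_refl] by blast
  have H1_lim: "((\<lambda>\<alpha>. H1_norm \<Omega> (d \<alpha>)) \<longlongrightarrow> 0) at_top"
    if d: "\<And>\<alpha>. 0 < \<alpha> \<Longrightarrow> d \<alpha> \<in> ?V" and lim: "((\<lambda>\<alpha>. P.E.nrm (d \<alpha>)) \<longlongrightarrow> 0) at_top"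
    for d :: "real \<Rightarrow> 'a \<Rightarrow> real"
  proof (rule tendsto_sandwich[OF _ _ tendsto_const tendsto_mult_right_zero[OF lim, of C]])
    have ev: "\<forall>\<^sub>F \<alpha> :: real in at_top. 0 < \<alpha>" by (rule eventually_gt_at_top)
    show "\<forall>\<^sub>F \<alpha> in at_top. 0 \<le> H1_norm \<Omega> (d \<alpha>)"
      using ev by eventually_elim (simp add: H1 d N.nrm_nonneg)
    show "\<forall>\<^sub>F \<alpha> in at_top. H1_norm \<Omega> (d \<alpha>) \<le> C * P.E.nrm (d \<alpha>)"
      using ev by eventually_elim (simp add: H1 d C(2))
  qed
  have "((\<lambda>\<alpha>. H1_norm \<Omega> (\<lambda>x. state_ha \<Omega> \<Gamma>1 \<Gamma>2 \<tau> b g \<alpha> (qa_op \<alpha>) x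
                               - state_h \<Omega> \<Gamma>1 \<Gamma>2 \<tau> b g q_op x)) \<longlongrightarrow> 0) at_top"
    by (rule H1_lim[OF A.diff_mem[OF _ P.is_state_V[OF state[OF qo]]] lim(1)])
      (use pstate[OF _ qa] in \<open>simp add: P.is_penalised_state_def\<close>)
  moreover have "((\<lambda>\<alpha>. H1_norm \<Omega> (\<lambda>x. adjoint_ha \<Omega> \<Gamma>1 \<Gamma>2 \<tau> b g zd \<alpha> (qa_op \<alpha>) x
                               - adjoint_h \<Omega> \<Gamma>1 \<Gamma>2 \<tau> b g zd q_op x)) \<longlongrightarrow> 0) at_top"
    by (rule H1_lim[OF A.diff_mem[OF _ P.memV] lim(2)])
      (use padjoint[OF _ qa] adjoint[OF qo] in \<open>simp_all add: P.is_penalised_adjoint_def P.is_adjoint_def\<close>)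
  moreover have "((\<lambda>\<alpha>. L2_norm ?R (\<lambda>x. qa_op \<alpha> x - q_op x)) \<longlongrightarrow> 0) at_top"
    unfolding L2_norm_def Q.nrm_def[symmetric] by (rule lim(3))
  ultimately show ?thesis by blast
qed

end
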